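(* Consider the polling system with $K$ queues and an $I$-stage polling table operating under the binomial-exhaustive policy with parameter $\mathbf r\in\mathcal R$, as described in the context. Then $\mathbb E[Q_j(A_i)Q_k(A_i)]<\infty$ for all $i\in\mathcal I$ and $j,k\in\mathcal K$ if and only if $\mathbb E[S_k^2]<\infty$ for all $k\in\mathcal K$ and $\mathbb E[V_i^2]<\infty$ for all $i\in\mathcal I$.
   Context: Model. A single server attends $K$ queues, indexed by $\mathcal K=\{1,\dots,K\}$. Customers arrive at queue $k$ according to a Poisson process with rate $\lambda_k>0$ and wait in an infinite buffer. Service times at queue $k$ are i.i.d., distributed as a nonnegative random variable $S_k$ with mean $1/\mu_k<\infty$. The server visits queues according to a polling table with $I\ge K$ stages, $\mathcal I=\{1,\dots,I\}$; $p:\mathcal I\to\mathcal K$ maps a stage to the queue visited at that stage. Stages are visited cyclically $1,2,\dots,I,1,2,\dots$. Each transition from stage $i$ to the next stage (stage $I+1$ meaning stage $1$) incurs a switchover time distributed as a nonnegative random variable $V_i$ with finite mean $s_i$; $s:=\sum_{i\in\mathcal I}s_i>0$. All arrival processes, service times and switchover times are mutually independent. Put $\rho_k:=\lambda_k/\mu_k$, $\rho:=\sum_{k\in\mathcal K}\rho_k$, and assume $\rho<1$. Binomial-exhaustive policy (BEP). It has a parameter $\mathbf r=(r_1,\dots,r_I)\in\mathcal R:=\{\mathbf r\in[0,1]^I:\ \sum_{i\in\mathcal I:\,p(i)=k}r_i>0\text{ for all }k\in\mathcal K\}$. If the server finds $N$ customers in queue $p(i)$ at the start of a visit at stage $i$,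 then it serves queue $p(i)$ until its queue length is reduced to $N-Y_i(N,r_i)$, where $Y_i(N,r_i)$ is a binomial random variable with parameters $N$ and $r_i$, independent of everything else. (Equivalently, each of the $N$ customers is independently selected with probability $r_i$, and each selected customer generates an independent $M/G/1$ busy period with arrival rate $\lambda_{p(i)}$ and service times distributed as $S_{p(i)}$.) Steady state. The polling epoch of a stage is the starting time of the visit; a cycle is the time between consecutive polling epochs of stage $1$. $Q_k(t)$ is the number of customers in queue $k$ at time $t$ and $Q(t)=(Q_k(t))_{k\in\mathcal K}$. Since $\rho<1$, the chain of queue-length vectors embedded at the successive polling epochs of stage $1$ is an ergodic discrete-time Markov chain whose stationary distribution has finite mean, and the system is considered in the corresponding steady state; $A_i$ denotes a generic polling epoch of stage $i$ in steady state, so $Q(A_i)$ has the stationary distribution of the queue-length vector at the polling epochs of stage $i$.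
   Formalization: The number of queues K is assumed to be at least 2; for K = 1 the equivalence fails, since the queue lengths at polling epochs then do not depend on the service times (e.g. K = I = 1, r = 1, V = 1, E[S²] = ∞). *)

theory Defs
  imports "HOL-Probability.Probability"
begin

text \<open>
  Poisson process of rate \<open>l\<close> on the time axis \<open>[0, \<infinity>)\<close>; \<open>N t\<close> is the number of points in \<open>(0, t]\<close>.
  Values at negative times are irrelevant and left unconstrained.
\<close>

definition (in prob_space) poisson_process :: "(real \<Rightarrow> 'a \<Rightarrow> nat) \<Rightarrow> real \<Rightarrow> bool" where
  "poisson_process N l \<longleftrightarrow>
     (\<forall>t\<ge>0. random_variable (count_space UNIV) (N t)) \<and>
     (\<forall>\<omega>\<in>space M. N 0 \<omega> = 0 \<and> mono_on {0..} (\<lambda>t. N t \<omega>) \<and>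
        (\<forall>t\<ge>0. continuous (at_right t) (\<lambda>u. N u \<omega>))) \<and>
     (\<forall>t u. 0 \<le> t \<and> t < u \<longrightarrow>
        distr M (count_space UNIV) (\<lambda>\<omega>. N u \<omega> - N t \<omega>)
          = measure_pmf (poisson_pmf (l * (u - t)))) \<and>
     (\<forall>\<tau>. mono \<tau> \<and> 0 \<le> \<tau> 0 \<longrightarrow>
        indep_vars (\<lambda>_. count_space UNIV) (\<lambda>n \<omega>. N (\<tau> (Suc n)) \<omega> - N (\<tau> n) \<omega>) (UNIV :: nat set))"

text \<open>
  Visits are numbered \<open>0, 1, 2, \<dots>\<close> and stages \<open>1, \<dots>, I\<close>; cycle \<open>c\<close> consists of the visits
  \<open>c * I, \<dots>, c * I + (I - 1)\<close>, so the visit \<open>c * I\<close> is one at stage 1.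
\<close>

definition stage :: "nat \<Rightarrow> nat \<Rightarrow> nat" where
  "stage I v = Suc (v mod I)"

text \<open>
  Number of services in a visit that starts at time \<open>a\<close> with \<open>n\<close> customers present and that ends
  when the queue length has been reduced to \<open>n - y\<close>. Here \<open>A\<close> is the arrival counting path of the
  visited queue and \<open>\<sigma>\<close> the sequence of successive service times, so that upon completion of the
  \<open>m\<close>-th service the queue length is \<open>n + (arrivals in (a, a + \<sigma> 0 + \<dots> + \<sigma> (m - 1)]) - m\<close>. Counting
  services rather than looking at hitting times in \<open>t\<close> treats services of length zero correctly.
  Under the assumptions below the defining set is nonempty almost surely.
\<close>

definition visit_services ::
    "(real \<Rightarrow> nat) \<Rightarrow> real \<Rightarrow> (nat \<Rightarrow> real) \<Rightarrow> nat \<Rightarrow> nat \<Rightarrow> nat" where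
  "visit_services A a \<sigma> n y =
     (LEAST m. n + (A (a + (\<Sum>l<m. \<sigma> l)) - A a) = (n - y) + m)"

text \<open>
  Sample path of the system at the polling epochs: \<open>polling_epoch I p N S V Y q0 v\<close> is the pair of
  the starting time of visit \<open>v\<close> and the queue-length vector at that time. The arguments are sample
  paths: \<open>N k t\<close> counts the arrivals at queue \<open>k\<close> in \<open>(0, t]\<close>, \<open>S v l\<close> is the length of the
  \<open>l\<close>-th service given in visit \<open>v\<close>, \<open>V v\<close> the switchover time after visit \<open>v\<close>, and \<open>Y v n\<close> the
  value of the binomial variable that is used if visit \<open>v\<close> starts with \<open>n\<close> customers in the visited
  queue. Visit 0 starts at time 0 with queue lengths \<open>q0\<close>.
\<close>

primrec polling_epoch ::
    "nat \<Rightarrow> (nat \<Rightarrow> 'k) \<Rightarrow> ('k \<Rightarrow> real \<Rightarrow> nat) \<Rightarrow> (nat \<Rightarrow> nat \<Rightarrow> real) \<Rightarrow> (nat \<Rightarrow> real) \<Rightarrow>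
     (nat \<Rightarrow> nat \<Rightarrow> nat) \<Rightarrow> ('k \<Rightarrow> nat) \<Rightarrow> nat \<Rightarrow> real \<times> ('k \<Rightarrow> nat)" where
  "polling_epoch I p N S V Y q0 0 = (0, q0)"
| "polling_epoch I p N S V Y q0 (Suc v) =
     (let (a, q) = polling_epoch I p N S V Y q0 v;
          k = p (stage I v);
          m = visit_services (N k) a (S v) (q k) (Y v (q k));
          a' = a + (\<Sum>l<m. S v l) + V v
      in (a', \<lambda>j. q j + (N j a' - N j a) - (if j = k then m else 0)))"

datatype 'k source =
  Initial | Arrival 'k | Service nat nat | Switchover nat | Selection nat nat

text \<open>
  The polling table is \<open>p\<close> on \<open>{1..I}\<close>; \<open>S_law k\<close> and \<open>V_law i\<close> are the distributions of the generic
  service time at queue \<open>k\<close> and of the generic switchover time out of stage \<open>i\<close>. The queues are the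
  elements of the finite type \<open>'k\<close>. Since service times are i.i.d. per queue, they may be labelled
  by visit and position within the visit instead of by customer.
\<close>

locale bep_polling_system = prob_space M
  for M :: "'a measure" +
  fixes I :: nat
    and p :: "nat \<Rightarrow> 'k::finite"
    and lam mu :: "'k \<Rightarrow> real"
    and s :: "nat \<Rightarrow> real"
    and S_law :: "'k \<Rightarrow> real measure"
    and V_law :: "nat \<Rightarrow> real measure"
    and r :: "nat \<Rightarrow> real"
    and N :: "'k \<Rightarrow> real \<Rightarrow> 'a \<Rightarrow> nat"
    and S :: "nat \<Rightarrow> nat \<Rightarrow> 'a \<Rightarrow> real"
    and V :: "nat \<Rightarrow> 'a \<Rightarrow> real"
    and Y :: "nat \<Rightarrow> nat \<Rightarrow> 'a \<Rightarrow> nat"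
    and Q0 :: "'a \<Rightarrow> 'k \<Rightarrow> nat"
  assumes stages: "CARD('k) \<le> I"
    and lam_pos: "\<And>k. 0 < lam k"
    and mu_pos: "\<And>k. 0 < mu k"
    and stable: "(\<Sum>k\<in>UNIV. lam k / mu k) < 1"
    and s_sum_pos: "0 < (\<Sum>i\<in>{1..I}. s i)"
    and r_range: "\<And>i. i \<in> {1..I} \<Longrightarrow> r i \<in> {0..1}"
    and r_sum_pos: "\<And>k. 0 < (\<Sum>i\<in>{i \<in> {1..I}. p i = k}. r i)"
    and service_mean: "\<And>k. has_bochner_integral (S_law k) (\<lambda>x. x) (1 / mu k)"
    and switchover_mean: "\<And>i. i \<in> {1..I} \<Longrightarrow> has_bochner_integral (V_law i) (\<lambda>x. x) (s i)"
    and initial_rv: "random_variable (count_space UNIV) Q0"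
    and arrivals: "\<And>k. poisson_process (N k) (lam k)"
    and service_rv: "\<And>v l. random_variable borel (S v l)"
    and service_nonneg: "\<And>v l \<omega>. \<omega> \<in> space M \<Longrightarrow> 0 \<le> S v l \<omega>"
    and service_law: "\<And>v l. distr M borel (S v l) = S_law (p (stage I v))"
    and switchover_rv: "\<And>v. random_variable borel (V v)"
    and switchover_nonneg: "\<And>v \<omega>. \<omega> \<in> space M \<Longrightarrow> 0 \<le> V v \<omega>"
    and switchover_law: "\<And>v. distr M borel (V v) = V_law (stage I v)"
    and selection_rv: "\<And>v n. random_variable (count_space UNIV) (Y v n)"
    and selection_law: "\<And>v n. distr M (count_space UNIV) (Y v n)
          = measure_pmf (binomial_pmf n (r (stage I v)))"
    and independence: "indep_sets (\<lambda>x. case x of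
            Initial \<Rightarrow> sets (vimage_algebra (space M) Q0 (count_space UNIV))
          | Arrival k \<Rightarrow> sets (vimage_algebra (space M) (\<lambda>\<omega>. \<lambda>t\<in>{0..}. N k t \<omega>)
                                (\<Pi>\<^sub>M t\<in>{0..}. count_space UNIV))
          | Service v l \<Rightarrow> sets (vimage_algebra (space M) (S v l) borel)
          | Switchover v \<Rightarrow> sets (vimage_algebra (space M) (V v) borel)
          | Selection v n \<Rightarrow> sets (vimage_algebra (space M) (Y v n) (count_space UNIV)))
        (UNIV :: 'k source set)"
begin

definition queue_at_visit :: "nat \<Rightarrow> 'a \<Rightarrow> 'k \<Rightarrow> nat" where
  "queue_at_visit v \<omega> = snd (polling_epoch I p (\<lambda>k t. N k t \<omega>) (\<lambda>v l. S v l \<omega>) (\<lambda>v. V v \<omega>)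
     (\<lambda>v n. Y v n \<omega>) (Q0 \<omega>) v)"

text \<open>
  The chain of queue-length vectors embedded at the polling epochs of stage 1 is stationary; as the
  initial vector \<open>Q0\<close> is independent of all other primitives, this says that its law is a stationary
  distribution of that Markov chain.
\<close>

definition steady_state :: bool where
  "steady_state \<longleftrightarrow> (\<forall>c. distr M (count_space UNIV) (queue_at_visit (c * I))
                         = distr M (count_space UNIV) Q0)"

text \<open>\<open>Q_at i\<close> is \<open>Q(A\<^sub>i)\<close>, taken in the first cycle; in steady state all cycles are alike.\<close>

definition Q_at :: "nat \<Rightarrow> 'a \<Rightarrow> 'k \<Rightarrow> nat" where
  "Q_at i = queue_at_visit (i - 1)"

end

end

theory Submission
  imports Defs
begin

text \<open>
  The system is observed after every single selection, service and switchover. Each such step consumes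
  one fresh source of randomness and the arrivals during its duration. Along a fixed sequence of
  distinct sources the time points depend on the service and switchover times only, so by independence
  of these from the arrivals the Poisson increments decouple; summing over the countably many possible
  sequences shows that the input of the next step is independent of the history. This replaces the
  strong Markov property at the random polling epochs.

  Sufficiency: let \<open>level\<close> be an upper estimate of the mean work at a target visit. It is a supermartingale whose
  conditional variances are controlled by the decrease of the work, so its square plus a multiple of
  the work has nonpositive drift. Over one cycle every customer is selected with positive probability,
  which makes the level at the start at most \<open>1 - \<epsilon>\<close> times the work, up to a constant. Hence
  \<open>f = work\<^sup>2\<close> satisfies \<open>P f \<le> a f + C\<close> with \<open>a < 1\<close> for the stage-1 chain, and a truncation argument
  bounds \<open>f\<close> under every stationary law; no finite mean is presupposed.

  Necessity: a queue that is not being served collects the Poisson arrivals of each switchover and each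
  service of another queue, and each such step occurs with positive probability. For the services of
  queue \<open>k\<close> this holds because otherwise queue \<open>k\<close> would grow in every cycle.
\<close>

section \<open>Decoupling, stationarity and moments\<close>

text \<open>That there are two queues matters for necessity. With one queue, one stage and
  \<open>r = 1\<close>, every visit empties the queue, so the queue length at a polling epoch is the
  number of arrivals during a switchover and reveals nothing about the services. A queue other than
  \<open>k\<close> is needed as a counter for the services at \<open>k\<close>. For sufficiency, the
  obstacle is that the number of services in a visit has no a priori bound, so conditional variances
  cannot be summed as constants. Each service at \<open>k\<close>, however, lowers the mean work by
  \<open>(1 - load) / mu k\<close>, and a linear term in the work pays for the variance caused by
  that service. A selection adds a variance proportional to the number of customers found; it is
  paid by lowering the coefficient of the linear term. An arrival at the queue in service prolongs
  the busy period and is therefore charged like a selected customer. Requiring mean balance of a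
  service under this charge determines \<open>theta\<close>. The contraction over a cycle rests on
  \<open>theta k < 1\<close>, which is the stability condition \<open>load < 1\<close> in another
  form.\<close>

lemma (in prob_space) nn_integral_diag_indep:
  assumes ind: "indep_set (sets A) (sets B)"
    and A: "space A = space M" "sets A \<subseteq> events" and B: "space B = space M" "sets B \<subseteq> events"
    and h[measurable]: "h \<in> borel_measurable (A \<Otimes>\<^sub>M B)"
  shows "(\<integral>\<^sup>+\<omega>. h (\<omega>, \<omega>) \<partial>M) = (\<integral>\<^sup>+\<omega>. \<integral>\<^sup>+\<omega>'. h (\<omega>, \<omega>') \<partial>M \<partial>M)"
proof -
  \<comment> \<open>The identity is regarded as a random variable with values in the coarser space
    \<open>C\<close>. It generates exactly \<open>sets C\<close>, so independence of two
    sigma-algebras becomes independence of two random variables, and the law of the diagonal is a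
    product measure.\<close>
  have trace: "(\<lambda>x. x) \<in> measurable M C \<and>
      sigma_sets (space M) {(\<lambda>x. x) -` E \<inter> space M |E. E \<in> sets C} = sets C"
    if C: "space C = space M" "sets C \<subseteq> events" for C
  proof -
    have E: "(\<lambda>x. x) -` E \<inter> space M = E" if "E \<in> sets C" for E
      using sets.sets_into_space[OF that] C(1) by auto
    then have "{(\<lambda>x. x) -` E \<inter> space M |E. E \<in> sets C} = sets C" by auto
    moreover have "(\<lambda>x. x) \<in> measurable M C"
      by (rule measurableI) (use C E in auto)
    ultimately show ?thesis using sets.sigma_sets_eq[of C] C(1) by simp
  qed
  note mA[measurable] = trace[OF A, THEN conjunct1] and mB[measurable] = trace[OF B, THEN conjunct1]
  note sA = trace[OF A, THEN conjunct2] and sB = trace[OF B, THEN conjunct2]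
  have "indep_var A (\<lambda>x. x) B (\<lambda>x. x)"
    unfolding indep_var_eq sA sB using ind by simp
  then have eq: "distr M A (\<lambda>x. x) \<Otimes>\<^sub>M distr M B (\<lambda>x. x) = distr M (A \<Otimes>\<^sub>M B) (\<lambda>x. (x, x))"
    unfolding indep_var_distribution_eq by simp
  interpret PB: prob_space "distr M B (\<lambda>x. x)" by (rule prob_space_distr) simp
  have "(\<integral>\<^sup>+\<omega>. h (\<omega>, \<omega>) \<partial>M) = (\<integral>\<^sup>+z. h z \<partial>distr M (A \<Otimes>\<^sub>M B) (\<lambda>x. (x, x)))"
    by (subst nn_integral_distr) auto
  also have "\<dots> = (\<integral>\<^sup>+\<omega>. \<integral>\<^sup>+\<omega>'. h (\<omega>, \<omega>') \<partial>distr M B (\<lambda>x. x) \<partial>distr M A (\<lambda>x. x))"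
    unfolding eq[symmetric] by (subst PB.nn_integral_fst[symmetric]) auto
  also have "\<dots> = (\<integral>\<^sup>+\<omega>. \<integral>\<^sup>+\<omega>'. h (\<omega>, \<omega>') \<partial>distr M B (\<lambda>x. x) \<partial>M)"
    by (subst nn_integral_distr) (auto intro!: PB.borel_measurable_nn_integral)
  also have "\<dots> = (\<integral>\<^sup>+\<omega>. \<integral>\<^sup>+\<omega>'. h (\<omega>, \<omega>') \<partial>M \<partial>M)"
  proof (rule nn_integral_cong)
    fix \<omega> assume "\<omega> \<in> space M"
    then have "\<omega> \<in> space A" using A by simp
    then show "(\<integral>\<^sup>+\<omega>'. h (\<omega>, \<omega>') \<partial>distr M B (\<lambda>x. x)) = (\<integral>\<^sup>+\<omega>'. h (\<omega>, \<omega>') \<partial>M)"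
      by (subst nn_integral_distr) auto
  qed
  finally show ?thesis .
qed

text \<open>The form used for freezing: with durations and selections in \<open>A\<close> and
  arrivals in \<open>B\<close>, random sampling times are constants inside the inner
  probability.\<close>

lemma (in prob_space) emeasure_diag_indep:
  assumes "indep_set (sets A) (sets B)"
    and "space A = space M" "sets A \<subseteq> events" and B: "space B = space M" "sets B \<subseteq> events"
    and P: "Measurable.pred (A \<Otimes>\<^sub>M B) P"
  shows "emeasure M {\<omega> \<in> space M. P (\<omega>, \<omega>)} = (\<integral>\<^sup>+\<omega>. emeasure M {\<omega>' \<in> space M. P (\<omega>, \<omega>')} \<partial>M)"
proof -
  have meas: "{\<omega>' \<in> space M. P (\<omega>, \<omega>')} \<in> events" if "\<omega> \<in> space M" for \<omega>
  proof -
    have "Pair \<omega> \<in> measurable B (A \<Otimes>\<^sub>M B)" using that assms(2) by simp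
    from measurable_compose[OF this P] have "{\<omega>' \<in> space B. P (\<omega>, \<omega>')} \<in> sets B" by simp
    then show ?thesis using B by auto
  qed
  have idA: "(\<lambda>x. x) \<in> measurable M A" and idB: "(\<lambda>x. x) \<in> measurable M B"
    using assms(2-5) sets.sets_into_space[of _ A] sets.sets_into_space[of _ B]
    by (auto intro!: measurableI simp: subset_eq Int_def conj_commute cong: conj_cong)
  have "(\<lambda>x. (x, x)) \<in> measurable M (A \<Otimes>\<^sub>M B)" using idA idB by (rule measurable_Pair)
  from measurable_compose[OF this P] have diag: "{\<omega> \<in> space M. P (\<omega>, \<omega>)} \<in> events" by simp
  have "emeasure M {\<omega> \<in> space M. P (\<omega>, \<omega>)} = (\<integral>\<^sup>+\<omega>. indicator {\<omega> \<in> space M. P (\<omega>, \<omega>)} \<omega> \<partial>M)"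
    using diag by simp
  also have "\<dots> = (\<integral>\<^sup>+\<omega>. indicator (Collect P) (\<omega>, \<omega>) \<partial>M)"
    by (intro nn_integral_cong) (auto simp: indicator_def)
  also have "\<dots> = (\<integral>\<^sup>+\<omega>. \<integral>\<^sup>+\<omega>'. indicator (Collect P) (\<omega>, \<omega>') \<partial>M \<partial>M)"
  proof (rule nn_integral_diag_indep[OF assms(1-5)])
    have "(\<lambda>z. if P z then 1 else 0 :: ennreal) \<in> borel_measurable (A \<Otimes>\<^sub>M B)"
      using P by measurable
    then show "(indicator (Collect P) :: _ \<Rightarrow> ennreal) \<in> borel_measurable (A \<Otimes>\<^sub>M B)"
      by (simp add: indicator_def[abs_def] of_bool_def)
  qed
  also have "\<dots> = (\<integral>\<^sup>+\<omega>. \<integral>\<^sup>+\<omega>'. indicator {\<omega>' \<in> space M. P (\<omega>, \<omega>')} \<omega>' \<partial>M \<partial>M)"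
    by (intro nn_integral_cong) (auto simp: indicator_def)
  also have "\<dots> = (\<integral>\<^sup>+\<omega>. emeasure M {\<omega>' \<in> space M. P (\<omega>, \<omega>')} \<partial>M)"
    by (intro nn_integral_cong) (simp add: meas)
  finally show ?thesis .
qed

section \<open>Countable partitions and evaluation of paths at random times\<close>

lemma sets_diff_eq:
  fixes f g :: "'b \<Rightarrow> nat"
  assumes [measurable]: "f \<in> measurable C (count_space UNIV)" "g \<in> measurable C (count_space UNIV)"
  shows "{x \<in> space C. f x - g x + y = b} \<in> sets C"
  by measurable

lemma nn_integral_partition:
  fixes X :: "'b \<Rightarrow> 'c::countable"
  assumes [measurable]: "X \<in> measurable C (count_space UNIV)" "f \<in> borel_measurable C"
  shows "(\<integral>\<^sup>+x. f x \<partial>C) = (\<integral>\<^sup>+c. \<integral>\<^sup>+x. f x * indicator {x \<in> space C. X x = c} x \<partial>C \<partial>count_space UNIV)"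
proof -
  have "(\<integral>\<^sup>+x. f x \<partial>C) = (\<integral>\<^sup>+x. \<integral>\<^sup>+c. f x * indicator {x \<in> space C. X x = c} x \<partial>count_space UNIV \<partial>C)"
  proof (rule nn_integral_cong)
    fix x assume "x \<in> space C"
    then have "(\<integral>\<^sup>+c. f x * indicator {x \<in> space C. X x = c} x \<partial>count_space UNIV)
        = (\<integral>\<^sup>+c. f x * indicator {X x} c \<partial>count_space UNIV)"
      by (intro nn_integral_cong) (auto simp: indicator_def)
    then show "f x = (\<integral>\<^sup>+c. f x * indicator {x \<in> space C. X x = c} x \<partial>count_space UNIV)"
      by simp
  qed
  also have "\<dots> = (\<integral>\<^sup>+c. \<integral>\<^sup>+x. f x * indicator {x \<in> space C. X x = c} x \<partial>C \<partial>count_space UNIV)"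
    by (rule nn_integral_count_space_nn_integral) auto
  finally show ?thesis .
qed

lemma measurable_fun_count_space:
  fixes f :: "'b \<Rightarrow> 'k::finite \<Rightarrow> 'c::countable"
  assumes f: "\<And>j. (\<lambda>x. f x j) \<in> measurable C (count_space UNIV)"
  shows "f \<in> measurable C (count_space UNIV)"
proof -
  have "f -` {a} \<inter> space C \<in> sets C" for a
  proof -
    note f[measurable]
    have "{x \<in> space C. \<forall>j. f x j = a j} \<in> sets C" by measurable
    also have "{x \<in> space C. \<forall>j. f x j = a j} = f -` {a} \<inter> space C" by auto
    finally show ?thesis .
  qed
  then show ?thesis by (subst measurable_count_space_eq2_countable) auto
qed

lemma measurable_nat_of_real:
  assumes "(\<lambda>x. real (f x)) \<in> borel_measurable C"
  shows "f \<in> measurable C (count_space UNIV)"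
proof -
  have "(\<lambda>x. nat \<lfloor>real (f x)\<rfloor>) \<in> measurable C (count_space UNIV)"
    by (rule measurable_compose[OF _ measurable_count_space]) (use assms in measurable)
  then show ?thesis by simp
qed

text \<open>The random time is approximated from the right by times on a countable grid, where
  composition is measurable; right-continuity identifies the limit.\<close>

lemma measurable_right_continuous_eval:
  fixes N :: "real \<Rightarrow> 'b \<Rightarrow> nat"
  assumes N: "\<And>t. 0 \<le> t \<Longrightarrow> N t \<in> measurable B (count_space UNIV)"
    and rc: "\<And>\<omega> t. \<omega> \<in> space B \<Longrightarrow> 0 \<le> t \<Longrightarrow> continuous (at_right t) (\<lambda>u. N u \<omega>)"
    and T[measurable]: "T \<in> borel_measurable C" and g[measurable]: "g \<in> measurable C B"
    and pos: "\<And>x. x \<in> space C \<Longrightarrow> 0 \<le> T x"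
  shows "(\<lambda>x. N (T x) (g x)) \<in> measurable C (count_space UNIV)"
proof (rule measurable_nat_of_real)
  \<comment> \<open>The \<open>+ 1\<close> places the grid point strictly to the right of
    \<open>T x\<close>, as convergence along \<open>at_right\<close> demands.\<close>
  define a where "a n x = (real (nat \<lfloor>T x * real (Suc n)\<rfloor>) + 1) / real (Suc n)" for n x
  have a_gt: "T x < a n x" and a_le: "a n x \<le> T x + 1 / real (Suc n)" if "x \<in> space C" for n x
  proof -
    have "0 \<le> T x * real (Suc n)" using pos[OF that] by simp
    then have e: "real (nat \<lfloor>T x * real (Suc n)\<rfloor>) = of_int \<lfloor>T x * real (Suc n)\<rfloor>"
      by (simp add: of_nat_nat)
    let ?m = "real (Suc n)"
    have m: "0 < ?m" by simp
    have 1: "T x * ?m < of_int \<lfloor>T x * ?m\<rfloor> + 1" and 2: "of_int \<lfloor>T x * ?m\<rfloor> \<le> T x * ?m"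
      by linarith+
    show "T x < a n x" unfolding a_def e pos_less_divide_eq[OF m] by (rule 1)
    have "a n x \<le> (T x * ?m + 1) / ?m"
      unfolding a_def e by (intro divide_right_mono) (use 2 in auto)
    also have "\<dots> = T x + 1 / ?m" by (simp add: add_divide_distrib)
    finally show "a n x \<le> T x + 1 / ?m" .
  qed
  show "(\<lambda>x. real (N (T x) (g x))) \<in> borel_measurable C"
  proof (rule borel_measurable_LIMSEQ_real)
    fix n
    have m: "(\<lambda>x. N ((real i + 1) / real (Suc n)) (g x)) \<in> measurable C (count_space UNIV)" for i
      by (rule measurable_compose[OF g N]) simp
    have "(\<lambda>x. N (a n x) (g x)) \<in> measurable C (count_space UNIV)"
      unfolding a_def
      by (rule measurable_compose_countable[where f="\<lambda>i x. N ((real i + 1) / real (Suc n)) (g x)"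
          and g="\<lambda>x. nat \<lfloor>T x * real (Suc n)\<rfloor>"], rule m) measurable
    then show "(\<lambda>x. real (N (a n x) (g x))) \<in> borel_measurable C" by measurable
  next
    fix x assume x: "x \<in> space C"
    have lim: "(\<lambda>n. a n x) \<longlonglongrightarrow> T x"
    proof (rule tendsto_sandwich[of "\<lambda>_. T x" _ _ "\<lambda>n. T x + 1 / real (Suc n)"])
      have "(\<lambda>n. T x + 1 / real (Suc n)) \<longlonglongrightarrow> T x + 0"
        by (intro tendsto_intros LIMSEQ_Suc[OF lim_1_over_n])
      then show "(\<lambda>n. T x + 1 / real (Suc n)) \<longlonglongrightarrow> T x" by simp
    qed (use a_gt[OF x] a_le[OF x] in \<open>auto intro!: always_eventually less_imp_le\<close>)
    have "filterlim (\<lambda>n. a n x) (at_right (T x)) sequentially"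
      unfolding filterlim_at using lim a_gt[OF x] by (auto simp: less_imp_neq[symmetric])
    moreover have "((\<lambda>u. N u (g x)) \<longlongrightarrow> N (T x) (g x)) (at_right (T x))"
      using rc[OF measurable_space[OF g x] pos[OF x]] by (simp add: continuous_within)
    ultimately have "(\<lambda>n. N (a n x) (g x)) \<longlonglongrightarrow> N (T x) (g x)"
      by (rule filterlim_compose[rotated])
    then show "(\<lambda>n. real (N (a n x) (g x))) \<longlonglongrightarrow> real (N (T x) (g x))"
      unfolding tendsto_discrete by (intro tendsto_eventually) (auto elim: eventually_mono)
  qed
qed

section \<open>Poisson and binomial moments\<close>

lemma nn_integral_poisson_shift:
  assumes "0 < (r::real)"
  shows "(\<integral>\<^sup>+n. of_nat n * f n \<partial>poisson_pmf r) = ennreal r * (\<integral>\<^sup>+n. f (Suc n) \<partial>poisson_pmf r)"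
proof -
  let ?a = "\<lambda>n. ennreal (pmf (poisson_pmf r) n) * (of_nat n * f n)"
  have "(\<integral>\<^sup>+n. of_nat n * f n \<partial>poisson_pmf r) = (\<Sum>n. ?a n)"
    by (simp only: nn_integral_measure_pmf nn_integral_count_space_nat)
  also have "\<dots> = (\<Sum>n. ?a (Suc n))"
    using sums_Suc[OF summable_sums[of "\<lambda>n. ?a (Suc n)"]] by (auto simp: sums_iff)
  also have "\<dots> = (\<Sum>n. ennreal r * (ennreal (pmf (poisson_pmf r) n) * f (Suc n)))"
  proof (rule suminf_cong)
    fix n
    have "ennreal (pmf (poisson_pmf r) (Suc n)) * of_nat (Suc n) = ennreal r * ennreal (pmf (poisson_pmf r) n)"
      using assms by (simp add: ennreal_of_nat_eq_real_of_nat ennreal_mult[symmetric] field_simps del: of_nat_Suc)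
    then show "?a (Suc n) = ennreal r * (ennreal (pmf (poisson_pmf r) n) * f (Suc n))"
      by (simp add: mult.assoc[symmetric] del: of_nat_Suc)
  qed
  also have "\<dots> = ennreal r * (\<integral>\<^sup>+n. f (Suc n) \<partial>poisson_pmf r)"
    by (simp add: nn_integral_measure_pmf nn_integral_count_space_nat)
  finally show ?thesis .
qed

text \<open>Both are instances of the Stein-Chen identity above, with a constant function and with
  the identity.\<close>

lemma nn_integral_poisson_moments:
  assumes "0 < (r::real)"
  shows "(\<integral>\<^sup>+n. of_nat n \<partial>poisson_pmf r) = ennreal r"
    and "(\<integral>\<^sup>+n. of_nat (n\<^sup>2) \<partial>poisson_pmf r) = ennreal (r + r\<^sup>2)"
proof -
  show 1: "(\<integral>\<^sup>+n. of_nat n \<partial>poisson_pmf r) = ennreal r"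
    using nn_integral_poisson_shift[OF assms, of "\<lambda>_. 1"] by simp
  have "(\<integral>\<^sup>+n. of_nat (n\<^sup>2) \<partial>poisson_pmf r) = ennreal r * (\<integral>\<^sup>+n. of_nat (Suc n) \<partial>poisson_pmf r)"
    using nn_integral_poisson_shift[OF assms, of of_nat] by (simp add: power2_eq_square)
  also have "(\<integral>\<^sup>+n. of_nat (Suc n) \<partial>poisson_pmf r) = 1 + ennreal r"
    by (simp add: nn_integral_add 1)
  also have "ennreal r * (1 + ennreal r) = ennreal (r + r\<^sup>2)"
    using assms by (simp add: distrib_left ennreal_mult[symmetric] ennreal_plus power2_eq_square)
  finally show "(\<integral>\<^sup>+n. of_nat (n\<^sup>2) \<partial>poisson_pmf r) = ennreal (r + r\<^sup>2)" .
qed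

lemma pred_hit:
  fixes n a b y :: "'b \<Rightarrow> nat"
  assumes [measurable]: "n \<in> measurable C (count_space UNIV)" "a \<in> measurable C (count_space UNIV)"
    "b \<in> measurable C (count_space UNIV)" "y \<in> measurable C (count_space UNIV)"
  shows "Measurable.pred C (\<lambda>x. n x + (a x - b x) = n x - y x + m)"
  by (rule measurable_compose_countable[where f="\<lambda>c x. n x + (a x - b x) = c" and g="\<lambda>x. n x - y x + m"]) measurable

text \<open>Squared mean plus variance. The induction splits off one Bernoulli trial, which replaces
  \<open>A\<close> by \<open>A - a\<close>; hence \<open>A\<close> must be arbitrary.\<close>

lemma binomial_affine_square:
  assumes p: "p \<in> {0..1}"
  shows "measure_pmf.expectation (binomial_pmf n p) (\<lambda>y. (A - a * real y)\<^sup>2) =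
    (A - a * (real n * p))\<^sup>2 + a\<^sup>2 * (real n * (p * (1 - p)))"
proof (induction n arbitrary: A)
  case 0
  then show ?case using p by (simp add: binomial_pmf_0)
next
  case (Suc n)
  let ?E = "\<lambda>A. measure_pmf.expectation (binomial_pmf n p) (\<lambda>y. (A - a * real y)\<^sup>2)"
  have "binomial_pmf (Suc n) p = bernoulli_pmf p \<bind> (\<lambda>b. map_pmf (\<lambda>k. (if b then 1 else 0) + k) (binomial_pmf n p))"
    using p by (simp add: binomial_pmf_Suc map_pmf_def)
  then have "measure_pmf.expectation (binomial_pmf (Suc n) p) (\<lambda>y. (A - a * real y)\<^sup>2) =
      (\<Sum>b\<in>UNIV. pmf (bernoulli_pmf p) b *\<^sub>R measure_pmf.expectation
        (map_pmf (\<lambda>k. (if b then 1 else 0) + k) (binomial_pmf n p)) (\<lambda>y. (A - a * real y)\<^sup>2))"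
    using finite_set_pmf_binomial_pmf[OF p] by (simp only:) (rule pmf_expectation_bind, auto)
  also have "\<dots> = p * ?E (A - a) + (1 - p) * ?E A"
    using p by (simp add: UNIV_bool algebra_simps)
  also have "\<dots> = (A - a * (real (Suc n) * p))\<^sup>2 + a\<^sup>2 * (real (Suc n) * (p * (1 - p)))"
    unfolding Suc.IH by (simp add: power2_eq_square algebra_simps)
  finally show ?case .
qed

text \<open>The gap between \<open>(1 - \<epsilon>)\<close> squared and 1 leaves room for a multiple
  of \<open>w\<close> squared, which absorbs the linear term by completing the square.\<close>

lemma quadratic_absorb:
  fixes \<epsilon> b c e :: real
  assumes "0 < \<epsilon>" "\<epsilon> \<le> 1"
  shows "\<exists>a C. 0 \<le> a \<and> a < 1 \<and> 0 \<le> C \<and> (\<forall>w\<ge>0. ((1 - \<epsilon>) * w + b)\<^sup>2 + c * w + e \<le> a * w\<^sup>2 + C)"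
proof -
  \<comment> \<open>Half of the gap, so that the new leading coefficient is still below 1.\<close>
  define \<eta> where "\<eta> = (1 - (1 - \<epsilon>)\<^sup>2) / 2"
  define d where "d = 2 * (1 - \<epsilon>) * b + c"
  have "(1 - \<epsilon>)\<^sup>2 < 1" using assms by (simp add: power_less_one_iff abs_square_less_1)
  then have \<eta>: "0 < \<eta>" "(1 - \<epsilon>)\<^sup>2 + \<eta> < 1" by (simp_all add: \<eta>_def field_simps)
  have "((1 - \<epsilon>) * w + b)\<^sup>2 + c * w + e \<le> ((1 - \<epsilon>)\<^sup>2 + \<eta>) * w\<^sup>2 + (d\<^sup>2 / (4 * \<eta>) + b\<^sup>2 + \<bar>e\<bar>)" for w
  proof -
    have "0 \<le> \<eta> * (w - d / (2 * \<eta>))\<^sup>2" using \<eta> by simp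
    also have "\<dots> = \<eta> * w\<^sup>2 - d * w + d\<^sup>2 / (4 * \<eta>)"
      using \<eta>(1) by (simp add: power2_diff field_simps power2_eq_square)
    finally have "d * w \<le> \<eta> * w\<^sup>2 + d\<^sup>2 / (4 * \<eta>)" by simp
    moreover have "((1 - \<epsilon>) * w + b)\<^sup>2 + c * w + e = (1 - \<epsilon>)\<^sup>2 * w\<^sup>2 + d * w + b\<^sup>2 + e"
      by (simp add: d_def power2_eq_square algebra_simps)
    moreover have "e \<le> \<bar>e\<bar>" by simp
    ultimately show ?thesis unfolding distrib_right by linarith
  qed
  moreover have "0 \<le> d\<^sup>2 / (4 * \<eta>) + b\<^sup>2 + \<bar>e\<bar>" using \<eta> by simp
  moreover have "0 \<le> (1 - \<epsilon>)\<^sup>2 + \<eta>" using \<eta> by (simp add: add_nonneg_nonneg less_imp_le)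
  ultimately show ?thesis using \<eta>(2) by blast
qed

text \<open>Integrating \<open>P f \<le> a f + C\<close> against the stationary law and cancelling
  would require the integral of \<open>f\<close> to be finite, which is the claim. The comparison is
  therefore made for \<open>min f n\<close>, whose mean is finite and equal under \<open>X\<close>
  and \<open>X'\<close>. States with \<open>f x > n\<close> are bounded trivially by
  \<open>n\<close> and cancel; the rest yields a bound that does not depend on
  \<open>n\<close>.\<close>

lemma (in prob_space) stationary_moment_bound:
  fixes X X' :: "'a \<Rightarrow> 'c::countable" and f :: "'c \<Rightarrow> real"
  assumes X[measurable]: "X \<in> measurable M (count_space UNIV)" and X'[measurable]: "X' \<in> measurable M (count_space UNIV)"
    and eq: "distr M (count_space UNIV) X' = distr M (count_space UNIV) X"
    and f: "\<And>x. 0 \<le> f x" and a: "0 \<le> a" "a < 1" and C: "0 \<le> C"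
    and le: "\<And>x. (\<integral>\<^sup>+\<omega>. ennreal (f (X' \<omega>)) * indicator {\<omega> \<in> space M. X \<omega> = x} \<omega> \<partial>M)
      \<le> ennreal (a * f x + C) * emeasure M {\<omega> \<in> space M. X \<omega> = x}"
  shows "(\<integral>\<^sup>+\<omega>. ennreal (f (X \<omega>)) \<partial>M) \<le> ennreal (C / (1 - a))"
proof -
  \<comment> \<open>Set to 0 above \<open>n\<close>, not capped at \<open>n\<close>: the cap is
    split off as \<open>?i\<close> below, since no contraction is available on it.\<close>
  define g where "g n x = (if f x \<le> real n then f x else 0)" for n :: nat and x
  have trunc: "(\<integral>\<^sup>+\<omega>. ennreal (g n (X \<omega>)) \<partial>M) \<le> ennreal (C / (1 - a))" for n
  proof -
    let ?h = "\<lambda>x. if f x \<le> real n then a * f x + C else real n"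
    have "(\<integral>\<^sup>+\<omega>. ennreal (min (f (X \<omega>)) (real n)) \<partial>M) = (\<integral>\<^sup>+\<omega>. ennreal (min (f (X' \<omega>)) (real n)) \<partial>M)"
      using nn_integral_distr[OF X, of "\<lambda>x. ennreal (min (f x) (real n))"]
        nn_integral_distr[OF X', of "\<lambda>x. ennreal (min (f x) (real n))"] by (simp add: eq)
    also have "\<dots> = (\<integral>\<^sup>+x. \<integral>\<^sup>+\<omega>. ennreal (min (f (X' \<omega>)) (real n)) * indicator {\<omega> \<in> space M. X \<omega> = x} \<omega> \<partial>M \<partial>count_space UNIV)"
      by (rule nn_integral_partition) measurable
    also have "\<dots> \<le> (\<integral>\<^sup>+x. ennreal (?h x) * emeasure M {\<omega> \<in> space M. X \<omega> = x} \<partial>count_space UNIV)"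
    proof (rule nn_integral_mono)
      fix x
      show "(\<integral>\<^sup>+\<omega>. ennreal (min (f (X' \<omega>)) (real n)) * indicator {\<omega> \<in> space M. X \<omega> = x} \<omega> \<partial>M)
          \<le> ennreal (?h x) * emeasure M {\<omega> \<in> space M. X \<omega> = x}"
      proof (cases "f x \<le> real n")
        case True
        have "(\<integral>\<^sup>+\<omega>. ennreal (min (f (X' \<omega>)) (real n)) * indicator {\<omega> \<in> space M. X \<omega> = x} \<omega> \<partial>M)
          \<le> (\<integral>\<^sup>+\<omega>. ennreal (f (X' \<omega>)) * indicator {\<omega> \<in> space M. X \<omega> = x} \<omega> \<partial>M)"
          by (intro nn_integral_mono mult_right_mono ennreal_leI) auto
        also note le
        finally show ?thesis using True by simp
      next
        case False
        have "(\<integral>\<^sup>+\<omega>. ennreal (min (f (X' \<omega>)) (real n)) * indicator {\<omega> \<in> space M. X \<omega> = x} \<omega> \<partial>M)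
          \<le> (\<integral>\<^sup>+\<omega>. ennreal (real n) * indicator {\<omega> \<in> space M. X \<omega> = x} \<omega> \<partial>M)"
          by (intro nn_integral_mono mult_right_mono ennreal_leI) auto
        also have "\<dots> = ennreal (real n) * emeasure M {\<omega> \<in> space M. X \<omega> = x}"
          by (rule nn_integral_cmult_indicator) measurable
        finally show ?thesis using False by simp
      qed
    qed
    also have "\<dots> = (\<integral>\<^sup>+x. \<integral>\<^sup>+\<omega>. ennreal (?h (X \<omega>)) * indicator {\<omega> \<in> space M. X \<omega> = x} \<omega> \<partial>M \<partial>count_space UNIV)"
    proof (rule nn_integral_cong)
      fix x
      have "(\<integral>\<^sup>+\<omega>. ennreal (?h (X \<omega>)) * indicator {\<omega> \<in> space M. X \<omega> = x} \<omega> \<partial>M)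
        = (\<integral>\<^sup>+\<omega>. ennreal (?h x) * indicator {\<omega> \<in> space M. X \<omega> = x} \<omega> \<partial>M)"
        by (intro nn_integral_cong) (auto simp: indicator_def)
      also have "\<dots> = ennreal (?h x) * emeasure M {\<omega> \<in> space M. X \<omega> = x}"
        by (rule nn_integral_cmult_indicator) measurable
      finally show "ennreal (?h x) * emeasure M {\<omega> \<in> space M. X \<omega> = x}
        = (\<integral>\<^sup>+\<omega>. ennreal (?h (X \<omega>)) * indicator {\<omega> \<in> space M. X \<omega> = x} \<omega> \<partial>M)" ..
    qed
    also have "\<dots> = (\<integral>\<^sup>+\<omega>. ennreal (?h (X \<omega>)) \<partial>M)"
      by (rule nn_integral_partition[symmetric]) measurable
    finally have le': "(\<integral>\<^sup>+\<omega>. ennreal (min (f (X \<omega>)) (real n)) \<partial>M) \<le> (\<integral>\<^sup>+\<omega>. ennreal (?h (X \<omega>)) \<partial>M)" .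
    \<comment> \<open>The contribution of the large states. It is the same on both sides and
      integrable, hence it can be subtracted.\<close>
    let ?i = "\<lambda>x. if f x \<le> real n then 0 else real n"
    have fmeas: "(\<lambda>\<omega>. F (X \<omega>)) \<in> borel_measurable M" for F :: "'c \<Rightarrow> real" by measurable
    have int: "integrable M (\<lambda>\<omega>. g n (X \<omega>))" "integrable M (\<lambda>\<omega>. ?i (X \<omega>))"
      by (rule integrable_const_bound[where B="real n"]; use f in \<open>auto simp: g_def intro!: AE_I2 fmeas\<close>)+
    have h_le: "?h x \<le> a * g n x + C + ?i x" for x using C by (auto simp: g_def)
    have min_eq: "min (f x) (real n) = g n x + ?i x" for x by (auto simp: g_def)
    have g0: "0 \<le> g n x" for x using f by (simp add: g_def)
    have "(\<integral>\<^sup>+\<omega>. ennreal (g n (X \<omega>) + ?i (X \<omega>)) \<partial>M) \<le> (\<integral>\<^sup>+\<omega>. ennreal (a * g n (X \<omega>) + C + ?i (X \<omega>)) \<partial>M)"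
      using le' unfolding min_eq by (rule order_trans) (intro nn_integral_mono ennreal_leI h_le)
    moreover have "(\<integral>\<^sup>+\<omega>. ennreal (g n (X \<omega>) + ?i (X \<omega>)) \<partial>M) = ennreal (expectation (\<lambda>\<omega>. g n (X \<omega>) + ?i (X \<omega>)))"
      by (rule nn_integral_eq_integral) (use int g0 in \<open>auto intro!: AE_I2 Bochner_Integration.integrable_add\<close>)
    moreover have "(\<integral>\<^sup>+\<omega>. ennreal (a * g n (X \<omega>) + C + ?i (X \<omega>)) \<partial>M) = ennreal (expectation (\<lambda>\<omega>. a * g n (X \<omega>) + C + ?i (X \<omega>)))"
      by (rule nn_integral_eq_integral) (use int g0 a C in \<open>auto intro!: AE_I2 Bochner_Integration.integrable_add\<close>)
    moreover have "0 \<le> expectation (\<lambda>\<omega>. a * g n (X \<omega>) + C + ?i (X \<omega>))"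
      using g0 a C by (intro integral_nonneg_AE AE_I2) auto
    ultimately have "expectation (\<lambda>\<omega>. g n (X \<omega>) + ?i (X \<omega>)) \<le> expectation (\<lambda>\<omega>. a * g n (X \<omega>) + C + ?i (X \<omega>))"
      by (simp add: ennreal_le_iff)
    then have "expectation (\<lambda>\<omega>. g n (X \<omega>)) \<le> a * expectation (\<lambda>\<omega>. g n (X \<omega>)) + C"
      using int by (simp add: Bochner_Integration.integral_add prob_space)
    then have "expectation (\<lambda>\<omega>. g n (X \<omega>)) \<le> C / (1 - a)"
      using a by (simp add: field_simps)
    moreover have "(\<integral>\<^sup>+\<omega>. ennreal (g n (X \<omega>)) \<partial>M) = ennreal (expectation (\<lambda>\<omega>. g n (X \<omega>)))"
      by (rule nn_integral_eq_integral) (use int g0 in auto)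
    ultimately show ?thesis by (simp add: ennreal_leI)
  qed
  have "(\<integral>\<^sup>+\<omega>. ennreal (f (X \<omega>)) \<partial>M) \<le> (\<integral>\<^sup>+\<omega>. (SUP n. ennreal (g n (X \<omega>))) \<partial>M)"
  proof (rule nn_integral_mono)
    fix \<omega>
    obtain n :: nat where "f (X \<omega>) \<le> real n" using real_arch_simple by blast
    then have "ennreal (f (X \<omega>)) = ennreal (g n (X \<omega>))" by (simp add: g_def)
    then show "ennreal (f (X \<omega>)) \<le> (SUP n. ennreal (g n (X \<omega>)))" by (metis SUP_upper UNIV_I)
  qed
  also have "\<dots> = (SUP n. \<integral>\<^sup>+\<omega>. ennreal (g n (X \<omega>)) \<partial>M)"
    by (rule nn_integral_monotone_convergence_SUP)
      (auto simp: g_def incseq_def le_fun_def f intro!: ennreal_leI)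
  also have "\<dots> \<le> ennreal (C / (1 - a))" by (rule SUP_least) (rule trunc)
  finally show ?thesis .
qed

section \<open>Independence of the inputs along a sequence of sources\<close>

context bep_polling_system
begin

text \<open>The sigma-algebras of the independence assumption, packaged as measure spaces so that
  measurability with respect to a single source can be expressed.\<close>

definition src_algebra :: "'k source \<Rightarrow> 'a measure" where
  "src_algebra x = (case x of
      Initial \<Rightarrow> vimage_algebra (space M) Q0 (count_space UNIV)
    | Arrival k \<Rightarrow> vimage_algebra (space M) (\<lambda>\<omega>. \<lambda>t\<in>{0..}. N k t \<omega>)
        (\<Pi>\<^sub>M t\<in>{0..}. count_space UNIV)
    | Service v l \<Rightarrow> vimage_algebra (space M) (S v l) borel
    | Switchover v \<Rightarrow> vimage_algebra (space M) (V v) borel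
    | Selection v n \<Rightarrow> vimage_algebra (space M) (Y v n) (count_space UNIV))"

lemma indep_src: "indep_sets (\<lambda>x. sets (src_algebra x)) UNIV"
proof -
  have "(\<lambda>x. sets (src_algebra x)) = (\<lambda>x. case x of
            Initial \<Rightarrow> sets (vimage_algebra (space M) Q0 (count_space UNIV))
          | Arrival k \<Rightarrow> sets (vimage_algebra (space M) (\<lambda>\<omega>. \<lambda>t\<in>{0..}. N k t \<omega>)
                                (\<Pi>\<^sub>M t\<in>{0..}. count_space UNIV))
          | Service v l \<Rightarrow> sets (vimage_algebra (space M) (S v l) borel)
          | Switchover v \<Rightarrow> sets (vimage_algebra (space M) (V v) borel)
          | Selection v n \<Rightarrow> sets (vimage_algebra (space M) (Y v n) (count_space UNIV)))"
    by (auto simp: fun_eq_iff src_algebra_def split: source.split)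
  then show ?thesis using independence by simp
qed

lemma space_src_algebra[simp]: "space (src_algebra x) = space M"
  by (simp add: src_algebra_def split: source.split)

lemma sets_src_algebra: "sets (src_algebra x) \<subseteq> events"
  using indep_src by (simp add: indep_sets_def)

definition alg :: "'k source set \<Rightarrow> 'a measure" where
  "alg X = sigma (space M) (\<Union>x\<in>X. sets (src_algebra x))"

lemma space_alg[simp]: "space (alg X) = space M"
  unfolding alg_def
  by (rule space_measure_of) (use sets_src_algebra sets.sets_into_space in blast)

lemma sets_alg: "sets (alg X) = sigma_sets (space M) (\<Union>x\<in>X. sets (src_algebra x))"
  unfolding alg_def
  by (rule sets_measure_of) (use sets_src_algebra sets.sets_into_space in blast)

lemma sets_alg_events: "sets (alg X) \<subseteq> events"
  unfolding sets_alg using sets_src_algebra by (intro sets.sigma_sets_subset) auto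

lemma measurable_alg:
  assumes "x \<in> X" "f \<in> measurable (src_algebra x) L"
  shows "f \<in> measurable (alg X) L"
proof (rule measurableI)
  fix E assume "E \<in> sets L"
  from measurable_sets[OF assms(2) this] show "f -` E \<inter> space (alg X) \<in> sets (alg X)"
    using assms(1) by (auto simp: sets_alg)
qed (use measurable_space[OF assms(2)] in simp)

lemma indep_alg:
  assumes "X \<inter> Z = {}"
  shows "indep_set (sets (alg X)) (sets (alg Z))"
proof -
  have "indep_sets (\<lambda>b. sigma_sets (space M) (\<Union>x\<in>case_bool X Z b. sets (src_algebra x))) UNIV"
  proof (rule indep_sets_collect_sigma)
    show "indep_sets (\<lambda>x. sets (src_algebra x)) (\<Union>b\<in>UNIV. case_bool X Z b)"
      by (rule indep_sets_mono_index[OF _ indep_src]) simp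
    show "disjoint_family_on (case_bool X Z) UNIV"
      using assms by (auto simp: disjoint_family_on_def split: bool.splits)
  qed (rule sets.Int_stable)
  then show ?thesis
    unfolding indep_set_def
    by (rule back_subst[where P="\<lambda>F. indep_sets F UNIV"]) (auto simp: fun_eq_iff sets_alg split: bool.split)
qed

lemma src_measurable:
  "Q0 \<in> measurable (src_algebra Initial) (count_space UNIV)"
  "S v l \<in> borel_measurable (src_algebra (Service v l))"
  "V v \<in> borel_measurable (src_algebra (Switchover v))"
  "Y v n \<in> measurable (src_algebra (Selection v n)) (count_space UNIV)"
  by (auto simp: src_algebra_def intro!: measurable_vimage_algebra1)

lemma N_measurable_src:
  assumes "0 \<le> t"
  shows "N k t \<in> measurable (src_algebra (Arrival k)) (count_space UNIV)"
proof -
  have "(\<lambda>\<omega>. (\<lambda>t\<in>{0..}. N k t \<omega>)) \<in> measurable (src_algebra (Arrival k)) (\<Pi>\<^sub>M t\<in>{0::real..}. count_space UNIV)"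
    by (auto simp: src_algebra_def space_PiM intro!: measurable_vimage_algebra1)
  from measurable_compose[OF this measurable_component_singleton[of t]]
  show ?thesis using assms by simp
qed

lemma N_rv[measurable]: "0 \<le> t \<Longrightarrow> random_variable (count_space UNIV) (N k t)"
  using arrivals by (simp add: poisson_process_def)

lemma N_0[simp]: "\<omega> \<in> space M \<Longrightarrow> N k 0 \<omega> = 0"
  using arrivals by (simp add: poisson_process_def)

lemma N_mono: "\<omega> \<in> space M \<Longrightarrow> 0 \<le> t \<Longrightarrow> t \<le> u \<Longrightarrow> N k t \<omega> \<le> N k u \<omega>"
  using arrivals[of k] by (auto simp: poisson_process_def mono_on_def)

lemma N_eval_measurable:
  assumes B: "space B = space M" "\<And>t. 0 \<le> t \<Longrightarrow> N k t \<in> measurable B (count_space UNIV)"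
    and "T \<in> borel_measurable C" "g \<in> measurable C B" "\<And>x. x \<in> space C \<Longrightarrow> 0 \<le> T x"
  shows "(\<lambda>x. N k (T x) (g x)) \<in> measurable C (count_space UNIV)"
proof (rule measurable_right_continuous_eval[OF B(2)])
  fix \<omega> t assume "\<omega> \<in> space B" "0 \<le> (t::real)"
  then show "continuous (at_right t) (\<lambda>u. N k u \<omega>)"
    using B(1) arrivals[of k] by (simp add: poisson_process_def)
qed (use assms in auto)

text \<open>Only services and switchovers take time, and only selections have a value in
  \<open>sel\<close>. The defaults 0 let one formula, arrivals during \<open>dur\<close> plus
  \<open>sel\<close>, cover all kinds of steps.\<close>

fun dur :: "'k source \<Rightarrow> 'a \<Rightarrow> real" where
  "dur (Service v l) \<omega> = S v l \<omega>"
| "dur (Switchover v) \<omega> = V v \<omega>"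
| "dur _ \<omega> = 0"

fun sel :: "'k source \<Rightarrow> 'a \<Rightarrow> nat" where
  "sel (Selection v n) \<omega> = Y v n \<omega>"
| "sel _ \<omega> = 0"

lemma dur_nonneg[simp]: "\<omega> \<in> space M \<Longrightarrow> 0 \<le> dur x \<omega>"
  by (cases x) (auto simp: service_nonneg switchover_nonneg)

lemma dur_src: "dur x \<in> borel_measurable (src_algebra x)"
  by (cases x) (auto simp: src_measurable cong: measurable_cong)

lemma sel_src: "sel x \<in> measurable (src_algebra x) (count_space UNIV)"
  by (cases x) (auto simp: src_measurable cong: measurable_cong)

lemma src_algebra_rv: "f \<in> measurable (src_algebra x) L \<Longrightarrow> random_variable L f"
  using measurable_mono[of L L "src_algebra x" M] sets_src_algebra[of x] by auto

lemma dur_rv[measurable]: "random_variable borel (dur x)"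
  by (rule src_algebra_rv[OF dur_src])

lemma sel_rv[measurable]: "random_variable (count_space UNIV) (sel x)"
  by (rule src_algebra_rv[OF sel_src])

section \<open>Poisson increments at nonrandom times\<close>

lemma prob_Inter_arrivals:
  assumes E: "\<And>j. E j \<in> sets (src_algebra (Arrival j))"
  shows "prob (\<Inter>j. E j) = (\<Prod>j\<in>UNIV. prob (E j))"
proof -
  define A where "A x = (case x of Arrival j \<Rightarrow> E j | _ \<Rightarrow> {})" for x
  have "prob (\<Inter>x\<in>range Arrival. A x) = (\<Prod>x\<in>range Arrival. prob (A x))"
    by (rule indep_setsD[OF indep_src]) (auto simp: A_def E)
  moreover have "inj (Arrival :: 'k \<Rightarrow> 'k source)" by (auto simp: inj_on_def)
  ultimately show ?thesis by (simp add: prod.reindex A_def)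
qed

lemma prob_increment:
  assumes "0 \<le> t" "t \<le> u"
  shows "prob {\<omega> \<in> space M. N k u \<omega> - N k t \<omega> + y = b} = prob {\<omega> \<in> space M. N k (u - t) \<omega> + y = b}"
proof (cases "t = u")
  case True
  then show ?thesis by (auto intro!: arg_cong[where f=prob])
next
  case False
  have d: "distr M (count_space UNIV) (\<lambda>\<omega>. N k u \<omega> - N k t \<omega>) = measure_pmf (poisson_pmf (lam k * (u - t)))"
    if "0 \<le> t" "t < u" for t u
    using arrivals[of k] that by (simp add: poisson_process_def)
  have m: "prob {\<omega> \<in> space M. X \<omega> + y = b} = measure (distr M (count_space UNIV) X) {m. m + y = b}"
    if "random_variable (count_space UNIV) X" for X :: "'a \<Rightarrow> nat"
    using that by (subst measure_distr) (auto intro!: arg_cong[where f=prob])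
  have [measurable]: "N k u \<in> measurable M (count_space UNIV)" "N k t \<in> measurable M (count_space UNIV)"
      "N k (u - t) \<in> measurable M (count_space UNIV)" "N k 0 \<in> measurable M (count_space UNIV)"
    using assms by auto
  have "prob {\<omega> \<in> space M. N k (u - t) \<omega> + y = b} = prob {\<omega> \<in> space M. N k (u - t) \<omega> - N k 0 \<omega> + y = b}"
    by (auto intro!: arg_cong[where f=prob])
  also have "\<dots> = prob {\<omega> \<in> space M. N k u \<omega> - N k t \<omega> + y = b}"
    using assms False d[of 0 "u - t"] d[of t u] by (simp add: m)
  finally show ?thesis ..
qed

lemma prob_increments_one_queue:
  assumes "0 \<le> \<tau> 0" "\<And>i. \<tau> i \<le> \<tau> (Suc i)"
  shows "prob {\<omega> \<in> space M. \<forall>i<n. N j (\<tau> (Suc i)) \<omega> - N j (\<tau> i) \<omega> + y i = b i} =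
    (\<Prod>i<n. prob {\<omega> \<in> space M. N j (\<tau> (Suc i) - \<tau> i) \<omega> + y i = b i})"
proof (cases "n = 0")
  case True
  then show ?thesis using prob_space by simp
next
  case False
  have mono: "mono \<tau>" using assms(2) by (rule incseq_SucI)
  have ge0: "0 \<le> \<tau> i" for i using monoD[OF mono, of 0 i] assms(1) by simp
  have ind: "indep_vars (\<lambda>_. count_space UNIV) (\<lambda>i \<omega>. N j (\<tau> (Suc i)) \<omega> - N j (\<tau> i) \<omega>) (UNIV :: nat set)"
    using arrivals[of j] mono assms(1) by (simp add: poisson_process_def)
  have "prob (\<Inter>i\<in>{..<n}. (\<lambda>\<omega>. N j (\<tau> (Suc i)) \<omega> - N j (\<tau> i) \<omega>) -` {m. m + y i = b i} \<inter> space M) =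
    (\<Prod>i\<in>{..<n}. prob ((\<lambda>\<omega>. N j (\<tau> (Suc i)) \<omega> - N j (\<tau> i) \<omega>) -` {m. m + y i = b i} \<inter> space M))"
    by (rule indep_varsD[OF ind]) (use False in auto)
  moreover have "(\<Inter>i\<in>{..<n}. (\<lambda>\<omega>. N j (\<tau> (Suc i)) \<omega> - N j (\<tau> i) \<omega>) -` {m. m + y i = b i} \<inter> space M)
     = {\<omega> \<in> space M. \<forall>i<n. N j (\<tau> (Suc i)) \<omega> - N j (\<tau> i) \<omega> + y i = b i}"
    using False by auto
  moreover have "(\<lambda>\<omega>. N j (\<tau> (Suc i)) \<omega> - N j (\<tau> i) \<omega>) -` {m. m + y i = b i} \<inter> space M =
      {\<omega> \<in> space M. N j (\<tau> (Suc i)) \<omega> - N j (\<tau> i) \<omega> + y i = b i}" for i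
    by auto
  ultimately show ?thesis
    using prob_increment[OF ge0 assms(2)] by simp
qed

text \<open>Independence of the queues and of the increments within each queue gives a double
  product over queues and intervals. After exchanging the products, the queues are joined again,
  which leaves one factor per interval.\<close>

lemma prob_increments:
  assumes \<tau>: "0 \<le> \<tau> 0" "\<And>i. \<tau> i \<le> \<tau> (Suc i)"
  shows "prob {\<omega> \<in> space M. \<forall>i<n. \<forall>j. N j (\<tau> (Suc i)) \<omega> - N j (\<tau> i) \<omega> + y i = b i j} =
    (\<Prod>i<n. prob {\<omega> \<in> space M. \<forall>j. N j (\<tau> (Suc i) - \<tau> i) \<omega> + y i = b i j})"
proof -
  have mono: "mono \<tau>" using \<tau>(2) by (rule incseq_SucI)
  have ge0: "0 \<le> \<tau> i" for i using monoD[OF mono, of 0 i] \<tau>(1) by simp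
  have eq: "{\<omega> \<in> space M. \<forall>j. P j \<omega>} = (\<Inter>j. {\<omega> \<in> space M. P j \<omega>})" for P :: "'k \<Rightarrow> 'a \<Rightarrow> bool"
    by auto
  have sets: "{\<omega> \<in> space M. \<forall>i<n. N j (\<tau> (Suc i)) \<omega> - N j (\<tau> i) \<omega> + y i = b i j} \<in> sets (src_algebra (Arrival j))" for j
  proof -
    have "{\<omega> \<in> space (src_algebra (Arrival j)). \<forall>i\<in>{..<n}. N j (\<tau> (Suc i)) \<omega> - N j (\<tau> i) \<omega> + y i = b i j} \<in> sets (src_algebra (Arrival j))"
    proof (rule sets.sets_Collect_finite_All)
      fix i
      show "{\<omega> \<in> space (src_algebra (Arrival j)). N j (\<tau> (Suc i)) \<omega> - N j (\<tau> i) \<omega> + y i = b i j} \<in> sets (src_algebra (Arrival j))"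
        by (rule sets_diff_eq[OF N_measurable_src[OF ge0] N_measurable_src[OF ge0]])
    qed (rule finite_lessThan)
    then show ?thesis by (simp only: space_src_algebra Ball_def lessThan_iff)
  qed
  have sets': "{\<omega> \<in> space M. N j (\<tau> (Suc i) - \<tau> i) \<omega> + y i = b i j} \<in> sets (src_algebra (Arrival j))" for i j
    using sets_diff_eq[OF N_measurable_src[of "\<tau> (Suc i) - \<tau> i" j] measurable_const[of 0], of "y i" "b i j"] \<tau>(2)
    by simp
  have "prob {\<omega> \<in> space M. \<forall>i<n. \<forall>j. N j (\<tau> (Suc i)) \<omega> - N j (\<tau> i) \<omega> + y i = b i j} =
      prob (\<Inter>j. {\<omega> \<in> space M. \<forall>i<n. N j (\<tau> (Suc i)) \<omega> - N j (\<tau> i) \<omega> + y i = b i j})"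
    by (rule arg_cong[where f=prob]) auto
  also have "\<dots> = (\<Prod>j\<in>UNIV. \<Prod>i<n. prob {\<omega> \<in> space M. N j (\<tau> (Suc i) - \<tau> i) \<omega> + y i = b i j})"
    by (subst prob_Inter_arrivals[OF sets]) (simp add: prob_increments_one_queue[where b="\<lambda>i. b i _", OF \<tau>])
  also have "\<dots> = (\<Prod>i<n. \<Prod>j\<in>UNIV. prob {\<omega> \<in> space M. N j (\<tau> (Suc i) - \<tau> i) \<omega> + y i = b i j})"
    by (rule prod.swap)
  also have "\<dots> = (\<Prod>i<n. prob {\<omega> \<in> space M. \<forall>j. N j (\<tau> (Suc i) - \<tau> i) \<omega> + y i = b i j})"
    unfolding eq by (subst prob_Inter_arrivals[OF sets']) simp
  finally show ?thesis .
qed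

section \<open>Freezing everything but the arrivals\<close>

abbreviation "inner_alg \<equiv> alg (- range Arrival)"
abbreviation "arrival_alg \<equiv> alg (range Arrival)"

lemma N_measurable_arrival_alg: "0 \<le> t \<Longrightarrow> N k t \<in> measurable arrival_alg (count_space UNIV)"
  by (rule measurable_alg[OF _ N_measurable_src]) auto

lemma dur_inner: "x \<notin> range Arrival \<Longrightarrow> dur x \<in> borel_measurable inner_alg"
  by (rule measurable_alg[OF _ dur_src]) auto

lemma sel_inner: "x \<notin> range Arrival \<Longrightarrow> sel x \<in> measurable inner_alg (count_space UNIV)"
  by (rule measurable_alg[OF _ sel_src]) auto

lemma Q0_inner: "Q0 \<in> measurable inner_alg (count_space UNIV)"
  by (rule measurable_alg[OF _ src_measurable(1)]) auto

lemmas emeasure_diag_alg =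
  emeasure_diag_indep[OF indep_alg[of "- range Arrival" "range Arrival"] space_alg sets_alg_events space_alg sets_alg_events]

lemma input_mass:
  fixes b :: "'k \<Rightarrow> nat"
  assumes x: "x \<notin> range Arrival"
  defines "g \<equiv> \<lambda>\<omega>. emeasure M {\<omega>' \<in> space M. \<forall>j. N j (dur x \<omega>) \<omega>' + sel x \<omega> = b j}"
  shows "emeasure M {\<omega> \<in> space M. \<forall>j. N j (dur x \<omega>) \<omega> + sel x \<omega> = b j} = (\<integral>\<^sup>+\<omega>. g \<omega> \<partial>M)"
    and "g \<in> borel_measurable (src_algebra x)"
proof -
  have "Measurable.pred (inner_alg \<Otimes>\<^sub>M arrival_alg) (\<lambda>z. \<forall>j. N j (dur x (fst z)) (snd z) + sel x (fst z) = b j)"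
  proof (rule pred_intros_countable)
    fix j
    have [measurable]: "(\<lambda>z. N j (dur x (fst z)) (snd z)) \<in> measurable (inner_alg \<Otimes>\<^sub>M arrival_alg) (count_space UNIV)"
      by (rule N_eval_measurable[OF space_alg N_measurable_arrival_alg _ measurable_snd])
        (auto simp: space_pair_measure intro: measurable_compose[OF measurable_fst dur_inner[OF x]])
    have [measurable]: "(\<lambda>z. sel x (fst z)) \<in> measurable (inner_alg \<Otimes>\<^sub>M arrival_alg) (count_space UNIV)"
      by (rule measurable_compose[OF measurable_fst sel_inner[OF x]])
    show "Measurable.pred (inner_alg \<Otimes>\<^sub>M arrival_alg) (\<lambda>z. N j (dur x (fst z)) (snd z) + sel x (fst z) = b j)"
      by measurable
  qed
  from emeasure_diag_alg[OF _ this]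
  show "emeasure M {\<omega> \<in> space M. \<forall>j. N j (dur x \<omega>) \<omega> + sel x \<omega> = b j} = (\<integral>\<^sup>+\<omega>. g \<omega> \<partial>M)"
    by (simp add: g_def)
  define Q where "Q = {z \<in> space (src_algebra x \<Otimes>\<^sub>M M). \<forall>j. N j (dur x (fst z)) (snd z) + sel x (fst z) = b j}"
  have "Measurable.pred (src_algebra x \<Otimes>\<^sub>M M) (\<lambda>z. \<forall>j. N j (dur x (fst z)) (snd z) + sel x (fst z) = b j)"
  proof (rule pred_intros_countable)
    fix j
    have [measurable]: "(\<lambda>z. N j (dur x (fst z)) (snd z)) \<in> measurable (src_algebra x \<Otimes>\<^sub>M M) (count_space UNIV)"
      by (rule N_eval_measurable[OF refl N_rv _ measurable_snd])
        (auto simp: space_pair_measure intro: measurable_compose[OF measurable_fst dur_src])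
    have [measurable]: "(\<lambda>z. sel x (fst z)) \<in> measurable (src_algebra x \<Otimes>\<^sub>M M) (count_space UNIV)"
      by (rule measurable_compose[OF measurable_fst sel_src])
    show "Measurable.pred (src_algebra x \<Otimes>\<^sub>M M) (\<lambda>z. N j (dur x (fst z)) (snd z) + sel x (fst z) = b j)"
      by measurable
  qed
  then have "Q \<in> sets (src_algebra x \<Otimes>\<^sub>M M)"
    unfolding Q_def by measurable
  then have "(\<lambda>\<omega>. emeasure M (Pair \<omega> -` Q)) \<in> borel_measurable (src_algebra x)"
    by (rule measurable_emeasure_Pair)
  moreover have "emeasure M (Pair \<omega> -` Q) = g \<omega>" if "\<omega> \<in> space (src_algebra x)" for \<omega>
    unfolding g_def Q_def using that by (intro arg_cong[where f="emeasure M"]) (auto simp: space_pair_measure)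
  ultimately show "g \<in> borel_measurable (src_algebra x)"
    by (rule measurable_cong[THEN iffD1, rotated])
qed

definition elapsed :: "'k source list \<Rightarrow> nat \<Rightarrow> 'a \<Rightarrow> real" where
  "elapsed xs i \<omega> = (\<Sum>i'<i. dur (xs ! i') \<omega>)"

lemma elapsed_nonneg: "\<omega> \<in> space M \<Longrightarrow> 0 \<le> elapsed xs i \<omega>"
  by (auto simp: elapsed_def intro: sum_nonneg)

text \<open>For a list fixed in advance the time points are functions of the durations. Freezing
  \<open>inner_alg\<close> leaves increments over nonrandom intervals, hence a product with one
  factor per list entry. Each factor is a function of its own source, and as the list is distinct
  the mean of the product is the product of the means.\<close>

lemma prob_inputs:
  assumes dist: "distinct xs" and xs: "Initial \<notin> set xs" "set xs \<inter> range Arrival = {}"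
  shows "emeasure M {\<omega> \<in> space M. Q0 \<omega> = q \<and> (\<forall>i<length xs. \<forall>j.
        N j (elapsed xs (Suc i) \<omega>) \<omega> - N j (elapsed xs i \<omega>) \<omega> + sel (xs ! i) \<omega> = b (xs ! i) j)} =
      emeasure M {\<omega> \<in> space M. Q0 \<omega> = q} *
      (\<Prod>x\<in>set xs. emeasure M {\<omega> \<in> space M. \<forall>j. N j (dur x \<omega>) \<omega> + sel x \<omega> = b x j})"
    (is "emeasure M ?E = _")
proof -
  define n where "n = length xs"
  define P where "P z \<longleftrightarrow> Q0 (fst z) = q \<and> (\<forall>i\<in>{..<n}. \<forall>j. N j (elapsed xs (Suc i) (fst z)) (snd z)
      - N j (elapsed xs i (fst z)) (snd z) + sel (xs ! i) (fst z) = b (xs ! i) j)" for z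
  define g where "g x \<omega> = emeasure M {\<omega>' \<in> space M. \<forall>j. N j (dur x \<omega>) \<omega>' + sel x \<omega> = b x j}" for x \<omega>
  \<comment> \<open>The event \<open>Q0 = q\<close> is treated as the factor of the source
    \<open>Initial\<close>, so that one independence statement covers the start and all
    steps.\<close>
  define X where "X x \<omega> = (if x = Initial then indicator {\<omega> \<in> space M. Q0 \<omega> = q} \<omega> else g x \<omega>)" for x \<omega>
  have notin: "xs ! i \<notin> range Arrival" if "i < n" for i
    using that xs(2) nth_mem[of i xs] unfolding n_def disjoint_iff by blast
  have el: "elapsed xs i \<in> borel_measurable inner_alg" if "i \<le> n" for i
    unfolding elapsed_def using that by (intro borel_measurable_sum dur_inner notin) auto
  have "Measurable.pred (inner_alg \<Otimes>\<^sub>M arrival_alg) P"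
    unfolding P_def
  proof (intro pred_intros_logic pred_intros_finite pred_intros_countable)
    have [measurable]: "Q0 \<in> measurable inner_alg (count_space UNIV)" by (rule Q0_inner)
    show "Measurable.pred (inner_alg \<Otimes>\<^sub>M arrival_alg) (\<lambda>z. Q0 (fst z) = q)"
      by measurable
  next
    fix i j assume i: "i \<in> {..<n}"
    have [measurable]: "(\<lambda>z. N j (elapsed xs i' (fst z)) (snd z)) \<in> measurable (inner_alg \<Otimes>\<^sub>M arrival_alg) (count_space UNIV)"
      if "i' \<le> n" for i'
      by (rule N_eval_measurable[OF space_alg N_measurable_arrival_alg _ measurable_snd])
        (auto simp: space_pair_measure elapsed_nonneg intro: measurable_compose[OF measurable_fst el[OF that]])
    have [measurable]: "(\<lambda>z. sel (xs ! i) (fst z)) \<in> measurable (inner_alg \<Otimes>\<^sub>M arrival_alg) (count_space UNIV)"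
      by (rule measurable_compose[OF measurable_fst sel_inner[OF notin]]) (use i in auto)
    have [simp]: "Suc i \<le> n" "i \<le> n" using i by auto
    show "Measurable.pred (inner_alg \<Otimes>\<^sub>M arrival_alg) (\<lambda>z. N j (elapsed xs (Suc i) (fst z)) (snd z)
      - N j (elapsed xs i (fst z)) (snd z) + sel (xs ! i) (fst z) = b (xs ! i) j)"
      by measurable
  qed simp
  then have "emeasure M {\<omega> \<in> space M. P (\<omega>, \<omega>)} = (\<integral>\<^sup>+\<omega>. emeasure M {\<omega>' \<in> space M. P (\<omega>, \<omega>')} \<partial>M)"
    by (intro emeasure_diag_alg) auto
  also have "{\<omega> \<in> space M. P (\<omega>, \<omega>)} = ?E"
    by (auto simp: P_def n_def)
  also have "(\<integral>\<^sup>+\<omega>. emeasure M {\<omega>' \<in> space M. P (\<omega>, \<omega>')} \<partial>M) =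
      (\<integral>\<^sup>+\<omega>. (\<Prod>x\<in>insert Initial (set xs). X x \<omega>) \<partial>M)"
  proof (rule nn_integral_cong)
    fix \<omega> assume \<omega>: "\<omega> \<in> space M"
    \<comment> \<open>Held constant after \<open>n\<close>: the Poisson assumption speaks of
      infinite monotone sequences of times.\<close>
    define \<tau> where "\<tau> i = elapsed xs (min i n) \<omega>" for i
    have \<tau>: "0 \<le> \<tau> 0" "\<tau> i \<le> \<tau> (Suc i)" for i
      using \<omega> by (auto simp: \<tau>_def elapsed_def min_def not_le intro!: sum_mono2)
    have \<tau>_diff: "\<tau> (Suc i) - \<tau> i = dur (xs ! i) \<omega>" if "i < n" for i
      using that by (simp add: \<tau>_def elapsed_def min_def)
    have "emeasure M {\<omega>' \<in> space M. \<forall>i<n. \<forall>j. N j (\<tau> (Suc i)) \<omega>' - N j (\<tau> i) \<omega>' + sel (xs ! i) \<omega> = b (xs ! i) j}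
        = (\<Prod>i<n. emeasure M {\<omega>' \<in> space M. \<forall>j. N j (\<tau> (Suc i) - \<tau> i) \<omega>' + sel (xs ! i) \<omega> = b (xs ! i) j})"
      unfolding emeasure_eq_measure prob_increments[where \<tau>=\<tau> and y="\<lambda>i. sel (xs ! i) \<omega>" and b="\<lambda>i. b (xs ! i)", OF \<tau>]
      by (simp add: prod_ennreal)
    also have "\<dots> = (\<Prod>i<n. g (xs ! i) \<omega>)"
      by (intro prod.cong) (auto simp: g_def \<tau>_diff)
    also have "\<dots> = (\<Prod>x\<in>set xs. g x \<omega>)"
      unfolding n_def by (rule prod.reindex_bij_betw[OF bij_betw_nth[OF dist refl refl]])
    also have "{\<omega>' \<in> space M. \<forall>i<n. \<forall>j. N j (\<tau> (Suc i)) \<omega>' - N j (\<tau> i) \<omega>' + sel (xs ! i) \<omega> = b (xs ! i) j}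
      = {\<omega>' \<in> space M. \<forall>i\<in>{..<n}. \<forall>j. N j (elapsed xs (Suc i) \<omega>) \<omega>' - N j (elapsed xs i \<omega>) \<omega>' + sel (xs ! i) \<omega> = b (xs ! i) j}"
      unfolding \<tau>_def by (intro Collect_cong conj_cong refl) (auto simp: min_def)
    finally have "emeasure M {\<omega>' \<in> space M. P (\<omega>, \<omega>')} = X Initial \<omega> * (\<Prod>x\<in>set xs. g x \<omega>)"
      using \<omega> by (cases "Q0 \<omega> = q") (simp_all add: P_def X_def)
    also have "(\<Prod>x\<in>set xs. g x \<omega>) = (\<Prod>x\<in>set xs. X x \<omega>)"
      using xs by (intro prod.cong) (auto simp: X_def)
    finally show "emeasure M {\<omega>' \<in> space M. P (\<omega>, \<omega>')} = (\<Prod>x\<in>insert Initial (set xs). X x \<omega>)"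
      using xs by simp
  qed
  also have "\<dots> = (\<Prod>x\<in>insert Initial (set xs). \<integral>\<^sup>+\<omega>. X x \<omega> \<partial>M)"
  proof (rule indep_vars_nn_integral)
    have X: "X x \<in> borel_measurable (src_algebra x)" if x: "x \<in> insert Initial (set xs)" for x
    proof (cases "x = Initial")
      case True
      have [measurable]: "Q0 \<in> measurable (src_algebra Initial) (count_space UNIV)" by (rule src_measurable)
      have "{\<omega> \<in> space (src_algebra Initial). Q0 \<omega> = q} \<in> sets (src_algebra Initial)" by measurable
      then show ?thesis by (auto simp: True X_def[abs_def])
    next
      case False
      then have "x \<notin> range Arrival" using x xs by auto
      from input_mass(2)[OF this, of "b x"] False show ?thesis by (simp add: X_def[abs_def] g_def)
    qed
    show "indep_vars (\<lambda>_. borel) X (insert Initial (set xs))"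
      unfolding indep_vars_def2
    proof
      show "\<forall>x\<in>insert Initial (set xs). random_variable borel (X x)"
        using X src_algebra_rv by blast
      show "indep_sets (\<lambda>x. {X x -` A \<inter> space M |A. A \<in> sets borel}) (insert Initial (set xs))"
        by (rule indep_sets_mono[OF indep_src]) (use measurable_sets[OF X] in auto)
    qed
  qed auto
  also have "\<dots> = (\<integral>\<^sup>+\<omega>. X Initial \<omega> \<partial>M) * (\<Prod>x\<in>set xs. \<integral>\<^sup>+\<omega>. X x \<omega> \<partial>M)"
    using xs by simp
  also have "(\<integral>\<^sup>+\<omega>. X Initial \<omega> \<partial>M) = emeasure M {\<omega> \<in> space M. Q0 \<omega> = q}"
  proof -
    note initial_rv[measurable]
    show ?thesis by (simp add: X_def)
  qed
  also have "(\<Prod>x\<in>set xs. \<integral>\<^sup>+\<omega>. X x \<omega> \<partial>M) =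
      (\<Prod>x\<in>set xs. emeasure M {\<omega> \<in> space M. \<forall>j. N j (dur x \<omega>) \<omega> + sel x \<omega> = b x j})"
  proof (rule prod.cong)
    fix x assume "x \<in> set xs"
    then have "x \<notin> range Arrival" "x \<noteq> Initial" using xs by auto
    from input_mass(1)[OF this(1), of "b x"] this(2)
    show "(\<integral>\<^sup>+\<omega>. X x \<omega> \<partial>M) = emeasure M {\<omega> \<in> space M. \<forall>j. N j (dur x \<omega>) \<omega> + sel x \<omega> = b x j}"
      by (simp add: X_def g_def)
  qed simp
  finally show ?thesis .
qed

end

section \<open>The embedded chain\<close>

text \<open>\<open>Select v q\<close> is the start of visit \<open>v\<close>. In
  \<open>Serve v l q z\<close>, \<open>l\<close> services of visit \<open>v\<close> have been
  completed and \<open>z\<close> is the excess of the visited queue over the level at which the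
  visit ends; \<open>z = 0\<close> means that the switchover comes next.\<close>

datatype 'k state = Select nat "'k \<Rightarrow> nat" | Serve nat nat "'k \<Rightarrow> nat" nat

instance state :: (finite) countable
proof
  show "\<exists>f :: 'a state \<Rightarrow> nat. inj f"
    by (rule exI[of _ "\<lambda>c. to_nat (case c of Select v q \<Rightarrow> Inl (v, q) | Serve v l q z \<Rightarrow> Inr (v, l, q, z))"])
      (auto simp: inj_on_def split: state.splits)
qed

context bep_polling_system
begin

definition queue_of :: "nat \<Rightarrow> 'k" where
  "queue_of v = p (stage I v)"

fun src :: "'k state \<Rightarrow> 'k source" where
  "src (Select v q) = Selection v (q (queue_of v))"
| "src (Serve v l q z) = (if z = 0 then Switchover v else Service v l)"

text \<open>The cap by \<open>min\<close> agrees with the truncated subtraction in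
  \<open>visit_services\<close>. It keeps \<open>z\<close> below the queue length surely and not
  only almost surely, so that the subtraction of a served customer is always exact.\<close>

fun next_state :: "'k state \<Rightarrow> ('k \<Rightarrow> nat) \<Rightarrow> 'k state" where
  "next_state (Select v q) b = Serve v 0 q (min (q (queue_of v)) (b (queue_of v)))"
| "next_state (Serve v l q z) b = (if z = 0 then Select (Suc v) (\<lambda>j. q j + b j)
     else Serve v (Suc l) (\<lambda>j. q j + b j - (if j = queue_of v then 1 else 0)) (z + b (queue_of v) - 1))"

text \<open>A selection has duration 0 and is recorded as a constant vector.\<close>

definition input :: "'k source \<Rightarrow> 'a \<Rightarrow> 'k \<Rightarrow> nat" where
  "input x \<omega> j = N j (dur x \<omega>) \<omega> + sel x \<omega>"

primrec trajectory :: "nat \<Rightarrow> 'a \<Rightarrow> real \<times> 'k state" where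
  "trajectory 0 \<omega> = (0, Select 0 (Q0 \<omega>))"
| "trajectory (Suc n) \<omega> = (let (t, c) = trajectory n \<omega>; t' = t + dur (src c) \<omega>
     in (t', next_state c (\<lambda>j. N j t' \<omega> - N j t \<omega> + sel (src c) \<omega>)))"

definition clock where "clock n \<omega> = fst (trajectory n \<omega>)"
definition state_at where "state_at n \<omega> = snd (trajectory n \<omega>)"
definition input_at where "input_at n \<omega> j = N j (clock (Suc n) \<omega>) \<omega> - N j (clock n \<omega>) \<omega> + sel (src (state_at n \<omega>)) \<omega>"

lemma clock_0[simp]: "clock 0 \<omega> = 0" and state_at_0[simp]: "state_at 0 \<omega> = Select 0 (Q0 \<omega>)"
  by (simp_all add: clock_def state_at_def)

lemma clock_Suc: "clock (Suc n) \<omega> = clock n \<omega> + dur (src (state_at n \<omega>)) \<omega>"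
  by (simp add: clock_def state_at_def Let_def case_prod_beta)

lemma state_at_Suc: "state_at (Suc n) \<omega> = next_state (state_at n \<omega>) (input_at n \<omega>)"
  by (simp add: clock_def state_at_def input_at_def[abs_def] Let_def case_prod_beta)

lemma clock_mono: "\<omega> \<in> space M \<Longrightarrow> m \<le> n \<Longrightarrow> clock m \<omega> \<le> clock n \<omega>"
  by (rule lift_Suc_mono_le[of "\<lambda>n. clock n \<omega>"]) (simp_all add: clock_Suc)

lemma clock_nonneg: "\<omega> \<in> space M \<Longrightarrow> 0 \<le> clock n \<omega>"
  using clock_mono[of \<omega> 0 n] by simp

lemma N_rv_random_time:
  assumes "random_variable borel T" "\<And>\<omega>. \<omega> \<in> space M \<Longrightarrow> 0 \<le> T \<omega>"
  shows "random_variable (count_space UNIV) (\<lambda>\<omega>. N j (T \<omega>) \<omega>)"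
  by (rule N_eval_measurable[where g="\<lambda>\<omega>. \<omega>" and B=M, OF refl N_rv assms(1) _ assms(2)]) auto

lemma clock_st_rv: "random_variable borel (clock n) \<and> random_variable (count_space UNIV) (state_at n)"
proof (induction n)
  case 0
  note initial_rv[measurable]
  have "(\<lambda>\<omega>. Select 0 (Q0 \<omega>)) \<in> measurable M (count_space UNIV)" by measurable
  then show ?case by (simp add: clock_def[abs_def] state_at_def[abs_def])
next
  case (Suc n)
  then have [measurable]: "random_variable borel (clock n)" "random_variable (count_space UNIV) (state_at n)" by auto
  have "(\<lambda>\<omega>. dur (src (state_at n \<omega>)) \<omega>) \<in> borel_measurable M"
    by (rule measurable_compose_countable[where f="\<lambda>c \<omega>. dur (src c) \<omega>" and g="state_at n"]) measurable
  then have clock[measurable]: "clock (Suc n) \<in> borel_measurable M"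
    by (simp add: clock_Suc[abs_def])
  have [measurable]: "(\<lambda>\<omega>. sel (src (state_at n \<omega>)) \<omega>) \<in> measurable M (count_space UNIV)"
    by (rule measurable_compose_countable[where f="\<lambda>c \<omega>. sel (src c) \<omega>" and g="state_at n"]) measurable
  have [measurable]: "(\<lambda>\<omega>. N j (clock (Suc n) \<omega>) \<omega>) \<in> measurable M (count_space UNIV)"
      "(\<lambda>\<omega>. N j (clock n \<omega>) \<omega>) \<in> measurable M (count_space UNIV)" for j
    by (rule N_rv_random_time; simp add: clock_nonneg)+
  have input_at[measurable]: "input_at n \<in> measurable M (count_space UNIV)"
    by (rule measurable_fun_count_space) (simp add: input_at_def[abs_def])
  have "(\<lambda>\<omega>. next_state (state_at n \<omega>) (input_at n \<omega>)) \<in> measurable M (count_space UNIV)"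
    by (rule measurable_compose_countable[where f="\<lambda>c \<omega>. next_state c (input_at n \<omega>)" and g="state_at n"]) measurable
  then show ?case using clock by (simp add: state_at_Suc[abs_def])
qed

lemma clock_rv[measurable]: "random_variable borel (clock n)"
  and state_at_rv[measurable]: "random_variable (count_space UNIV) (state_at n)"
  using clock_st_rv by auto

lemma input_at_rv[measurable]: "random_variable (count_space UNIV) (input_at n)"
proof (rule measurable_fun_count_space)
  fix j
  have [measurable]: "(\<lambda>\<omega>. N j (clock n \<omega>) \<omega>) \<in> measurable M (count_space UNIV)" for n
    by (rule N_rv_random_time; simp add: clock_nonneg)
  have [measurable]: "(\<lambda>\<omega>. sel (src (state_at n \<omega>)) \<omega>) \<in> measurable M (count_space UNIV)"
    by (rule measurable_compose_countable[where f="\<lambda>c \<omega>. sel (src c) \<omega>" and g="state_at n"]) measurable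
  show "(\<lambda>\<omega>. input_at n \<omega> j) \<in> measurable M (count_space UNIV)"
    unfolding input_at_def by measurable
qed

lemma input_rv[measurable]: "random_variable (count_space UNIV) (input x)"
proof (rule measurable_fun_count_space)
  fix j
  have [measurable]: "(\<lambda>\<omega>. N j (dur x \<omega>) \<omega>) \<in> measurable M (count_space UNIV)"
    by (rule N_rv_random_time) simp_all
  show "(\<lambda>\<omega>. input x \<omega> j) \<in> measurable M (count_space UNIV)"
    unfolding input_def by measurable
qed

section \<open>Path probabilities and the Markov step\<close>

fun srcs :: "'k state \<Rightarrow> ('k \<Rightarrow> nat) list \<Rightarrow> 'k source list" where
  "srcs c [] = []"
| "srcs c (b # bs) = src c # srcs (next_state c b) bs"

lemma length_srcs[simp]: "length (srcs c bs) = length bs"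
  by (induction c bs rule: srcs.induct) auto

lemma srcs_nth: "i < length bs \<Longrightarrow> srcs c bs ! i = src (foldl next_state c (take i bs))"
  by (induction c bs arbitrary: i rule: srcs.induct) (auto simp: less_Suc_eq_0_disj nth_Cons')

text \<open>A superset of the sources that can still be consumed from a state on. It loses the
  current source with every step, which is why no source is used twice along a path.\<close>

fun fresh :: "'k state \<Rightarrow> 'k source set" where
  "fresh (Select v q) = {Selection v' n |v' n. v \<le> v'} \<union> {Service v' l |v' l. v \<le> v'} \<union> {Switchover v' |v'. v \<le> v'}"
| "fresh (Serve v l q z) = {Selection v' n |v' n. v < v'} \<union>
     {Service v' l' |v' l'. v < v' \<or> v' = v \<and> l \<le> l'} \<union> {Switchover v' |v'. v \<le> v'}"

lemma src_fresh: "src c \<in> fresh c"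
  by (cases c) auto

lemma fresh_next_state: "fresh (next_state c b) \<subseteq> fresh c - {src c}"
  by (cases c) auto

lemma fresh_special: "Initial \<notin> fresh c" "fresh c \<inter> range Arrival = {}"
  by (cases c; auto)+

lemma srcs_fresh: "set (srcs c bs) \<subseteq> fresh c"
proof (induction c bs rule: srcs.induct)
  case (2 c b bs)
  then show ?case using src_fresh[of c] fresh_next_state[of c b] by auto
qed simp

lemma distinct_srcs: "distinct (srcs c bs)"
proof (induction c bs rule: srcs.induct)
  case (2 c b bs)
  then show ?case using srcs_fresh[of "next_state c b" bs] fresh_next_state[of c b] by auto
qed simp

text \<open>As long as the inputs agree with \<open>bs\<close>, the states are forced, and with them
  the sources and the clock. Hence the event that the true inputs equal \<open>bs\<close> coincides
  with the same event formed along the predetermined list \<open>xs\<close>, whose time points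
  involve durations only. The equivalence and the identification of state and clock have to be
  proved together.\<close>

lemma input_at_eq_iff_elapsed:
  fixes bs :: "('k \<Rightarrow> nat) list"
  assumes "Q0 \<omega> = q"
  defines "xs \<equiv> srcs (Select 0 q) bs"
  shows "m \<le> length bs \<Longrightarrow>
    ((\<forall>i<m. input_at i \<omega> = bs ! i) \<longleftrightarrow> (\<forall>i<m. \<forall>j. N j (elapsed xs (Suc i) \<omega>) \<omega>
        - N j (elapsed xs i \<omega>) \<omega> + sel (xs ! i) \<omega> = (bs ! i) j)) \<and>
    ((\<forall>i<m. input_at i \<omega> = bs ! i) \<longrightarrow> state_at m \<omega> = foldl next_state (Select 0 q) (take m bs) \<and> clock m \<omega> = elapsed xs m \<omega>)"
proof (induction m)
  case 0
  then show ?case using assms by (simp add: elapsed_def)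
next
  case (Suc m)
  let ?A = "\<lambda>i. input_at i \<omega> = bs ! i"
  let ?B = "\<lambda>i. \<forall>j. N j (elapsed xs (Suc i) \<omega>) \<omega> - N j (elapsed xs i \<omega>) \<omega> + sel (xs ! i) \<omega> = (bs ! i) j"
  have m: "m < length bs" using Suc.prems by simp
  have IH: "(\<forall>i<m. ?A i) \<longleftrightarrow> (\<forall>i<m. ?B i)"
    "(\<forall>i<m. ?A i) \<Longrightarrow> state_at m \<omega> = foldl next_state (Select 0 q) (take m bs) \<and> clock m \<omega> = elapsed xs m \<omega>"
    using Suc by auto
  have step: "(?A m \<longleftrightarrow> ?B m) \<and> clock (Suc m) \<omega> = elapsed xs (Suc m) \<omega>" if "\<forall>i<m. ?A i"
  proof -
    from IH(2)[OF that] have s: "state_at m \<omega> = foldl next_state (Select 0 q) (take m bs)" "clock m \<omega> = elapsed xs m \<omega>" by auto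
    have x: "src (state_at m \<omega>) = xs ! m" using srcs_nth[OF m] s by (simp add: xs_def)
    have c: "clock (Suc m) \<omega> = elapsed xs (Suc m) \<omega>"
      unfolding clock_Suc x s(2) by (simp add: elapsed_def)
    show ?thesis by (simp add: fun_eq_iff input_at_def c s(2) x)
  qed
  show ?case
  proof (cases "\<forall>i<m. ?A i")
    case True
    then show ?thesis using step[OF True] IH m
      by (auto simp: less_Suc_eq state_at_Suc take_Suc_conv_app_nth)
  next
    case False
    then have "\<not> (\<forall>i<Suc m. ?A i)" "\<not> (\<forall>i<Suc m. ?B i)" using IH(1) less_Suc_eq by auto
    then show ?thesis by metis
  qed
qed

definition mass :: "'k source \<Rightarrow> ('k \<Rightarrow> nat) \<Rightarrow> ennreal" where
  "mass x b = emeasure M {\<omega> \<in> space M. input x \<omega> = b}"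

lemma path_probability:
  fixes bs :: "('k \<Rightarrow> nat) list"
  shows "emeasure M {\<omega> \<in> space M. Q0 \<omega> = q \<and> (\<forall>i<length bs. input_at i \<omega> = bs ! i)} =
    emeasure M {\<omega> \<in> space M. Q0 \<omega> = q} * (\<Prod>i<length bs. mass (src (foldl next_state (Select 0 q) (take i bs))) (bs ! i))"
proof -
  define xs where "xs = srcs (Select 0 q) bs"
  \<comment> \<open>The values must be a function of the source instead of the position;
    distinctness of \<open>xs\<close> makes the lookup faithful.\<close>
  define b where "b x = the (map_of (zip xs bs) x)" for x
  have len: "length xs = length bs" and dist: "distinct xs"
    by (simp_all add: xs_def distinct_srcs)
  have b: "b (xs ! i) = bs ! i" if "i < length bs" for i
    using map_of_zip_nth[OF len dist that] by (simp add: b_def)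
  have xs: "Initial \<notin> set xs" "set xs \<inter> range Arrival = {}"
    using srcs_fresh[of "Select 0 q" bs] fresh_special[of "Select 0 q"] unfolding xs_def by blast+
  have ev: "{\<omega> \<in> space M. Q0 \<omega> = q \<and> (\<forall>i<length bs. input_at i \<omega> = bs ! i)} =
      {\<omega> \<in> space M. Q0 \<omega> = q \<and> (\<forall>i<length xs. \<forall>j.
        N j (elapsed xs (Suc i) \<omega>) \<omega> - N j (elapsed xs i \<omega>) \<omega> + sel (xs ! i) \<omega> = b (xs ! i) j)}"
    using input_at_eq_iff_elapsed[of _ q "length bs" bs] by (auto simp: xs_def[symmetric] len b)
  have m: "emeasure M {\<omega> \<in> space M. \<forall>j. N j (dur x \<omega>) \<omega> + sel x \<omega> = b x j} = mass x (b x)" for x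
    by (simp add: mass_def input_def fun_eq_iff)
  have "(\<Prod>x\<in>set xs. mass x (b x)) = (\<Prod>i<length bs. mass (xs ! i) (b (xs ! i)))"
    by (rule prod.reindex_bij_betw[OF bij_betw_nth[OF dist _ refl], symmetric]) (simp add: len)
  moreover have "\<dots> = (\<Prod>i<length bs. mass (src (foldl next_state (Select 0 q) (take i bs))) (bs ! i))"
    by (intro prod.cong refl arg_cong2[where f=mass]) (use b in \<open>auto simp: xs_def srcs_nth\<close>)
  ultimately show ?thesis
    unfolding ev prob_inputs[OF dist xs] m by (rule arg_cong[OF trans])
qed

definition history :: "nat \<Rightarrow> 'a \<Rightarrow> ('k \<Rightarrow> nat) list" where
  "history n \<omega> = map (\<lambda>i. input_at i \<omega>) [0..<n]"

lemma history_rv[measurable]: "random_variable (count_space UNIV) (history n)"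
proof (induction n)
  case (Suc n)
  note Suc[measurable]
  have "(\<lambda>\<omega>. history n \<omega> @ [input_at n \<omega>]) \<in> measurable M (count_space UNIV)"
    by (rule measurable_compose_countable[where f="\<lambda>c \<omega>. c @ [input_at n \<omega>]" and g="history n"]) measurable
  then show ?case by (simp add: history_def[abs_def])
qed (simp add: history_def[abs_def])

lemma history_eq_iff: "history n \<omega> = bs \<longleftrightarrow> length bs = n \<and> (\<forall>i<n. input_at i \<omega> = bs ! i)"
  by (auto simp: history_def list_eq_iff_nth_eq)

lemma state_at_hist: "state_at n \<omega> = foldl next_state (Select 0 (Q0 \<omega>)) (history n \<omega>)"
  by (induction n) (simp_all add: history_def state_at_Suc)

lemma history_step_probability:
  assumes "length bs = n"
  shows "emeasure M {\<omega> \<in> space M. Q0 \<omega> = q \<and> history n \<omega> = bs \<and> input_at n \<omega> = b} =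
    emeasure M {\<omega> \<in> space M. Q0 \<omega> = q \<and> history n \<omega> = bs} * mass (src (foldl next_state (Select 0 q) bs)) b"
proof -
  have "{\<omega> \<in> space M. Q0 \<omega> = q \<and> history n \<omega> = bs \<and> input_at n \<omega> = b}
      = {\<omega> \<in> space M. Q0 \<omega> = q \<and> (\<forall>i<length (bs @ [b]). input_at i \<omega> = (bs @ [b]) ! i)}"
    using assms by (auto simp: history_eq_iff less_Suc_eq nth_append)
  moreover have "{\<omega> \<in> space M. Q0 \<omega> = q \<and> history n \<omega> = bs} =
      {\<omega> \<in> space M. Q0 \<omega> = q \<and> (\<forall>i<length bs. input_at i \<omega> = bs ! i)}"
    using assms by (auto simp: history_eq_iff)
  ultimately show ?thesis
    using path_probability[of q "bs @ [b]"] path_probability[of q bs]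
    by (simp add: nth_append mult.assoc)
qed

text \<open>On each event \<open>history n = bs\<close> the state is a constant, and
  \<open>history_step_probability\<close> factors out the law of the next input. The restriction to
  \<open>Q0 = q\<close> is kept because the later bounds depend on the initial vector.\<close>

lemma markov_step:
  fixes \<phi> :: "'k state \<Rightarrow> ('k \<Rightarrow> nat) \<Rightarrow> ennreal"
  shows "(\<integral>\<^sup>+\<omega>. \<phi> (state_at n \<omega>) (input_at n \<omega>) * indicator {\<omega> \<in> space M. Q0 \<omega> = q} \<omega> \<partial>M) =
    (\<integral>\<^sup>+\<omega>. (\<integral>\<^sup>+\<omega>'. \<phi> (state_at n \<omega>) (input (src (state_at n \<omega>)) \<omega>') \<partial>M) * indicator {\<omega> \<in> space M. Q0 \<omega> = q} \<omega> \<partial>M)"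
    (is "integral\<^sup>N M ?L = integral\<^sup>N M ?R")
proof -
  note initial_rv[measurable]
  let ?c = "foldl next_state (Select 0 q)"
  let ?E = "\<lambda>bs. {\<omega> \<in> space M. Q0 \<omega> = q \<and> history n \<omega> = bs}"
  have [measurable]: "(\<lambda>\<omega>. \<phi> (state_at n \<omega>) (input_at n \<omega>)) \<in> borel_measurable M"
    by (rule measurable_compose_countable[where f="\<lambda>c \<omega>. \<phi> c (input_at n \<omega>)" and g="state_at n"]) measurable
  have L: "?L \<in> borel_measurable M" by measurable
  have R: "?R \<in> borel_measurable M" by measurable
  have eq: "(\<integral>\<^sup>+\<omega>. ?L \<omega> * indicator {\<omega> \<in> space M. history n \<omega> = bs} \<omega> \<partial>M) =
      (\<integral>\<^sup>+\<omega>. ?R \<omega> * indicator {\<omega> \<in> space M. history n \<omega> = bs} \<omega> \<partial>M)" for bs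
  proof (cases "length bs = n")
    case False
    then have "{\<omega> \<in> space M. history n \<omega> = bs} = {}" by (auto simp: history_eq_iff)
    then show ?thesis by simp
  next
    case True
    have "(\<integral>\<^sup>+\<omega>. ?L \<omega> * indicator {\<omega> \<in> space M. history n \<omega> = bs} \<omega> \<partial>M) =
        (\<integral>\<^sup>+\<omega>. \<phi> (?c bs) (input_at n \<omega>) * indicator (?E bs) \<omega> \<partial>M)"
      by (intro nn_integral_cong) (auto simp: indicator_def state_at_hist)
    also have "\<dots> = (\<integral>\<^sup>+b. \<integral>\<^sup>+\<omega>. \<phi> (?c bs) (input_at n \<omega>) * indicator (?E bs) \<omega> * indicator {\<omega> \<in> space M. input_at n \<omega> = b} \<omega> \<partial>M \<partial>count_space UNIV)"
      by (rule nn_integral_partition) measurable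
    also have "\<dots> = (\<integral>\<^sup>+b. \<phi> (?c bs) b * emeasure M {\<omega> \<in> space M. Q0 \<omega> = q \<and> history n \<omega> = bs \<and> input_at n \<omega> = b} \<partial>count_space UNIV)"
    proof (rule nn_integral_cong)
      fix b
      have "(\<integral>\<^sup>+\<omega>. \<phi> (?c bs) (input_at n \<omega>) * indicator (?E bs) \<omega> * indicator {\<omega> \<in> space M. input_at n \<omega> = b} \<omega> \<partial>M)
        = (\<integral>\<^sup>+\<omega>. \<phi> (?c bs) b * indicator {\<omega> \<in> space M. Q0 \<omega> = q \<and> history n \<omega> = bs \<and> input_at n \<omega> = b} \<omega> \<partial>M)"
        by (intro nn_integral_cong) (auto simp: indicator_def)
      also have "\<dots> = \<phi> (?c bs) b * emeasure M {\<omega> \<in> space M. Q0 \<omega> = q \<and> history n \<omega> = bs \<and> input_at n \<omega> = b}"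
        by (subst nn_integral_cmult_indicator) measurable
      finally show "(\<integral>\<^sup>+\<omega>. \<phi> (?c bs) (input_at n \<omega>) * indicator (?E bs) \<omega> * indicator {\<omega> \<in> space M. input_at n \<omega> = b} \<omega> \<partial>M) = \<dots>" .
    qed
    also have "\<dots> = (\<integral>\<^sup>+b. (\<phi> (?c bs) b * mass (src (?c bs)) b) * emeasure M (?E bs) \<partial>count_space UNIV)"
      by (intro nn_integral_cong) (simp add: history_step_probability[OF True] mult_ac)
    also have "\<dots> = (\<integral>\<^sup>+b. \<phi> (?c bs) b * mass (src (?c bs)) b \<partial>count_space UNIV) * emeasure M (?E bs)"
      by (rule nn_integral_multc) simp
    also have "(\<integral>\<^sup>+b. \<phi> (?c bs) b * mass (src (?c bs)) b \<partial>count_space UNIV) =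
        (\<integral>\<^sup>+\<omega>'. \<phi> (?c bs) (input (src (?c bs)) \<omega>') \<partial>M)"
    proof -
      have "(\<integral>\<^sup>+\<omega>'. \<phi> (?c bs) (input (src (?c bs)) \<omega>') \<partial>M) = (\<integral>\<^sup>+b. \<integral>\<^sup>+\<omega>'. \<phi> (?c bs) (input (src (?c bs)) \<omega>')
          * indicator {\<omega> \<in> space M. input (src (?c bs)) \<omega> = b} \<omega>' \<partial>M \<partial>count_space UNIV)"
        by (rule nn_integral_partition) measurable
      also have "\<dots> = (\<integral>\<^sup>+b. \<integral>\<^sup>+\<omega>'. \<phi> (?c bs) b
          * indicator {\<omega> \<in> space M. input (src (?c bs)) \<omega> = b} \<omega>' \<partial>M \<partial>count_space UNIV)"
        by (intro nn_integral_cong) (auto simp: indicator_def)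
      also have "\<dots> = (\<integral>\<^sup>+b. \<phi> (?c bs) b * mass (src (?c bs)) b \<partial>count_space UNIV)"
        unfolding mass_def by (intro nn_integral_cong nn_integral_cmult_indicator) measurable
      finally show ?thesis ..
    qed
    also have "(\<integral>\<^sup>+\<omega>'. \<phi> (?c bs) (input (src (?c bs)) \<omega>') \<partial>M) * emeasure M (?E bs) =
        (\<integral>\<^sup>+\<omega>. (\<integral>\<^sup>+\<omega>'. \<phi> (?c bs) (input (src (?c bs)) \<omega>') \<partial>M) * indicator (?E bs) \<omega> \<partial>M)"
      by (subst nn_integral_cmult_indicator) measurable
    also have "\<dots> = (\<integral>\<^sup>+\<omega>. ?R \<omega> * indicator {\<omega> \<in> space M. history n \<omega> = bs} \<omega> \<partial>M)"
      by (intro nn_integral_cong) (auto simp: indicator_def state_at_hist)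
    finally show ?thesis .
  qed
  show ?thesis
    unfolding nn_integral_partition[OF history_rv L, of n] nn_integral_partition[OF history_rv R, of n] eq ..
qed

section \<open>Moments of the arrivals during one step\<close>

lemma nn_integral_N:
  assumes "0 \<le> t"
  shows "(\<integral>\<^sup>+\<omega>. of_nat (N j t \<omega>) \<partial>M) = ennreal (lam j * t)"
    and "(\<integral>\<^sup>+\<omega>. of_nat ((N j t \<omega>)\<^sup>2) \<partial>M) = ennreal (lam j * t + (lam j * t)\<^sup>2)"
proof -
  have eq: "(\<integral>\<^sup>+\<omega>. f (N j t \<omega>) \<partial>M) = (\<integral>\<^sup>+n. f n \<partial>poisson_pmf (lam j * t))" if "0 < t" for f :: "nat \<Rightarrow> ennreal"
  proof -
    have "(\<integral>\<^sup>+\<omega>. f (N j t \<omega>) \<partial>M) = (\<integral>\<^sup>+n. f n \<partial>distr M (count_space UNIV) (N j t))"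
      by (rule nn_integral_distr[symmetric]) (auto intro: N_rv[OF assms])
    also have "distr M (count_space UNIV) (N j t) = distr M (count_space UNIV) (\<lambda>\<omega>. N j t \<omega> - N j 0 \<omega>)"
      by (rule distr_cong) auto
    also have "\<dots> = measure_pmf (poisson_pmf (lam j * t))"
      using arrivals[of j] that by (simp add: poisson_process_def)
    finally show ?thesis .
  qed
  have pos: "0 < lam j * t" if "0 < t" using that lam_pos by simp
  have z: "(\<integral>\<^sup>+\<omega>. of_nat (N j 0 \<omega>) \<partial>M) = 0" "(\<integral>\<^sup>+\<omega>. of_nat ((N j 0 \<omega>)\<^sup>2) \<partial>M) = 0"
    by (auto intro!: nn_integral_zero' AE_I2)
  show "(\<integral>\<^sup>+\<omega>. of_nat (N j t \<omega>) \<partial>M) = ennreal (lam j * t)"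
    "(\<integral>\<^sup>+\<omega>. of_nat ((N j t \<omega>)\<^sup>2) \<partial>M) = ennreal (lam j * t + (lam j * t)\<^sup>2)"
    using z assms eq[of "of_nat"] eq[of "\<lambda>n. of_nat (n\<^sup>2)"] nn_integral_poisson_moments[OF pos]
    by (cases "t = 0"; simp)+
qed

lemma nn_integral_N_dur:
  assumes x: "x \<notin> range Arrival"
  shows "(\<integral>\<^sup>+\<omega>. f (N j (dur x \<omega>) \<omega>) \<partial>M) = (\<integral>\<^sup>+\<omega>. \<integral>\<^sup>+\<omega>'. f (N j (dur x \<omega>) \<omega>') \<partial>M \<partial>M)"
proof -
  have "(\<lambda>z. N j (dur x (fst z)) (snd z)) \<in> measurable (inner_alg \<Otimes>\<^sub>M arrival_alg) (count_space UNIV)"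
    by (rule N_eval_measurable[OF space_alg N_measurable_arrival_alg _ measurable_snd])
      (auto simp: space_pair_measure intro: measurable_compose[OF measurable_fst dur_inner[OF x]])
  then have "(\<lambda>z. f (N j (dur x (fst z)) (snd z))) \<in> borel_measurable (inner_alg \<Otimes>\<^sub>M arrival_alg)"
    by measurable
  from nn_integral_diag_indep[OF indep_alg[of "- range Arrival" "range Arrival"] space_alg sets_alg_events
      space_alg sets_alg_events this]
  show ?thesis by simp
qed

lemma nn_integral_N_dur_moments:
  assumes x: "x \<notin> range Arrival"
  shows "(\<integral>\<^sup>+\<omega>. of_nat (N j (dur x \<omega>) \<omega>) \<partial>M) = (\<integral>\<^sup>+\<omega>. ennreal (lam j * dur x \<omega>) \<partial>M)"
    and "(\<integral>\<^sup>+\<omega>. of_nat ((N j (dur x \<omega>) \<omega>)\<^sup>2) \<partial>M) = (\<integral>\<^sup>+\<omega>. ennreal (lam j * dur x \<omega> + (lam j * dur x \<omega>)\<^sup>2) \<partial>M)"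
proof -
  show "(\<integral>\<^sup>+\<omega>. of_nat (N j (dur x \<omega>) \<omega>) \<partial>M) = (\<integral>\<^sup>+\<omega>. ennreal (lam j * dur x \<omega>) \<partial>M)"
    by (subst nn_integral_N_dur[OF x, where f=of_nat]) (auto intro!: nn_integral_cong nn_integral_N)
  show "(\<integral>\<^sup>+\<omega>. of_nat ((N j (dur x \<omega>) \<omega>)\<^sup>2) \<partial>M) = (\<integral>\<^sup>+\<omega>. ennreal (lam j * dur x \<omega> + (lam j * dur x \<omega>)\<^sup>2) \<partial>M)"
    by (subst nn_integral_N_dur[OF x, where f="\<lambda>n. of_nat (n\<^sup>2)"])
      (rule nn_integral_cong, rule nn_integral_N(2), simp)
qed

definition dur_mean :: "'k source \<Rightarrow> real" where
  "dur_mean x = (case x of Service v l \<Rightarrow> 1 / mu (queue_of v) | Switchover v \<Rightarrow> s (stage I v) | _ \<Rightarrow> 0)"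

lemma I_pos: "0 < I"
  using stages by (rule less_le_trans[rotated]) simp

lemma stage_range: "stage I v \<in> {1..I}"
  using I_pos by (auto simp: stage_def Suc_le_eq)

lemma dur_eq: "dur (Service v l) = S v l" "dur (Switchover v) = V v"
  "dur Initial = (\<lambda>_. 0)" "dur (Arrival k) = (\<lambda>_. 0)" "dur (Selection v n) = (\<lambda>_. 0)"
  by (simp_all add: fun_eq_iff)

lemma has_bochner_integral_dur: "has_bochner_integral M (dur x) (dur_mean x)"
proof (cases x)
  case (Service v l)
  have "has_bochner_integral (distr M borel (S v l)) (\<lambda>x. x) (1 / mu (queue_of v))"
    using service_mean[of "queue_of v"] by (simp add: service_law queue_of_def)
  then show ?thesis
    using service_rv[of v l] by (simp add: has_bochner_integral_iff Service dur_eq dur_mean_def integrable_distr_eq integral_distr)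
next
  case (Switchover v)
  have "has_bochner_integral (distr M borel (V v)) (\<lambda>x. x) (s (stage I v))"
    using switchover_mean[OF stage_range[of v]] by (simp add: switchover_law)
  then show ?thesis
    using switchover_rv[of v] by (simp add: has_bochner_integral_iff Switchover dur_eq dur_mean_def integrable_distr_eq integral_distr)
qed (simp_all add: dur_eq dur_mean_def has_bochner_integral_iff)

lemma integrable_dur[simp]: "integrable M (dur x)" and integral_dur[simp]: "expectation (dur x) = dur_mean x"
  using has_bochner_integral_dur by (auto simp: has_bochner_integral_iff)

lemma dur_mean_nonneg[simp]: "0 \<le> dur_mean x"
  unfolding integral_dur[symmetric] by (rule integral_nonneg_AE) (auto intro: AE_I2)

lemma has_bochner_integral_N_dur:
  assumes "x \<notin> range Arrival"
  shows "has_bochner_integral M (\<lambda>\<omega>. real (N j (dur x \<omega>) \<omega>)) (lam j * dur_mean x)"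
proof (rule has_bochner_integral_nn_integral)
  have [measurable]: "(\<lambda>\<omega>. N j (dur x \<omega>) \<omega>) \<in> measurable M (count_space UNIV)"
    by (rule N_rv_random_time) simp_all
  show "(\<lambda>\<omega>. real (N j (dur x \<omega>) \<omega>)) \<in> borel_measurable M" by measurable
  have "(\<integral>\<^sup>+\<omega>. ennreal (lam j * dur x \<omega>) \<partial>M) = ennreal (lam j * dur_mean x)"
    using lam_pos[of j] by (subst nn_integral_eq_integral) (auto intro!: mult_nonneg_nonneg less_imp_le)
  then show "(\<integral>\<^sup>+\<omega>. ennreal (real (N j (dur x \<omega>) \<omega>)) \<partial>M) = ennreal (lam j * dur_mean x)"
    using nn_integral_N_dur_moments(1)[OF assms, of j] by (simp add: ennreal_of_nat_eq_real_of_nat)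
qed (use lam_pos[of j] in \<open>auto intro: mult_nonneg_nonneg less_imp_le\<close>)

text \<open>Stated in the extended nonnegative reals because necessity applies it when the second
  moment of the duration is not yet known to be finite.\<close>

lemma nn_integral_N_dur_sq_ge:
  assumes "x \<notin> range Arrival"
  shows "ennreal ((lam j)\<^sup>2) * (\<integral>\<^sup>+\<omega>. ennreal ((dur x \<omega>)\<^sup>2) \<partial>M) \<le> (\<integral>\<^sup>+\<omega>. of_nat ((N j (dur x \<omega>) \<omega>)\<^sup>2) \<partial>M)"
proof -
  have "ennreal ((lam j)\<^sup>2) * (\<integral>\<^sup>+\<omega>. ennreal ((dur x \<omega>)\<^sup>2) \<partial>M) = (\<integral>\<^sup>+\<omega>. ennreal ((lam j)\<^sup>2) * ennreal ((dur x \<omega>)\<^sup>2) \<partial>M)"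
    by (rule nn_integral_cmult[symmetric]) measurable
  also have "\<dots> \<le> (\<integral>\<^sup>+\<omega>. ennreal (lam j * dur x \<omega> + (lam j * dur x \<omega>)\<^sup>2) \<partial>M)"
    using lam_pos[of j]
    by (intro nn_integral_mono) (auto simp: ennreal_mult[symmetric] power_mult_distrib intro!: ennreal_leI mult_nonneg_nonneg)
  also have "\<dots> = (\<integral>\<^sup>+\<omega>. of_nat ((N j (dur x \<omega>) \<omega>)\<^sup>2) \<partial>M)"
    using nn_integral_N_dur_moments(2)[OF assms, of j] by simp
  finally show ?thesis .
qed

lemma N_dur_sq:
  assumes "x \<notin> range Arrival" and sq: "integrable M (\<lambda>\<omega>. (dur x \<omega>)\<^sup>2)"
  shows "has_bochner_integral M (\<lambda>\<omega>. (real (N j (dur x \<omega>) \<omega>))\<^sup>2)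
    (lam j * dur_mean x + (lam j)\<^sup>2 * expectation (\<lambda>\<omega>. (dur x \<omega>)\<^sup>2))"
proof (rule has_bochner_integral_nn_integral)
  have [measurable]: "(\<lambda>\<omega>. N j (dur x \<omega>) \<omega>) \<in> measurable M (count_space UNIV)"
    by (rule N_rv_random_time) simp_all
  show "(\<lambda>\<omega>. (real (N j (dur x \<omega>) \<omega>))\<^sup>2) \<in> borel_measurable M" by measurable
  have "(\<integral>\<^sup>+\<omega>. ennreal (lam j * dur x \<omega> + (lam j * dur x \<omega>)\<^sup>2) \<partial>M) =
      ennreal (expectation (\<lambda>\<omega>. lam j * dur x \<omega> + (lam j * dur x \<omega>)\<^sup>2))"
    using lam_pos[of j] sq
    by (intro nn_integral_eq_integral) (auto simp: power_mult_distrib intro!: AE_I2 add_nonneg_nonneg mult_nonneg_nonneg)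
  also have "\<dots> = ennreal (lam j * dur_mean x + (lam j)\<^sup>2 * expectation (\<lambda>\<omega>. (dur x \<omega>)\<^sup>2))"
    using sq by (simp add: power_mult_distrib)
  finally show "(\<integral>\<^sup>+\<omega>. ennreal ((real (N j (dur x \<omega>) \<omega>))\<^sup>2) \<partial>M) = \<dots>"
    using nn_integral_N_dur_moments(2)[OF assms(1), of j] by (simp add: ennreal_of_nat_eq_real_of_nat)
qed (use lam_pos[of j] in \<open>auto intro!: add_nonneg_nonneg mult_nonneg_nonneg integral_nonneg_AE\<close>)

section \<open>Agreement of the step-by-step system with the polling epochs\<close>

definition epoch :: "nat \<Rightarrow> 'a \<Rightarrow> real" where
  "epoch v \<omega> = fst (polling_epoch I p (\<lambda>k t. N k t \<omega>) (\<lambda>v l. S v l \<omega>) (\<lambda>v. V v \<omega>) (\<lambda>v n. Y v n \<omega>) (Q0 \<omega>) v)"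

definition services :: "nat \<Rightarrow> 'a \<Rightarrow> nat" where
  "services v \<omega> = visit_services (\<lambda>t. N (queue_of v) t \<omega>) (epoch v \<omega>) (\<lambda>l. S v l \<omega>)
     (queue_at_visit v \<omega> (queue_of v)) (Y v (queue_at_visit v \<omega> (queue_of v)) \<omega>)"

lemma epoch_0[simp]: "epoch 0 \<omega> = 0" and queue_0[simp]: "queue_at_visit 0 \<omega> = Q0 \<omega>"
  by (simp_all add: epoch_def queue_at_visit_def)

lemma epoch_Suc: "epoch (Suc v) \<omega> = epoch v \<omega> + (\<Sum>l<services v \<omega>. S v l \<omega>) + V v \<omega>"
  by (simp add: epoch_def services_def queue_at_visit_def queue_of_def Let_def case_prod_beta)

lemma queue_Suc: "queue_at_visit (Suc v) \<omega> j = queue_at_visit v \<omega> j + (N j (epoch (Suc v) \<omega>) \<omega> - N j (epoch v \<omega>) \<omega>)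
    - (if j = queue_of v then services v \<omega> else 0)"
  by (simp add: epoch_def services_def queue_at_visit_def queue_of_def Let_def case_prod_beta)

lemma epoch_nonneg: "\<omega> \<in> space M \<Longrightarrow> 0 \<le> epoch v \<omega>"
  by (induction v) (auto simp: epoch_Suc intro!: add_nonneg_nonneg sum_nonneg service_nonneg switchover_nonneg)

lemma epoch_queue_rv:
  "random_variable borel (epoch v) \<and> random_variable (count_space UNIV) (queue_at_visit v)"
proof (induction v)
  case 0
  then show ?case using initial_rv by (simp cong: measurable_cong)
next
  case (Suc v)
  then have [measurable]: "epoch v \<in> borel_measurable M" "queue_at_visit v \<in> measurable M (count_space UNIV)" by auto
  note service_rv[measurable] switchover_rv[measurable] selection_rv[measurable]
  have q[measurable]: "(\<lambda>\<omega>. queue_at_visit v \<omega> j) \<in> measurable M (count_space UNIV)" for j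
    by (rule measurable_compose[where g="\<lambda>q. q j" and N="count_space UNIV"]) auto
  have [measurable]: "(\<lambda>\<omega>. Y v (queue_at_visit v \<omega> j) \<omega>) \<in> measurable M (count_space UNIV)" for j
    by (rule measurable_compose_countable[where f="\<lambda>n \<omega>. Y v n \<omega>"]) measurable
  have [measurable]: "(\<lambda>\<omega>. N j (epoch v \<omega> + (\<Sum>l<m. S v l \<omega>)) \<omega>) \<in> measurable M (count_space UNIV)" for j m
  proof (rule N_rv_random_time)
    show "(\<lambda>\<omega>. epoch v \<omega> + (\<Sum>l<m. S v l \<omega>)) \<in> borel_measurable M" by measurable
  qed (simp add: epoch_nonneg sum_nonneg service_nonneg)
  have [measurable]: "(\<lambda>\<omega>. N j (epoch v \<omega>) \<omega>) \<in> measurable M (count_space UNIV)" for j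
    by (rule N_rv_random_time) (simp_all add: epoch_nonneg)
  have serv[measurable]: "services v \<in> measurable M (count_space UNIV)"
  proof -
    define A where "A m \<omega> = N (queue_of v) (epoch v \<omega> + (\<Sum>l<m. S v l \<omega>)) \<omega>" for m \<omega>
    define B where "B \<omega> = N (queue_of v) (epoch v \<omega>) \<omega>" for \<omega>
    define n where "n \<omega> = queue_at_visit v \<omega> (queue_of v)" for \<omega>
    define y where "y \<omega> = Y v (n \<omega>) \<omega>" for \<omega>
    have m: "A m \<in> measurable M (count_space UNIV)" "B \<in> measurable M (count_space UNIV)"
        "n \<in> measurable M (count_space UNIV)" "y \<in> measurable M (count_space UNIV)" for m
      unfolding A_def[abs_def] B_def[abs_def] n_def[abs_def] y_def[abs_def] by measurable
    have "services v = (\<lambda>\<omega>. LEAST m. n \<omega> + (A m \<omega> - B \<omega>) = n \<omega> - y \<omega> + m)"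
      by (simp add: fun_eq_iff services_def visit_services_def A_def B_def n_def y_def)
    moreover have "Measurable.pred M (\<lambda>\<omega>. n \<omega> + (A m \<omega> - B \<omega>) = n \<omega> - y \<omega> + m)" for m
      by (rule pred_hit) (rule m)+
    ultimately show ?thesis by (simp only: measurable_Least)
  qed
  have "(\<lambda>\<omega>. \<Sum>l<services v \<omega>. S v l \<omega>) \<in> borel_measurable M"
    by (rule measurable_compose_countable[where f="\<lambda>m \<omega>. \<Sum>l<m. S v l \<omega>"]) measurable
  then have e[measurable]: "epoch (Suc v) \<in> borel_measurable M"
    unfolding epoch_Suc by measurable
  have [measurable]: "(\<lambda>\<omega>. N j (epoch (Suc v) \<omega>) \<omega>) \<in> measurable M (count_space UNIV)" for j
    by (rule N_rv_random_time) (auto intro: epoch_nonneg)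
  have "queue_at_visit (Suc v) \<in> measurable M (count_space UNIV)"
    by (rule measurable_fun_count_space) (unfold queue_Suc, measurable)
  then show ?case using e by simp
qed

lemma queue_rv[measurable]: "random_variable (count_space UNIV) (queue_at_visit v)"
  using epoch_queue_rv by simp

text \<open>During a visit, the first three conjuncts recover the time, the queue lengths and the
  excess \<open>z\<close> from the data at the polling epoch. The last one says that the stopping
  equation of \<open>visit_services\<close> failed after every smaller number of services, so that
  \<open>l\<close> is its least solution once \<open>z\<close> is 0.\<close>

definition follows_paths :: "'a \<Rightarrow> real \<Rightarrow> 'k state \<Rightarrow> bool" where
  "follows_paths \<omega> t c = (case c of
      Select v q \<Rightarrow> t = epoch v \<omega> \<and> q = queue_at_visit v \<omega>
    | Serve v l q z \<Rightarrow>
        let k = queue_of v; a = epoch v \<omega>; n = queue_at_visit v \<omega>; y = min (n k) (Y v (n k) \<omega>)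
        in t = a + (\<Sum>i<l. S v i \<omega>) \<and>
          (\<forall>j. q j + (if j = k then l else 0) = n j + (N j t \<omega> - N j a \<omega>)) \<and>
          z + l = y + (N k t \<omega> - N k a \<omega>) \<and>
          (\<forall>i<l. y + (N k (a + (\<Sum>i'<i. S v i' \<omega>)) \<omega> - N k a \<omega>) \<noteq> i))"

text \<open>Valid on every sample path: where a visit does not end, the states remain in that visit
  and the least solution is never consulted.\<close>

lemma follows_paths:
  assumes \<omega>: "\<omega> \<in> space M"
  shows "follows_paths \<omega> (clock n \<omega>) (state_at n \<omega>)"
proof (induction n)
  case 0
  then show ?case by (simp add: follows_paths_def)
next
  case (Suc n)
  define t where "t = clock n \<omega>"
  define t' where "t' = clock (Suc n) \<omega>"
  have t': "t' = t + dur (src (state_at n \<omega>)) \<omega>" by (simp add: t'_def t_def clock_Suc)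
  have tt: "0 \<le> t" "t \<le> t'" using \<omega> by (simp_all add: t_def t' clock_nonneg)
  have input_at: "input_at n \<omega> = (\<lambda>j. N j t' \<omega> - N j t \<omega> + sel (src (state_at n \<omega>)) \<omega>)"
    by (simp add: input_at_def[abs_def] t_def t'_def)
  show ?case
  proof (cases "state_at n \<omega>")
    case (Select v q)
    then have "t = epoch v \<omega>" "q = queue_at_visit v \<omega>"
      using Suc by (simp_all add: follows_paths_def t_def)
    moreover have "t' = t" by (simp add: t' Select)
    ultimately show ?thesis
      unfolding t'_def[symmetric] by (simp add: state_at_Suc Select follows_paths_def input_at)
  next
    case (Serve v l q z)
    define k where "k = queue_of v"
    define a where "a = epoch v \<omega>"
    define q0 where "q0 = queue_at_visit v \<omega>"
    define y where "y = min (q0 k) (Y v (q0 k) \<omega>)"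
    have fp: "t = a + (\<Sum>i<l. S v i \<omega>)" "\<And>j. q j + (if j = k then l else 0) = q0 j + (N j t \<omega> - N j a \<omega>)"
      "z + l = y + (N k t \<omega> - N k a \<omega>)" "\<And>i. i < l \<Longrightarrow> y + (N k (a + (\<Sum>i'<i. S v i' \<omega>)) \<omega> - N k a \<omega>) \<noteq> i"
      using Suc unfolding t_def[symmetric] Serve
      by (simp_all add: follows_paths_def Let_def k_def a_def q0_def y_def)
    have a: "0 \<le> a" "a \<le> t"
      using \<omega> by (auto simp: a_def epoch_nonneg fp(1) intro!: sum_nonneg service_nonneg)
    have N: "N j a \<omega> \<le> N j t \<omega>" "N j t \<omega> \<le> N j t' \<omega>" for j
      using N_mono[OF \<omega>] a tt by auto
    show ?thesis
    proof (cases "z = 0")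
      case True
      have serv: "services v \<omega> = l"
        unfolding services_def visit_services_def k_def[symmetric] a_def[symmetric] q0_def[symmetric]
      proof (rule Least_equality)
        show "q0 k + (N k (a + (\<Sum>i<l. S v i \<omega>)) \<omega> - N k a \<omega>) = q0 k - Y v (q0 k) \<omega> + l"
          using fp(3) True by (simp add: fp(1) y_def min_def split: if_splits)
        fix m assume "q0 k + (N k (a + (\<Sum>i<m. S v i \<omega>)) \<omega> - N k a \<omega>) = q0 k - Y v (q0 k) \<omega> + m"
        then have "y + (N k (a + (\<Sum>i<m. S v i \<omega>)) \<omega> - N k a \<omega>) = m"
          unfolding y_def min_def by (cases "q0 k \<le> Y v (q0 k) \<omega>"; simp only: if_True if_False; linarith)
        then show "l \<le> m" using fp(4)[of m] by force
      qed
      have e: "t' = epoch (Suc v) \<omega>"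
        by (simp add: epoch_Suc serv t' fp(1) Serve True a_def)
      have "(\<lambda>j. q j + input_at n \<omega> j) = queue_at_visit (Suc v) \<omega>"
      proof
        fix j
        show "q j + input_at n \<omega> j = queue_at_visit (Suc v) \<omega> j"
          using fp(2)[of j] N[of j] unfolding queue_Suc serv e[symmetric] input_at
          by (auto simp: Serve True k_def[symmetric] a_def[symmetric] q0_def[symmetric])
      qed
      then show ?thesis
        unfolding t'_def[symmetric] by (simp add: state_at_Suc Serve True follows_paths_def e)
    next
      case False
      have t'2: "t' = a + (\<Sum>i<Suc l. S v i \<omega>)" by (simp add: t' fp(1) Serve False)
      \<comment> \<open>The excess \<open>z\<close> is at most the queue length, so a positive
        excess means that a customer is present.\<close>
      have q: "1 \<le> q k"
        using fp(2)[of k] fp(3) False by (auto simp: y_def min_def split: if_splits)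
      have 1: "q j + input_at n \<omega> j - (if j = k then 1 else 0) + (if j = k then Suc l else 0) = q0 j + (N j t' \<omega> - N j a \<omega>)" for j
        using fp(2)[of j] N[of j] q by (auto simp: input_at Serve False)
      have 2: "z + input_at n \<omega> k - 1 + Suc l = y + (N k t' \<omega> - N k a \<omega>)"
        using fp(3) N[of k] False by (auto simp: input_at Serve)
      have 3: "y + (N k (a + (\<Sum>i'<i. S v i' \<omega>)) \<omega> - N k a \<omega>) \<noteq> i" if "i < Suc l" for i
        using that fp(4)[of i] fp(3) False by (cases "i = l") (auto simp: fp(1))
      show ?thesis
        unfolding t'_def[symmetric] using False 1 2 3 t'2
        by (simp add: state_at_Suc Serve follows_paths_def Let_def k_def[symmetric] a_def[symmetric] q0_def[symmetric] y_def[symmetric])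
    qed
  qed
qed

lemma state_at_Select: "\<omega> \<in> space M \<Longrightarrow> state_at n \<omega> = Select v q \<Longrightarrow> q = queue_at_visit v \<omega>"
  using follows_paths[of \<omega> n] by (simp add: follows_paths_def)

section \<open>Drift and termination\<close>

text \<open>The one-step expectation of the function, not its change, because extended nonnegative
  reals do not admit genuine subtraction; drift conditions are written with the decrease on the
  left.\<close>

definition drift :: "('k state \<Rightarrow> ennreal) \<Rightarrow> 'k state \<Rightarrow> ennreal" where
  "drift \<Phi> c = (\<integral>\<^sup>+\<omega>. \<Phi> (next_state c (input (src c) \<omega>)) \<partial>M)"

fun valid :: "'k state \<Rightarrow> bool" where
  "valid (Select v q) \<longleftrightarrow> True"
| "valid (Serve v l q z) \<longleftrightarrow> z \<le> q (queue_of v)"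

lemma valid_state_at: "valid (state_at n \<omega>)"
proof (induction n)
  case (Suc n)
  then show ?case by (cases "state_at n \<omega>") (auto simp: state_at_Suc)
qed simp

fun visit :: "'k state \<Rightarrow> nat" where
  "visit (Select v q) = v"
| "visit (Serve v l q z) = v"

abbreviation start_event :: "('k \<Rightarrow> nat) \<Rightarrow> 'a set" where
  "start_event q \<equiv> {\<omega> \<in> space M. Q0 \<omega> = q}"

lemma start_event_sets[measurable]: "start_event q \<in> events"
proof -
  note initial_rv[measurable]
  show ?thesis by measurable
qed

text \<open>Telescoping of the one-step inequality along the chain; the remaining term at time
  \<open>m\<close> is nonnegative and dropped. On a single start event the initial value is finite
  whatever the law of \<open>Q0\<close>.\<close>

lemma drift_sum_le:
  assumes d: "\<And>c. valid c \<Longrightarrow> drift \<Phi> c + g c \<le> \<Phi> c"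
  shows "(\<Sum>n<m. \<integral>\<^sup>+\<omega>. g (state_at n \<omega>) * indicator (start_event q) \<omega> \<partial>M) \<le> \<Phi> (Select 0 q) * emeasure M (start_event q)"
proof -
  let ?G = "\<lambda>g n. \<integral>\<^sup>+\<omega>. g (state_at n \<omega>) * indicator (start_event q) \<omega> \<partial>M"
  have step: "?G \<Phi> (Suc n) + ?G g n \<le> ?G \<Phi> n" for n
  proof -
    have "?G \<Phi> (Suc n) = ?G (drift \<Phi>) n"
      using markov_step[of "\<lambda>c b. \<Phi> (next_state c b)" n q] by (simp add: state_at_Suc drift_def)
    then have "?G \<Phi> (Suc n) + ?G g n = (\<integral>\<^sup>+\<omega>. drift \<Phi> (state_at n \<omega>) * indicator (start_event q) \<omega>
        + g (state_at n \<omega>) * indicator (start_event q) \<omega> \<partial>M)"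
      by (subst nn_integral_add) auto
    also have "\<dots> \<le> ?G \<Phi> n"
      using d[OF valid_state_at] by (intro nn_integral_mono) (auto simp: indicator_def)
    finally show ?thesis .
  qed
  have "(\<Sum>n<m. ?G g n) + ?G \<Phi> m \<le> ?G \<Phi> 0"
  proof (induction m)
    case (Suc m)
    have "(\<Sum>n<Suc m. ?G g n) + ?G \<Phi> (Suc m) = (\<Sum>n<m. ?G g n) + (?G \<Phi> (Suc m) + ?G g m)"
      by (simp add: ac_simps)
    also have "\<dots> \<le> (\<Sum>n<m. ?G g n) + ?G \<Phi> m" using step by (intro add_left_mono)
    finally show ?case using Suc by (rule order_trans)
  qed simp
  also have "?G \<Phi> 0 = (\<integral>\<^sup>+\<omega>. \<Phi> (Select 0 q) * indicator (start_event q) \<omega> \<partial>M)"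
    by (intro nn_integral_cong) (auto simp: indicator_def)
  also have "\<dots> = \<Phi> (Select 0 q) * emeasure M (start_event q)"
    by (rule nn_integral_cmult_indicator) measurable
  finally show ?thesis by (rule order_trans[rotated]) simp
qed

lemma drift_le:
  assumes f: "\<And>c. 0 \<le> f c"
    and h: "\<And>\<omega>. \<omega> \<in> space M \<Longrightarrow> f (next_state c (input (src c) \<omega>)) \<le> h \<omega>"
    and H: "has_bochner_integral M h H" "H \<le> H'"
  shows "drift (\<lambda>c. ennreal (f c)) c \<le> ennreal H'"
proof -
  have "drift (\<lambda>c. ennreal (f c)) c \<le> (\<integral>\<^sup>+\<omega>. ennreal (h \<omega>) \<partial>M)"
    unfolding drift_def by (intro nn_integral_mono ennreal_leI h)
  also have "\<dots> = ennreal H"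
    using H(1) f h by (subst nn_integral_eq_integral) (auto simp: has_bochner_integral_iff intro!: AE_I2 intro: order_trans)
  finally show ?thesis using H(2) by (meson ennreal_leI order_trans)
qed

section \<open>Mean work and the expected number of steps before a visit\<close>

definition work :: "('k \<Rightarrow> nat) \<Rightarrow> real" where
  "work q = (\<Sum>j\<in>UNIV. real (q j) / mu j)"

definition load :: real where
  "load = (\<Sum>k\<in>UNIV. lam k / mu k)"

lemma load_bounds: "0 \<le> load" "load < 1" "lam k / mu k \<le> load"
proof -
  show "0 \<le> load" unfolding load_def by (intro sum_nonneg) (simp add: lam_pos mu_pos less_imp_le)
  show "load < 1" using stable by (simp add: load_def)
  show "lam k / mu k \<le> load"
    unfolding load_def by (rule member_le_sum) (simp_all add: lam_pos mu_pos less_imp_le)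
qed

lemma work_nonneg[simp]: "0 \<le> work q"
  unfolding work_def by (intro sum_nonneg) (simp add: mu_pos less_imp_le)

lemma work_add: "work (\<lambda>j. q j + b j) = work q + work b"
  by (simp add: work_def add_divide_distrib sum.distrib)

lemma work_component: "real (q j) \<le> mu j * work q"
proof -
  have "real (q j) / mu j \<le> work q"
    unfolding work_def by (rule member_le_sum) (simp_all add: mu_pos less_imp_le)
  then show ?thesis using mu_pos[of j] by (simp add: field_simps)
qed

lemma work_serve:
  assumes "1 \<le> q k"
  shows "work (\<lambda>j. q j + b j - (if j = k then 1 else 0)) = work q + work b - 1 / mu k"
proof -
  have "work (\<lambda>j. q j + b j - (if j = k then 1 else 0)) =
      (\<Sum>j\<in>UNIV. (real (q j) + real (b j)) / mu j - (if j = k then 1 / mu k else 0))"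
    unfolding work_def using assms by (intro sum.cong) (auto simp: of_nat_diff diff_divide_distrib)
  also have "\<dots> = work q + work b - 1 / mu k"
    by (simp add: work_def sum_subtractf add_divide_distrib sum.distrib)
  finally show ?thesis .
qed

lemma input_dur: "x \<notin> range (case_prod Selection) \<Longrightarrow> input x \<omega> j = N j (dur x \<omega>) \<omega>"
  by (cases x) (auto simp: input_def)

lemma integral_input:
  assumes "x \<notin> range Arrival" "x \<notin> range (case_prod Selection)"
  shows "has_bochner_integral M (\<lambda>\<omega>. \<Sum>j\<in>UNIV. c j * real (input x \<omega> j)) (\<Sum>j\<in>UNIV. c j * (lam j * dur_mean x))"
  unfolding input_dur[OF assms(2)]
  by (intro has_bochner_integral_sum has_bochner_integral_mult_right has_bochner_integral_N_dur[OF assms(1)])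

lemma integral_work_input:
  assumes "x \<notin> range Arrival" "x \<notin> range (case_prod Selection)"
  shows "has_bochner_integral M (\<lambda>\<omega>. work (input x \<omega>)) (load * dur_mean x)"
  using integral_input[OF assms, of "\<lambda>j. 1 / mu j"]
  by (simp add: work_def load_def sum_distrib_right)

lemma has_bochner_integral_const': "has_bochner_integral M (\<lambda>_. c :: real) c"
  by (simp add: has_bochner_integral_iff prob_space)

lemma s_nonneg:
  assumes "i \<in> {1..I}"
  shows "0 \<le> s i"
proof -
  have "stage I (i - 1) = i" using assms by (auto simp: stage_def)
  then show ?thesis using dur_mean_nonneg[of "Switchover (i - 1)"] by (simp add: dur_mean_def)
qed

lemma dur_mean_switchover_le: "dur_mean (Switchover v) \<le> (\<Sum>i\<in>{1..I}. s i)"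
  unfolding dur_mean_def using stage_range[of v] s_nonneg by (auto intro!: member_le_sum)

lemma dur_mean_service: "dur_mean (Service v l) = 1 / mu (queue_of v)"
  by (simp add: dur_mean_def)

text \<open>A service at \<open>k\<close> lowers the mean work by \<open>(1 - load) / mu k\<close>;
  with this factor the loss is at least one unit, whichever queue is served.\<close>

definition steps_weight :: real where "steps_weight = (\<Sum>k\<in>UNIV. mu k) / (1 - load)"

text \<open>The budget of one visit: the mean growth of the weighted work during its switchover, and
  one unit each for the selection step and the switchover step. The \<open>- 1\<close> in the
  \<open>Serve\<close> case of \<open>steps_bound\<close> is the selection already paid.\<close>

definition steps_const :: real where "steps_const = steps_weight * (load * (\<Sum>i\<in>{1..I}. s i)) + 2"

fun steps_bound :: "nat \<Rightarrow> 'k state \<Rightarrow> real" where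
  "steps_bound G (Select v q) = (if v < G then steps_weight * work q + real (G - v) * steps_const else 0)"
| "steps_bound G (Serve v l q z) = (if v < G then steps_weight * work q + real (G - v) * steps_const - 1 else 0)"

lemma steps_weight_ge: "mu k \<le> steps_weight * (1 - load)" "0 \<le> steps_weight"
proof -
  have "mu k \<le> (\<Sum>k\<in>UNIV. mu k)" by (rule member_le_sum) (simp_all add: mu_pos less_imp_le)
  then show "mu k \<le> steps_weight * (1 - load)" using load_bounds by (simp add: steps_weight_def)
  show "0 \<le> steps_weight" unfolding steps_weight_def
    using load_bounds by (intro divide_nonneg_nonneg sum_nonneg) (simp_all add: mu_pos less_imp_le)
qed

lemma steps_const_ge: "2 \<le> steps_const"
  using steps_weight_ge load_bounds s_sum_pos by (simp add: steps_const_def)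

lemma steps_bound_nonneg: "0 \<le> steps_bound G c"
proof -
  have "1 \<le> real (G - v) * steps_const" if "v < G" for v
    using mult_mono[of 1 "real (G - v)" 1 steps_const] steps_const_ge that by simp
  moreover have "0 \<le> steps_weight * work q" for q using steps_weight_ge by simp
  ultimately have P: "1 \<le> steps_weight * work q + real (G - v) * steps_const" if "v < G" for v q
    using that by (smt (verit))
  show ?thesis
  proof (cases c)
    case (Select v q)
    then show ?thesis using P[of v q] by auto
  next
    case (Serve v l q z)
    then show ?thesis using P[of v q] by auto
  qed
qed

lemma steps_bound_drift:
  assumes v: "valid c"
  shows "drift (\<lambda>c. ennreal (steps_bound G c)) c + (if visit c < G then 1 else 0) \<le> ennreal (steps_bound G c)"
proof (cases "visit c < G")
  case False
  then have "steps_bound G (next_state c b) = 0" for b by (cases c) auto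
  then show ?thesis using False by (simp add: drift_def)
next
  case True
  \<comment> \<open>The second conjunct guards against truncation: it ensures that adding 1 to
    \<open>ennreal (steps_bound G c - 1)\<close> restores the full value.\<close>
  have "drift (\<lambda>c. ennreal (steps_bound G c)) c \<le> ennreal (steps_bound G c - 1) \<and> 1 \<le> steps_bound G c"
  proof (cases c)
    case (Select v q)
    then have G: "v < G" using True by simp
    have "1 \<le> real (G - v) * steps_const"
      using mult_mono[of 1 "real (G - v)" 1 steps_const] steps_const_ge G by simp
    moreover have "0 \<le> steps_weight * work q" using steps_weight_ge by simp
    moreover have "drift (\<lambda>c. ennreal (steps_bound G c)) c \<le> ennreal (steps_bound G c - 1)"
      by (rule drift_le[OF steps_bound_nonneg _ has_bochner_integral_const']) (use G in \<open>auto simp: Select\<close>)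
    ultimately show ?thesis using G by (simp add: Select)
  next
    case (Serve v l q z)
    then have G: "v < G" using True by simp
    have G1: "real (G - v) = real (G - Suc v) + 1" using G by simp
    have W: "0 \<le> steps_weight * work q" using steps_weight_ge by simp
    have GC: "2 \<le> real (G - v) * steps_const"
      using mult_mono[of 1 "real (G - v)" 2 steps_const] steps_const_ge G by simp
    show ?thesis
    proof (cases "z = 0")
      case z: True
      let ?x = "Switchover v"
      have "drift (\<lambda>c. ennreal (steps_bound G c)) c \<le> ennreal (steps_bound G c - 1)"
      proof (rule drift_le[OF steps_bound_nonneg])
        fix \<omega>
        show "steps_bound G (next_state c (input (src c) \<omega>)) \<le> steps_weight * work q + real (G - Suc v) * steps_const + steps_weight * work (input ?x \<omega>)"
          using steps_weight_ge W steps_const_ge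
          by (auto simp: Serve z work_add algebra_simps intro!: add_nonneg_nonneg mult_nonneg_nonneg)
      next
        show "has_bochner_integral M (\<lambda>\<omega>. steps_weight * work q + real (G - Suc v) * steps_const + steps_weight * work (input ?x \<omega>))
          (steps_weight * work q + real (G - Suc v) * steps_const + steps_weight * (load * dur_mean ?x))"
          by (intro has_bochner_integral_add has_bochner_integral_const' has_bochner_integral_mult_right integral_work_input) auto
        have "steps_weight * (load * dur_mean ?x) \<le> steps_const - 2"
          unfolding steps_const_def using dur_mean_switchover_le[of v] steps_weight_ge load_bounds
          by (simp add: mult_left_mono)
        then show "steps_weight * work q + real (G - Suc v) * steps_const + steps_weight * (load * dur_mean ?x) \<le> steps_bound G c - 1"
          using G by (simp add: Serve G1 algebra_simps del: of_nat_diff)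
      qed
      then show ?thesis using G W GC by (simp add: Serve)
    next
      case z: False
      let ?x = "Service v l" and ?k = "queue_of v"
      have q: "1 \<le> q ?k" using v z by (simp add: Serve)
      have wq: "work (\<lambda>j. q j + b j - (if j = ?k then 1 else 0)) = work q + work b - 1 / mu ?k" for b
        using work_serve[of q ?k b] q by simp
      have "1 \<le> steps_weight * (1 - load) * (1 / mu ?k)"
        using steps_weight_ge(1)[of ?k] mu_pos[of ?k] by (simp add: field_simps)
      then have 1: "steps_weight * (load * (1 / mu ?k)) + 1 \<le> steps_weight * (1 / mu ?k)"
        by (simp add: algebra_simps)
      have "drift (\<lambda>c. ennreal (steps_bound G c)) c \<le> ennreal (steps_bound G c - 1)"
      proof (rule drift_le[OF steps_bound_nonneg])
        fix \<omega>
        show "steps_bound G (next_state c (input (src c) \<omega>)) \<le> (steps_weight * work q + real (G - v) * steps_const - 1 - steps_weight * (1 / mu ?k)) + steps_weight * work (input ?x \<omega>)"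
          using G by (simp add: Serve z wq algebra_simps)
      next
        show "has_bochner_integral M (\<lambda>\<omega>. (steps_weight * work q + real (G - v) * steps_const - 1 - steps_weight * (1 / mu ?k)) + steps_weight * work (input ?x \<omega>))
          ((steps_weight * work q + real (G - v) * steps_const - 1 - steps_weight * (1 / mu ?k)) + steps_weight * (load * dur_mean ?x))"
          by (intro has_bochner_integral_add has_bochner_integral_const' has_bochner_integral_mult_right integral_work_input) auto
        show "(steps_weight * work q + real (G - v) * steps_const - 1 - steps_weight * (1 / mu ?k)) + steps_weight * (load * dur_mean ?x) \<le> steps_bound G c - 1"
          using G 1 by (simp add: Serve dur_mean_service)
      qed
      moreover have "1 / mu ?k \<le> work q"
        using work_component[of q ?k] q mu_pos[of ?k] by (simp add: field_simps)
      ultimately show ?thesis using G W GC by (simp add: Serve)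
    qed
  qed
  then show ?thesis
    using True ennreal_plus[of "steps_bound G c - 1" 1] by (auto dest!: add_right_mono[of _ _ 1])
qed

text \<open>From initial vector \<open>q\<close>, the expected number of steps before visit
  \<open>G\<close> is at most \<open>steps_bound\<close>. Remaining below \<open>G\<close> forever
  with positive probability would make it infinite.\<close>

lemma AE_visit_ge: "AE \<omega> in M. \<exists>n. G \<le> visit (state_at n \<omega>)"
proof -
  define E where "E q = {\<omega> \<in> space M. Q0 \<omega> = q \<and> (\<forall>n. visit (state_at n \<omega>) < G)}" for q
  note initial_rv[measurable]
  have [measurable]: "E q \<in> events" for q unfolding E_def by measurable
  have "prob (E q) = 0" for q
  proof (rule ccontr)
    assume "prob (E q) \<noteq> 0"
    then have pos: "0 < prob (E q)" by (simp add: zero_less_measure_iff)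
    obtain m :: nat where m: "steps_bound G (Select 0 q) < real m * prob (E q)"
      using reals_Archimedean3[OF pos] by blast
    have "ennreal (real m * prob (E q)) = (\<Sum>n<m. emeasure M (E q))"
      by (simp add: emeasure_eq_measure ennreal_mult ennreal_of_nat_eq_real_of_nat)
    also have "\<dots> \<le> (\<Sum>n<m. \<integral>\<^sup>+\<omega>. (if visit (state_at n \<omega>) < G then 1 else 0) * indicator (start_event q) \<omega> \<partial>M)"
    proof (rule sum_mono)
      fix n
      have "emeasure M (E q) = (\<integral>\<^sup>+\<omega>. indicator (E q) \<omega> \<partial>M)" by simp
      also have "\<dots> \<le> (\<integral>\<^sup>+\<omega>. (if visit (state_at n \<omega>) < G then 1 else 0) * indicator (start_event q) \<omega> \<partial>M)"
        by (intro nn_integral_mono) (auto simp: indicator_def E_def)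
      finally show "emeasure M (E q) \<le> \<dots>" .
    qed
    also have "\<dots> \<le> ennreal (steps_bound G (Select 0 q)) * emeasure M (start_event q)"
      by (rule drift_sum_le[of "\<lambda>c. ennreal (steps_bound G c)"], rule steps_bound_drift)
    also have "\<dots> \<le> ennreal (steps_bound G (Select 0 q)) * 1"
      by (intro mult_left_mono emeasure_le_1) simp
    finally show False using m steps_bound_nonneg[of G "Select 0 q"] by (simp add: ennreal_le_iff)
  qed
  then have "AE \<omega> in M. \<omega> \<notin> E q" for q
    by (intro AE_not_in) (auto simp: null_sets_def emeasure_eq_measure)
  then have "AE \<omega> in M. \<forall>q. \<omega> \<notin> E q" by (simp add: AE_all_countable)
  then show ?thesis
    by (rule AE_mp) (auto simp: E_def not_less intro!: AE_I2)
qed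

text \<open>The visit number starts at 0 and grows by one at a time, always upon entering a
  \<open>Select\<close> state, so no visit can be skipped.\<close>

lemma visit_ge_imp_Select:
  assumes "G \<le> visit (state_at n \<omega>)"
  shows "\<exists>m\<le>n. \<exists>q. state_at m \<omega> = Select G q"
  using assms
proof (induction n)
  case (Suc n)
  show ?case
  proof (cases "G \<le> visit (state_at n \<omega>)")
    case True
    then show ?thesis using Suc.IH le_SucI by blast
  next
    case False
    then obtain q where "state_at (Suc n) \<omega> = Select G q"
      using Suc.prems by (cases "state_at n \<omega>") (auto simp: state_at_Suc split: if_splits)
    then show ?thesis by blast
  qed
qed simp

lemma AE_reach:
  "AE \<omega> in M. \<exists>n. state_at n \<omega> = Select G (queue_at_visit G \<omega>) \<and> (\<forall>i<n. visit (state_at i \<omega>) < G)"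
  using AE_visit_ge[of G] AE_space
proof eventually_elim
  case (elim \<omega>)
  define n where "n = (LEAST n. G \<le> visit (state_at n \<omega>))"
  have n: "G \<le> visit (state_at n \<omega>)" unfolding n_def by (rule LeastI_ex) (rule elim)
  have less: "visit (state_at i \<omega>) < G" if "i < n" for i
    using not_less_Least[OF that[unfolded n_def]] by simp
  obtain m q where m: "m \<le> n" "state_at m \<omega> = Select G q" using visit_ge_imp_Select[OF n] by blast
  then have "m = n" using less[of m] by (auto simp: le_less)
  then show ?case using m less state_at_Select[OF elim(2)] by blast
qed

section \<open>Quadratic Lyapunov function\<close>

definition second_moments :: bool where
  "second_moments \<longleftrightarrow> (\<forall>k. integrable (S_law k) (\<lambda>x. x\<^sup>2)) \<and> (\<forall>i\<in>{1..I}. integrable (V_law i) (\<lambda>x. x\<^sup>2))"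

lemma dur_square_law:
  "integrable M (\<lambda>\<omega>. (dur (Service v l) \<omega>)\<^sup>2) \<longleftrightarrow> integrable (S_law (queue_of v)) (\<lambda>x. x\<^sup>2)"
  "expectation (\<lambda>\<omega>. (dur (Service v l) \<omega>)\<^sup>2) = (\<integral>x. x\<^sup>2 \<partial>S_law (queue_of v))"
  "integrable M (\<lambda>\<omega>. (dur (Switchover v) \<omega>)\<^sup>2) \<longleftrightarrow> integrable (V_law (stage I v)) (\<lambda>x. x\<^sup>2)"
  "expectation (\<lambda>\<omega>. (dur (Switchover v) \<omega>)\<^sup>2) = (\<integral>x. x\<^sup>2 \<partial>V_law (stage I v))"
  using service_rv[of v l] switchover_rv[of v]
  by (simp_all add: queue_of_def service_law[of v l, symmetric] switchover_law[symmetric]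
      integrable_distr_eq integral_distr)

abbreviation "timed \<equiv> range (case_prod Service) \<union> range Switchover"

lemma timed_not: "x \<in> timed \<Longrightarrow> x \<notin> range Arrival" "x \<in> timed \<Longrightarrow> x \<notin> range (case_prod Selection)"
  by auto

text \<open>One constant serves all steps because only finitely many service and switchover laws
  occur. The sums \<open>m\<close> and \<open>\<sigma>\<close> over all laws stand in for the maxima
  of means and second moments.\<close>

lemma input_square_bound:
  assumes second_moments
  obtains C where "0 \<le> C" "\<And>x. x \<in> timed \<Longrightarrow>
    \<exists>B\<le>C. has_bochner_integral M (\<lambda>\<omega>. \<Sum>j\<in>UNIV. (real (input x \<omega> j))\<^sup>2) B"
proof
  define m where "m = (\<Sum>k\<in>UNIV. 1 / mu k) + (\<Sum>i\<in>{1..I}. s i)"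
  define \<sigma> where "\<sigma> = (\<Sum>k\<in>UNIV. \<integral>x. x\<^sup>2 \<partial>S_law k) + (\<Sum>i\<in>{1..I}. \<integral>x. x\<^sup>2 \<partial>V_law i)"
  define C where "C = (\<Sum>j\<in>UNIV. lam j * m + (lam j)\<^sup>2 * \<sigma>)"
  have sq0: "0 \<le> (\<integral>x. x\<^sup>2 \<partial>L)" for L :: "real measure" by (rule integral_nonneg_AE) simp
  have m: "dur_mean x \<le> m" if "x \<in> timed" for x
  proof -
    have "1 / mu k \<le> (\<Sum>k\<in>UNIV. 1 / mu k)" for k
      by (rule member_le_sum) (simp_all add: mu_pos less_imp_le)
    moreover have "0 \<le> (\<Sum>k\<in>UNIV. 1 / mu k)" by (intro sum_nonneg) (simp add: mu_pos less_imp_le)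
    ultimately show ?thesis
      using that dur_mean_switchover_le s_sum_pos
      by (auto simp: m_def dur_mean_service intro: add_increasing add_increasing2)
  qed
  have \<sigma>: "expectation (\<lambda>\<omega>. (dur x \<omega>)\<^sup>2) \<le> \<sigma>" if "x \<in> timed" for x
  proof -
    have "(\<integral>x. x\<^sup>2 \<partial>S_law k) \<le> (\<Sum>k\<in>UNIV. \<integral>x. x\<^sup>2 \<partial>S_law k)" for k
      by (rule member_le_sum) (simp_all add: sq0)
    moreover have "(\<integral>x. x\<^sup>2 \<partial>V_law (stage I v)) \<le> (\<Sum>i\<in>{1..I}. \<integral>x. x\<^sup>2 \<partial>V_law i)" for v
      using stage_range by (intro member_le_sum) (simp_all add: sq0)
    moreover have "0 \<le> (\<Sum>k\<in>UNIV. \<integral>x. x\<^sup>2 \<partial>S_law k)" "0 \<le> (\<Sum>i\<in>{1..I}. \<integral>x. x\<^sup>2 \<partial>V_law i)"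
      by (simp_all add: sum_nonneg sq0)
    ultimately show ?thesis
      using that unfolding \<sigma>_def by (auto simp: dur_square_law simp del: dur.simps intro: add_increasing add_increasing2)
  qed
  have int: "integrable M (\<lambda>\<omega>. (dur x \<omega>)\<^sup>2)" if "x \<in> timed" for x
    using that assms stage_range
    by (auto simp: second_moments_def dur_square_law simp del: dur.simps)
  show "\<exists>B\<le>C. has_bochner_integral M (\<lambda>\<omega>. \<Sum>j\<in>UNIV. (real (input x \<omega> j))\<^sup>2) B" if x: "x \<in> timed" for x
  proof (intro exI conjI)
    show "has_bochner_integral M (\<lambda>\<omega>. \<Sum>j\<in>UNIV. (real (input x \<omega> j))\<^sup>2)
        (\<Sum>j\<in>UNIV. lam j * dur_mean x + (lam j)\<^sup>2 * expectation (\<lambda>\<omega>. (dur x \<omega>)\<^sup>2))"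
      unfolding input_dur[OF timed_not(2)[OF x]]
      by (intro has_bochner_integral_sum N_dur_sq timed_not(1)[OF x] int[OF x])
    show "(\<Sum>j\<in>UNIV. lam j * dur_mean x + (lam j)\<^sup>2 * expectation (\<lambda>\<omega>. (dur x \<omega>)\<^sup>2)) \<le> C"
      unfolding C_def using m[OF x] \<sigma>[OF x]
      by (intro sum_mono add_mono mult_left_mono) (simp_all add: lam_pos less_imp_le)
  qed
  have "0 \<le> m" unfolding m_def using s_sum_pos by (intro add_nonneg_nonneg sum_nonneg) (simp_all add: mu_pos less_imp_le s_nonneg)
  moreover have "0 \<le> \<sigma>" unfolding \<sigma>_def by (intro add_nonneg_nonneg sum_nonneg sq0)
  ultimately show "0 \<le> C" unfolding C_def
    by (intro sum_nonneg add_nonneg_nonneg mult_nonneg_nonneg) (simp_all add: lam_pos less_imp_le)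
qed

text \<open>Dominates the squared norm of every nonnegative coefficient vector below
  \<open>1 / mu\<close>; it is the Cauchy-Schwarz constant for all changes of
  \<open>level\<close>.\<close>

definition weight_sq :: real where "weight_sq = (\<Sum>j\<in>UNIV. (1 / mu j)\<^sup>2)"

lemma weight_sq_ge: "(1 / mu k)\<^sup>2 \<le> weight_sq" "0 \<le> weight_sq"
proof -
  show "(1 / mu k)\<^sup>2 \<le> weight_sq"
    unfolding weight_sq_def by (rule member_le_sum) simp_all
  show "0 \<le> weight_sq" by (simp add: weight_sq_def sum_nonneg)
qed

lemma linear_form_square:
  fixes y :: "'k \<Rightarrow> real"
  assumes c: "\<And>j. 0 \<le> c j" "\<And>j. c j \<le> 1 / mu j" and d: "0 \<le> d" and y: "\<And>j. 0 \<le> y j"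
  shows "((\<Sum>j\<in>UNIV. c j * y j) - d)\<^sup>2 \<le> weight_sq * (\<Sum>j\<in>UNIV. (y j)\<^sup>2) + d\<^sup>2"
proof -
  let ?A = "\<Sum>j\<in>UNIV. c j * y j"
  have A: "0 \<le> ?A" by (intro sum_nonneg mult_nonneg_nonneg c y)
  have "(?A - d)\<^sup>2 \<le> ?A\<^sup>2 + d\<^sup>2"
    using mult_nonneg_nonneg[OF A d] unfolding power2_diff by linarith
  also have "?A\<^sup>2 \<le> (\<Sum>j\<in>UNIV. (c j)\<^sup>2) * (\<Sum>j\<in>UNIV. (y j)\<^sup>2)" by (rule Cauchy_Schwarz_ineq_sum)
  also have "\<dots> \<le> weight_sq * (\<Sum>j\<in>UNIV. (y j)\<^sup>2)"
    unfolding weight_sq_def using c by (intro mult_right_mono sum_mono power_mono sum_nonneg) auto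
  finally show ?thesis by simp
qed

text \<open>The integrand majorizes the square of \<open>L\<close> plus an increment. The linear
  term has nonpositive mean since the increment does and \<open>L\<close> is nonnegative, so only
  the quadratic part of the increment can raise the mean.\<close>

lemma quadratic_step:
  assumes x: "x \<in> timed" and sq: "\<exists>B\<le>C. has_bochner_integral M (\<lambda>\<omega>. \<Sum>j\<in>UNIV. (real (input x \<omega> j))\<^sup>2) B"
    and mean: "(\<Sum>j\<in>UNIV. c j * (lam j * dur_mean x)) \<le> d" and L: "0 \<le> L"
  obtains H where "has_bochner_integral M (\<lambda>\<omega>. L\<^sup>2 + 2 * L * ((\<Sum>j\<in>UNIV. c j * real (input x \<omega> j)) - d)
      + (weight_sq * (\<Sum>j\<in>UNIV. (real (input x \<omega> j))\<^sup>2) + d\<^sup>2)) H"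
    "H \<le> L\<^sup>2 + (weight_sq * C + d\<^sup>2)"
proof -
  obtain B where B: "B \<le> C" "has_bochner_integral M (\<lambda>\<omega>. \<Sum>j\<in>UNIV. (real (input x \<omega> j))\<^sup>2) B"
    using sq by blast
  define m where "m = (\<Sum>j\<in>UNIV. c j * (lam j * dur_mean x))"
  have "has_bochner_integral M (\<lambda>\<omega>. L\<^sup>2 + 2 * L * ((\<Sum>j\<in>UNIV. c j * real (input x \<omega> j)) - d)
      + (weight_sq * (\<Sum>j\<in>UNIV. (real (input x \<omega> j))\<^sup>2) + d\<^sup>2)) (L\<^sup>2 + 2 * L * (m - d) + (weight_sq * B + d\<^sup>2))"
    unfolding m_def
    by (intro has_bochner_integral_add has_bochner_integral_diff has_bochner_integral_const'
        has_bochner_integral_mult_right integral_input timed_not[OF x] B(2))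
  moreover have "L\<^sup>2 + 2 * L * (m - d) + (weight_sq * B + d\<^sup>2) \<le> L\<^sup>2 + (weight_sq * C + d\<^sup>2)"
    using mult_left_mono[OF B(1) weight_sq_ge(2)] mult_nonneg_nonpos[of "2 * L" "m - d"] L mean
    by (simp add: m_def)
  ultimately show ?thesis using that by blast
qed

section \<open>Coefficients of the supermartingale\<close>

lemma load_k: "0 \<le> lam k / mu k" "lam k / mu k < 1"
  using load_bounds(2) load_bounds(3)[of k] lam_pos[of k] mu_pos[of k] by (simp, linarith)

text \<open>
  A busy period at queue \<open>k\<close> has mean length \<open>1 / (mu k - lam k)\<close>, so \<open>theta k / mu k\<close> is the mean work
  that arrives at the other queues in exchange for one selected customer.
\<close>

definition theta :: "'k \<Rightarrow> real" where
  "theta k = (load - lam k / mu k) / (1 - lam k / mu k)"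

lemma theta_bounds: "0 \<le> theta k" "theta k < 1"
  using load_bounds(2) load_bounds(3)[of k] load_k[of k] by (simp_all add: theta_def field_simps)

text \<open>The probability that a customer present in queue \<open>k\<close> at the start of visit
  \<open>v\<close> is selected in none of the visits \<open>v, ..., G - 1\<close>.\<close>

definition unselected :: "nat \<Rightarrow> nat \<Rightarrow> 'k \<Rightarrow> real" where
  "unselected G v k = (\<Prod>v'\<in>{v..<G}. if queue_of v' = k then 1 - r (stage I v') else 1)"

lemma r_bounds: "0 \<le> r (stage I v)" "r (stage I v) \<le> 1"
  using r_range[OF stage_range[of v]] by auto

lemma unselected_bounds: "0 \<le> unselected G v k" "unselected G v k \<le> 1"
  unfolding unselected_def using r_bounds by (auto intro!: prod_nonneg prod_le_1)

lemma unselected_rec: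
  "v < G \<Longrightarrow> unselected G v k = (if queue_of v = k then 1 - r (stage I v) else 1) * unselected G (Suc v) k"
  by (simp add: unselected_def prod.atLeast_Suc_lessThan)

definition share :: "'k \<Rightarrow> real" where "share k = theta k / mu k"

text \<open>The mean of a value that is \<open>1 / mu k\<close> if the customer is still unselected
  at visit \<open>G\<close> and \<open>share k\<close> otherwise. The work received in exchange for
  a selected customer counts in full, even if some of it is served before \<open>G\<close>; this is
  why only an upper estimate results.\<close>

definition weight :: "nat \<Rightarrow> nat \<Rightarrow> 'k \<Rightarrow> real" where
  "weight G v k = (theta k + (1 - theta k) * unselected G v k) / mu k"

lemma share_bounds: "0 \<le> share k" "share k \<le> 1 / mu k"
  using theta_bounds[of k] mu_pos[of k] by (auto simp: share_def intro!: divide_right_mono divide_nonneg_pos)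

lemma weight_bounds: "share k \<le> weight G v k" "weight G v k \<le> 1 / mu k" "0 \<le> weight G v k"
proof -
  show 1: "share k \<le> weight G v k"
    using theta_bounds[of k] mu_pos[of k] unselected_bounds[of G v k] by (simp add: share_def weight_def divide_right_mono)
  have "(1 - theta k) * unselected G v k \<le> (1 - theta k) * 1"
    using theta_bounds[of k] unselected_bounds[of G v k] by (intro mult_left_mono) auto
  then show "weight G v k \<le> 1 / mu k"
    unfolding weight_def using mu_pos[of k] by (intro divide_right_mono) auto
  show "0 \<le> weight G v k" using 1 share_bounds(1)[of k] by linarith
qed

text \<open>Conditioning on the selection in visit \<open>v\<close>: if \<open>k\<close> is visited,
  then with probability \<open>r (stage I v)\<close> the weight falls to
  \<open>share k\<close>.\<close>

lemma weight_rec: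
  assumes "v < G"
  shows "weight G v k = (if queue_of v = k then weight G (Suc v) k - r (stage I v) * (weight G (Suc v) k - share k)
     else weight G (Suc v) k)"
  using mu_pos[of k] unfolding weight_def unselected_rec[OF assms] share_def
  by (simp add: field_simps)

lemma weight_end: "weight G G k = 1 / mu k"
  by (simp add: weight_def unselected_def)

definition lin :: "nat \<Rightarrow> nat \<Rightarrow> ('k \<Rightarrow> nat) \<Rightarrow> real" where
  "lin G v q = (\<Sum>j\<in>UNIV. weight G v j * real (q j))"

definition drift_up :: real where "drift_up = load * (\<Sum>i\<in>{1..I}. s i)"

lemma drift_up_nonneg: "0 \<le> drift_up"
  using load_bounds s_sum_pos by (simp add: drift_up_def)

text \<open>During a visit the \<open>z\<close> customers of the excess are already selected and
  count \<open>share\<close>; all others carry the weight of the next visit. The multiple of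
  \<open>drift_up\<close> is a reserve for the arrivals in the switchovers still to come before
  \<open>G\<close>.\<close>

fun level :: "nat \<Rightarrow> 'k state \<Rightarrow> real" where
  "level G (Select v q) = lin G v q + real (G - v) * drift_up"
| "level G (Serve v l q z) = lin G (Suc v) q
     - (weight G (Suc v) (queue_of v) - share (queue_of v)) * real z + real (G - v) * drift_up"

lemma lin_nonneg: "0 \<le> lin G v q"
  unfolding lin_def by (intro sum_nonneg mult_nonneg_nonneg weight_bounds) simp

lemma level_nonneg:
  assumes "valid c"
  shows "0 \<le> level G c"
proof (cases c)
  case (Select v q)
  then show ?thesis using lin_nonneg drift_up_nonneg by simp
next
  case (Serve v l q z)
  let ?k = "queue_of v"
  have "(weight G (Suc v) ?k - share ?k) * real z \<le> weight G (Suc v) ?k * real (q ?k)"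
    using assms share_bounds(1)[of ?k] weight_bounds[where k="?k" and G=G and v="Suc v"] by (intro mult_mono) (auto simp: Serve)
  also have "\<dots> \<le> lin G (Suc v) q"
    unfolding lin_def by (rule member_le_sum) (auto intro!: mult_nonneg_nonneg weight_bounds)
  finally show ?thesis using drift_up_nonneg by (simp add: Serve)
qed

section \<open>Constants of the Lyapunov function and its drift\<close>

definition var_const :: "real \<Rightarrow> real" where
  "var_const C = weight_sq * C + weight_sq + drift_up\<^sup>2"

text \<open>The first summand, multiplied by the mean loss of work in a service, covers
  \<open>var_const\<close>; the second covers the binomial variance of a selection, since the
  customers present number at most \<open>(\<Sum>k. mu k)\<close> times the work.\<close>

definition work_coeff :: "real \<Rightarrow> real" where
  "work_coeff C = var_const C * steps_weight + weight_sq * (\<Sum>k\<in>UNIV. mu k)"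

text \<open>The cost of one switchover: the growth of the linear work term, whose coefficient is at
  most \<open>2 * work_coeff C * G\<close>, and the variance.\<close>

definition const_term :: "real \<Rightarrow> nat \<Rightarrow> real" where
  "const_term C G = 2 * work_coeff C * real G * drift_up + var_const C"

text \<open>\<open>level\<close> is a nonnegative supermartingale; the linear summands pay for its conditional variance.\<close>

fun lyapunov :: "real \<Rightarrow> nat \<Rightarrow> 'k state \<Rightarrow> real" where
  "lyapunov C G (Select v q) = (if v \<le> G then (level G (Select v q))\<^sup>2
      + 2 * work_coeff C * real (G - v) * work q + real (G - v) * const_term C G else 0)"
| "lyapunov C G (Serve v l q z) = (if v < G then (level G (Serve v l q z))\<^sup>2
      + work_coeff C * (2 * real (G - v) - 1) * work q + real (G - v) * const_term C G else 0)"

lemma var_const_nonneg: "0 \<le> C \<Longrightarrow> 0 \<le> var_const C"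
  using weight_sq_ge by (simp add: var_const_def)

lemma work_coeff_nonneg: "0 \<le> C \<Longrightarrow> 0 \<le> work_coeff C"
  unfolding work_coeff_def using var_const_nonneg steps_weight_ge weight_sq_ge
  by (intro add_nonneg_nonneg mult_nonneg_nonneg sum_nonneg) (simp_all add: mu_pos less_imp_le)

lemma const_term_nonneg: "0 \<le> C \<Longrightarrow> 0 \<le> const_term C G"
  unfolding const_term_def using work_coeff_nonneg var_const_nonneg drift_up_nonneg by simp

lemma lyapunov_nonneg:
  assumes "0 \<le> C"
  shows "0 \<le> lyapunov C G c"
proof (cases c)
  case (Select v q)
  then show ?thesis using work_coeff_nonneg[OF assms] const_term_nonneg[OF assms] by auto
next
  case (Serve v l q z)
  then show ?thesis using work_coeff_nonneg[OF assms] const_term_nonneg[OF assms]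
    by (auto intro!: add_nonneg_nonneg mult_nonneg_nonneg)
qed

text \<open>A binomial variable never exceeds \<open>n\<close> up to a null set, so the cap in
  \<open>next_state\<close> does not change its law.\<close>

lemma nn_integral_Y:
  assumes "\<And>y. y \<le> n \<Longrightarrow> 0 \<le> (f y :: real)"
  shows "(\<integral>\<^sup>+\<omega>. ennreal (f (min n (input (Selection v n) \<omega> j))) \<partial>M) =
    ennreal (measure_pmf.expectation (binomial_pmf n (r (stage I v))) f)"
proof -
  let ?B = "binomial_pmf n (r (stage I v))"
  have rb: "r (stage I v) \<in> {0..1}" using r_bounds by simp
  have fin: "finite (set_pmf ?B)" by (rule finite_set_pmf_binomial_pmf[OF rb])
  have le: "y \<le> n" if "y \<in> set_pmf ?B" for y
    using that set_pmf_binomial_eq[of "r (stage I v)" n] rb by (auto split: if_splits)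
  have "(\<integral>\<^sup>+\<omega>. ennreal (f (min n (input (Selection v n) \<omega> j))) \<partial>M) = (\<integral>\<^sup>+\<omega>. ennreal (f (min n (Y v n \<omega>))) \<partial>M)"
    by (intro nn_integral_cong) (simp add: input_def)
  also have "\<dots> = (\<integral>\<^sup>+y. ennreal (f (min n y)) \<partial>distr M (count_space UNIV) (Y v n))"
    using selection_rv[of v n] by (subst nn_integral_distr) auto
  also have "\<dots> = (\<integral>\<^sup>+y. ennreal (f (min n y)) \<partial>?B)" by (simp add: selection_law)
  also have "\<dots> = (\<integral>\<^sup>+y. ennreal (f y) \<partial>?B)"
    by (intro nn_integral_cong_AE) (auto simp: AE_measure_pmf_iff min_absorb2 dest: le)
  also have "\<dots> = ennreal (measure_pmf.expectation ?B f)"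
    using fin le assms by (intro nn_integral_eq_integral integrable_measure_pmf_finite) (auto simp: AE_measure_pmf_iff)
  finally show ?thesis .
qed

text \<open>By \<open>weight_rec\<close> the mean of \<open>level\<close> is unchanged, so its
  squared mean grows by a binomial variance, which is at most \<open>work_coeff C * work q\<close>.
  The coefficient of \<open>work\<close> falls from \<open>2 * (G - v)\<close> to
  \<open>2 * (G - v) - 1\<close> times \<open>work_coeff C\<close> and releases just this
  amount.\<close>

lemma lyapunov_drift_Select:
  assumes C: "0 \<le> C" and v: "v < G"
  shows "drift (\<lambda>c. ennreal (lyapunov C G c)) (Select v q) \<le> ennreal (lyapunov C G (Select v q))"
proof -
  let ?k = "queue_of v"
  define n where "n = q ?k"
  define a where "a = weight G (Suc v) ?k - share ?k"
  define A where "A = lin G (Suc v) q + real (G - v) * drift_up"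
  define U where "U = work_coeff C * (2 * real (G - v) - 1) * work q + real (G - v) * const_term C G"
  have a: "0 \<le> a" "a \<le> 1 / mu ?k"
    using weight_bounds[where k="?k" and G=G and v="Suc v"] share_bounds(1)[of ?k] by (auto simp: a_def)
  have U: "0 \<le> U" unfolding U_def using v work_coeff_nonneg[OF C] const_term_nonneg[OF C]
    by (intro add_nonneg_nonneg mult_nonneg_nonneg) auto
  have rb: "r (stage I v) \<in> {0..1}" using r_bounds by simp
  let ?r = "r (stage I v)"
  let ?B = "binomial_pmf n ?r"
  have lin: "lin G v q = lin G (Suc v) q - a * (real n * ?r)"
  proof -
    have "lin G v q = (\<Sum>j\<in>UNIV. weight G (Suc v) j * real (q j) - (if j = ?k then a * (real n * ?r) else 0))"
      unfolding lin_def by (intro sum.cong) (auto simp: weight_rec[OF v] a_def n_def algebra_simps)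
    then show ?thesis by (simp add: sum_subtractf lin_def)
  qed
  have "drift (\<lambda>c. ennreal (lyapunov C G c)) (Select v q) =
      (\<integral>\<^sup>+\<omega>. ennreal ((\<lambda>y. (A - a * real y)\<^sup>2 + U) (min n (input (Selection v n) \<omega> ?k))) \<partial>M)"
    unfolding drift_def using v
    by (intro nn_integral_cong) (simp add: n_def A_def a_def U_def algebra_simps)
  also have "\<dots> = ennreal (measure_pmf.expectation ?B (\<lambda>y. (A - a * real y)\<^sup>2 + U))"
    by (rule nn_integral_Y) (use U in simp)
  also have "measure_pmf.expectation ?B (\<lambda>y. (A - a * real y)\<^sup>2 + U) =
      (A - a * (real n * ?r))\<^sup>2 + a\<^sup>2 * (real n * (?r * (1 - ?r))) + U"
  proof -
    have "integrable ?B (\<lambda>y. (A - a * real y)\<^sup>2)"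
      by (intro integrable_measure_pmf_finite finite_set_pmf_binomial_pmf[OF rb])
    then show ?thesis by (simp add: Bochner_Integration.integral_add binomial_affine_square[OF rb])
  qed
  also have "\<dots> \<le> (A - a * (real n * ?r))\<^sup>2 + work_coeff C * work q + U"
  proof -
    have "?r * (1 - ?r) \<le> 1 * 1" using rb by (intro mult_mono) auto
    then have "real n * (?r * (1 - ?r)) \<le> real n" by (metis mult.right_neutral mult_left_mono of_nat_0_le_iff)
    moreover have "a\<^sup>2 \<le> weight_sq" using power_mono[OF a(2,1), of 2] weight_sq_ge(1)[of ?k] by linarith
    ultimately have "a\<^sup>2 * (real n * (?r * (1 - ?r))) \<le> weight_sq * real n"
      using rb by (intro mult_mono) (auto simp: weight_sq_ge)
    also have "\<dots> \<le> weight_sq * ((\<Sum>k\<in>UNIV. mu k) * work q)"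
    proof (intro mult_left_mono weight_sq_ge)
      have "mu ?k \<le> (\<Sum>k\<in>UNIV. mu k)" by (rule member_le_sum) (simp_all add: mu_pos less_imp_le)
      then show "real n \<le> (\<Sum>k\<in>UNIV. mu k) * work q"
        using work_component[of q ?k] mult_right_mono[of "mu ?k" _ "work q"] by (force simp: n_def)
    qed
    also have "\<dots> \<le> work_coeff C * work q"
      unfolding work_coeff_def using var_const_nonneg[OF C] steps_weight_ge by (simp add: distrib_right mult.assoc)
    finally show ?thesis by simp
  qed
  also have "\<dots> = lyapunov C G (Select v q)"
    using v by (simp add: A_def U_def lin algebra_simps)
  finally show ?thesis by (simp add: ennreal_leI)
qed

text \<open>The mean change of \<open>level\<close> is nonpositive by the choice of
  \<open>share\<close>, and the mean decrease of the work, times its coefficient, pays for the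
  quadratic part.\<close>

lemma lyapunov_drift_service:
  assumes C: "0 \<le> C" and sq: "\<And>x. x \<in> timed \<Longrightarrow>
      \<exists>B\<le>C. has_bochner_integral M (\<lambda>\<omega>. \<Sum>j\<in>UNIV. (real (input x \<omega> j))\<^sup>2) B"
    and v: "v < G" and z: "0 < z" "z \<le> q (queue_of v)"
  shows "drift (\<lambda>c. ennreal (lyapunov C G c)) (Serve v l q z) \<le> ennreal (lyapunov C G (Serve v l q z))"
proof -
  let ?k = "queue_of v" and ?x = "Service v l"
  \<comment> \<open>An arrival at the served queue also increases \<open>z\<close>, so it enters
    with \<open>share\<close>; arrivals elsewhere keep the weight of the next visit.\<close>
  define c where "c j = (if j = ?k then share ?k else weight G (Suc v) j)" for j
  define L where "L = level G (Serve v l q z)"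
  define K where "K = work_coeff C * (2 * real (G - v) - 1)"
  define R where "R = real (G - v) * const_term C G"
  have q: "1 \<le> q ?k" using z by linarith
  have c: "0 \<le> c j" "c j \<le> 1 / mu j" for j
    using share_bounds[of ?k] weight_bounds[where k="j" and G=G and v="Suc v"] by (auto simp: c_def)
  have L: "0 \<le> L" unfolding L_def by (rule level_nonneg) (use z in simp)
  have K: "work_coeff C \<le> K" unfolding K_def using v work_coeff_nonneg[OF C] mult_left_mono[of 1 "2 * real (G - v) - 1" "work_coeff C"] by simp
  have mean: "(\<Sum>j\<in>UNIV. c j * (lam j * dur_mean ?x)) \<le> share ?k"
  proof -
    have "(\<Sum>j\<in>UNIV. c j * (lam j * dur_mean ?x)) \<le> (\<Sum>j\<in>UNIV. lam j / mu j * (1 / mu ?k)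
        - (if j = ?k then (1 / mu ?k - share ?k) * (lam ?k / mu ?k) else 0))"
    proof (rule sum_mono)
      fix j
      have "c j * (lam j * dur_mean ?x) \<le> (1 / mu j) * (lam j * (1 / mu ?k))" if "j \<noteq> ?k"
        unfolding dur_mean_service using c lam_pos[of j] mu_pos[of ?k] by (intro mult_right_mono) (auto intro!: mult_nonneg_nonneg)
      then show "c j * (lam j * dur_mean ?x) \<le> lam j / mu j * (1 / mu ?k)
          - (if j = ?k then (1 / mu ?k - share ?k) * (lam ?k / mu ?k) else 0)"
      proof (cases "j = ?k")
        case True
        then show ?thesis using mu_pos[of ?k] by (simp add: c_def dur_mean_service field_simps)
      next
        case False
        with \<open>j \<noteq> ?k \<Longrightarrow> _\<close> show ?thesis by simp
      qed
    qed
    also have "\<dots> = load * (1 / mu ?k) - (1 / mu ?k - share ?k) * (lam ?k / mu ?k)"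
      by (simp add: sum_subtractf load_def sum_divide_distrib)
    \<comment> \<open>The balance equation behind \<open>theta\<close>: a service releases
      \<open>share\<close>, and it brings in work for the other queues together with further
      customers of the same busy period, each worth \<open>share\<close> again.\<close>
    also have "\<dots> = share ?k"
    proof -
      have "share ?k * (1 - lam ?k / mu ?k) = (load - lam ?k / mu ?k) / mu ?k"
      proof -
        have "(load - x) / (1 - x) * (1 - x) = load - x" if "x < 1" for x :: real using that by simp
        from this[OF load_k(2)[of ?k]] have "theta ?k * (1 - lam ?k / mu ?k) = load - lam ?k / mu ?k"
          unfolding theta_def .
        then show ?thesis unfolding share_def times_divide_eq_left by (rule arg_cong)
      qed
      then show ?thesis by (simp add: algebra_simps diff_divide_distrib)
    qed
    finally show ?thesis .
  qed
  obtain H where H: "has_bochner_integral M (\<lambda>\<omega>. L\<^sup>2 + 2 * L * ((\<Sum>j\<in>UNIV. c j * real (input ?x \<omega> j)) - share ?k)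
      + (weight_sq * (\<Sum>j\<in>UNIV. (real (input ?x \<omega> j))\<^sup>2) + (share ?k)\<^sup>2)) H"
      "H \<le> L\<^sup>2 + (weight_sq * C + (share ?k)\<^sup>2)"
    by (rule quadratic_step[OF _ sq mean L]) auto
  have level: "level G (next_state (Serve v l q z) b) = L + ((\<Sum>j\<in>UNIV. c j * real (b j)) - share ?k)" for b
  proof -
    have "lin G (Suc v) (\<lambda>j. q j + b j - (if j = ?k then 1 else 0)) =
        (\<Sum>j\<in>UNIV. weight G (Suc v) j * real (q j) + c j * real (b j)
          + (if j = ?k then (weight G (Suc v) ?k - share ?k) * real (b ?k) - weight G (Suc v) ?k else 0))"
      unfolding lin_def using q by (intro sum.cong) (auto simp: c_def of_nat_diff algebra_simps)
    then show ?thesis using z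
      by (simp add: L_def lin_def sum.distrib of_nat_diff algebra_simps)
  qed
  show ?thesis
  proof (rule drift_le)
    show "0 \<le> lyapunov C G c" for c by (rule lyapunov_nonneg[OF C])
    fix \<omega>
    let ?b = "input ?x \<omega>"
    have e: "lyapunov C G (next_state (Serve v l q z) ?b) = (level G (next_state (Serve v l q z) ?b))\<^sup>2 + K * (work q + work ?b - 1 / mu ?k) + R"
      using z v by (simp add: K_def R_def work_serve[of q ?k ?b] q)
    have le: "(level G (next_state (Serve v l q z) ?b))\<^sup>2 \<le> L\<^sup>2 + 2 * L * ((\<Sum>j\<in>UNIV. c j * real (?b j)) - share ?k)
      + (weight_sq * (\<Sum>j\<in>UNIV. (real (?b j))\<^sup>2) + (share ?k)\<^sup>2)"
      unfolding level power2_sum using linear_form_square[OF c share_bounds(1)[of ?k], of "\<lambda>j. real (?b j)"] by simp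
    have "src (Serve v l q z) = ?x" using z by simp
    then show "lyapunov C G (next_state (Serve v l q z) (input (src (Serve v l q z)) \<omega>)) \<le>
        (L\<^sup>2 + 2 * L * ((\<Sum>j\<in>UNIV. c j * real (?b j)) - share ?k)
      + (weight_sq * (\<Sum>j\<in>UNIV. (real (?b j))\<^sup>2) + (share ?k)\<^sup>2)) + K * (work q + work ?b - 1 / mu ?k) + R"
      using e le by (simp only:)
  next
    show "has_bochner_integral M (\<lambda>\<omega>. (L\<^sup>2 + 2 * L * ((\<Sum>j\<in>UNIV. c j * real (input ?x \<omega> j)) - share ?k)
      + (weight_sq * (\<Sum>j\<in>UNIV. (real (input ?x \<omega> j))\<^sup>2) + (share ?k)\<^sup>2)) + K * (work q + work (input ?x \<omega>) - 1 / mu ?k) + R)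
      (H + K * (work q + load * dur_mean ?x - 1 / mu ?k) + R)"
      by (intro has_bochner_integral_add has_bochner_integral_diff has_bochner_integral_const'
        has_bochner_integral_mult_right integral_work_input H(1)) auto
    have lyapunov_eq: "lyapunov C G (Serve v l q z) = L\<^sup>2 + K * work q + R"
      using v by (simp add: L_def K_def R_def)
    \<comment> \<open>Even in the last visit before \<open>G\<close> the coefficient is at least
      \<open>work_coeff C\<close>, because \<open>2 * (G - v) - 1\<close> is at least 1.\<close>
    have "var_const C \<le> K * ((1 - load) / mu ?k)"
    proof -
      have "var_const C * 1 \<le> var_const C * (steps_weight * (1 - load) / mu ?k)"
        using steps_weight_ge(1)[of ?k] mu_pos[of ?k] by (intro mult_left_mono var_const_nonneg[OF C]) (simp add: field_simps)
      also have "\<dots> = (var_const C * steps_weight) * ((1 - load) / mu ?k)" by simp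
      also have "\<dots> \<le> K * ((1 - load) / mu ?k)"
      proof (intro mult_right_mono order_trans[OF _ K])
        show "var_const C * steps_weight \<le> work_coeff C" unfolding work_coeff_def using weight_sq_ge
          by (simp add: sum_nonneg mu_pos less_imp_le)
      qed (use load_bounds mu_pos[of ?k] in auto)
      finally show ?thesis by simp
    qed
    moreover have "weight_sq * C + (share ?k)\<^sup>2 \<le> var_const C"
      using power_mono[OF share_bounds(2,1), of ?k 2] weight_sq_ge(1)[of ?k] zero_le_power2[of drift_up]
      unfolding var_const_def by linarith
    moreover have "K * (work q + load * dur_mean ?x - 1 / mu ?k) = K * work q - K * ((1 - load) / mu ?k)"
      by (simp add: dur_mean_service algebra_simps diff_divide_distrib)
    ultimately show "H + K * (work q + load * dur_mean ?x - 1 / mu ?k) + R \<le> lyapunov C G (Serve v l q z)"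
      using H(2) lyapunov_eq by linarith
  qed
qed

text \<open>Passing to visit \<open>v + 1\<close> releases one \<open>drift_up\<close> in
  \<open>level\<close>, which offsets the mean of the weighted arrivals, and one
  \<open>const_term\<close>, which pays for their variance and for the growth of the work.\<close>

lemma lyapunov_drift_switchover:
  assumes C: "0 \<le> C" and sq: "\<And>x. x \<in> timed \<Longrightarrow>
      \<exists>B\<le>C. has_bochner_integral M (\<lambda>\<omega>. \<Sum>j\<in>UNIV. (real (input x \<omega> j))\<^sup>2) B"
    and v: "v < G"
  shows "drift (\<lambda>c. ennreal (lyapunov C G c)) (Serve v l q 0) \<le> ennreal (lyapunov C G (Serve v l q 0))"
proof -
  let ?x = "Switchover v"
  define L where "L = level G (Serve v l q 0)"
  define K where "K = 2 * work_coeff C * real (G - Suc v)"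
  define R where "R = real (G - Suc v) * const_term C G"
  have G1: "real (G - v) = real (G - Suc v) + 1" using v by simp
  have L: "0 \<le> L" unfolding L_def by (rule level_nonneg) simp
  have K: "0 \<le> K" unfolding K_def using work_coeff_nonneg[OF C] by simp
  have up: "load * dur_mean ?x \<le> drift_up"
    unfolding drift_up_def using dur_mean_switchover_le load_bounds by (intro mult_left_mono) auto
  have mean: "(\<Sum>j\<in>UNIV. weight G (Suc v) j * (lam j * dur_mean ?x)) \<le> drift_up"
  proof -
    have "(\<Sum>j\<in>UNIV. weight G (Suc v) j * (lam j * dur_mean ?x)) \<le> (\<Sum>j\<in>UNIV. (1 / mu j) * (lam j * dur_mean ?x))"
      using weight_bounds(2) by (intro sum_mono mult_right_mono) (simp_all add: lam_pos less_imp_le)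
    also have "\<dots> = load * dur_mean ?x" by (simp add: load_def sum_distrib_right)
    finally show ?thesis using up by simp
  qed
  obtain H where H: "has_bochner_integral M (\<lambda>\<omega>. L\<^sup>2 + 2 * L * ((\<Sum>j\<in>UNIV. weight G (Suc v) j * real (input ?x \<omega> j)) - drift_up)
      + (weight_sq * (\<Sum>j\<in>UNIV. (real (input ?x \<omega> j))\<^sup>2) + drift_up\<^sup>2)) H"
      "H \<le> L\<^sup>2 + (weight_sq * C + drift_up\<^sup>2)"
    by (rule quadratic_step[OF _ sq mean L]) auto
  have level: "level G (next_state (Serve v l q 0) b) = L + ((\<Sum>j\<in>UNIV. weight G (Suc v) j * real (b j)) - drift_up)" for b
    by (simp add: L_def lin_def G1 sum.distrib algebra_simps del: of_nat_diff)
  show ?thesis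
  proof (rule drift_le)
    show "0 \<le> lyapunov C G c" for c by (rule lyapunov_nonneg[OF C])
    fix \<omega>
    let ?b = "input ?x \<omega>"
    have e: "lyapunov C G (next_state (Serve v l q 0) ?b) = (level G (next_state (Serve v l q 0) ?b))\<^sup>2 + K * (work q + work ?b) + R"
      using v by (simp add: K_def R_def work_add)
    have le: "(level G (next_state (Serve v l q 0) ?b))\<^sup>2 \<le> L\<^sup>2 + 2 * L * ((\<Sum>j\<in>UNIV. weight G (Suc v) j * real (?b j)) - drift_up)
      + (weight_sq * (\<Sum>j\<in>UNIV. (real (?b j))\<^sup>2) + drift_up\<^sup>2)"
      unfolding level power2_sum using linear_form_square[where c="weight G (Suc v)" and d=drift_up and y="\<lambda>j. real (?b j)",
          OF weight_bounds(3,2) drift_up_nonneg] by simp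
    have "src (Serve v l q 0) = ?x" by simp
    then show "lyapunov C G (next_state (Serve v l q 0) (input (src (Serve v l q 0)) \<omega>)) \<le>
        (L\<^sup>2 + 2 * L * ((\<Sum>j\<in>UNIV. weight G (Suc v) j * real (?b j)) - drift_up)
      + (weight_sq * (\<Sum>j\<in>UNIV. (real (?b j))\<^sup>2) + drift_up\<^sup>2)) + K * (work q + work ?b) + R"
      using e le by (simp only:)
  next
    show "has_bochner_integral M (\<lambda>\<omega>. (L\<^sup>2 + 2 * L * ((\<Sum>j\<in>UNIV. weight G (Suc v) j * real (input ?x \<omega> j)) - drift_up)
      + (weight_sq * (\<Sum>j\<in>UNIV. (real (input ?x \<omega> j))\<^sup>2) + drift_up\<^sup>2)) + K * (work q + work (input ?x \<omega>)) + R)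
      (H + K * (work q + load * dur_mean ?x) + R)"
      by (intro has_bochner_integral_add has_bochner_integral_const'
        has_bochner_integral_mult_right integral_work_input H(1)) auto
    have "K * (load * dur_mean ?x) \<le> 2 * work_coeff C * real G * drift_up"
      unfolding K_def using up work_coeff_nonneg[OF C] load_bounds by (intro mult_mono) (auto intro!: mult_nonneg_nonneg)
    then have "K * (load * dur_mean ?x) + (weight_sq * C + drift_up\<^sup>2) \<le> const_term C G"
      using weight_sq_ge by (simp add: const_term_def var_const_def)
    moreover have "lyapunov C G (Serve v l q 0) = L\<^sup>2 + K * work q + work_coeff C * work q + R + const_term C G"
      using v by (simp add: L_def K_def R_def G1 algebra_simps del: of_nat_diff level.simps)
    moreover have "0 \<le> work_coeff C * work q" using work_coeff_nonneg[OF C] by simp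
    ultimately show "H + K * (work q + load * dur_mean ?x) + R \<le> lyapunov C G (Serve v l q 0)"
      using H(2) by (simp add: distrib_left)
  qed
qed

definition target_square :: "nat \<Rightarrow> 'k state \<Rightarrow> real" where
  "target_square G c = (case c of Select v q \<Rightarrow> if v = G then (work q)\<^sup>2 else 0 | _ \<Rightarrow> 0)"

text \<open>Upon leaving visit \<open>G\<close> at its selection the function vanishes, so its whole
  value at \<open>Select G q\<close> can be spent; there all weights equal \<open>1 / mu\<close> and
  the value is the squared work.\<close>

lemma lyapunov_drift:
  assumes C: "0 \<le> C" and sq: "\<And>x. x \<in> timed \<Longrightarrow>
      \<exists>B\<le>C. has_bochner_integral M (\<lambda>\<omega>. \<Sum>j\<in>UNIV. (real (input x \<omega> j))\<^sup>2) B"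
    and c: "valid c"
  shows "drift (\<lambda>c. ennreal (lyapunov C G c)) c + ennreal (target_square G c) \<le> ennreal (lyapunov C G c)"
proof (cases "visit c < G")
  case True
  then have "target_square G c = 0" by (cases c) (auto simp: target_square_def)
  moreover have "drift (\<lambda>c. ennreal (lyapunov C G c)) c \<le> ennreal (lyapunov C G c)"
  proof (cases c)
    case (Select v q)
    then show ?thesis using True lyapunov_drift_Select[OF C] by simp
  next
    case (Serve v l q z)
    then show ?thesis
      using True c lyapunov_drift_service[OF C sq, of v G z q l] lyapunov_drift_switchover[OF C sq, of v G l q]
      by (cases "z = 0") auto
  qed
  ultimately show ?thesis by simp
next
  case False
  then have "lyapunov C G (next_state c b) = 0" for b by (cases c) auto
  moreover have "target_square G c \<le> lyapunov C G c"
    using False by (cases c) (auto simp: target_square_def lin_def weight_end work_def lyapunov_nonneg[OF C])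
  ultimately show ?thesis by (simp add: drift_def ennreal_leI)
qed

text \<open>The chain almost surely meets the state \<open>Select G\<close> with the true queue
  vector, so the squared work there is one term of the sum over all steps, and that sum is bounded
  by the initial Lyapunov value.\<close>

lemma second_moment_bound:
  assumes second_moments
  obtains C where "0 \<le> C" "\<And>G q. (\<integral>\<^sup>+\<omega>. ennreal ((work (queue_at_visit G \<omega>))\<^sup>2) * indicator (start_event q) \<omega> \<partial>M)
    \<le> ennreal (lyapunov C G (Select 0 q)) * emeasure M (start_event q)"
proof -
  obtain C where C: "0 \<le> C" "\<And>x. x \<in> timed \<Longrightarrow>
      \<exists>B\<le>C. has_bochner_integral M (\<lambda>\<omega>. \<Sum>j\<in>UNIV. (real (input x \<omega> j))\<^sup>2) B"
    using input_square_bound[OF assms] by blast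
  have "(\<integral>\<^sup>+\<omega>. ennreal ((work (queue_at_visit G \<omega>))\<^sup>2) * indicator (start_event q) \<omega> \<partial>M)
    \<le> ennreal (lyapunov C G (Select 0 q)) * emeasure M (start_event q)" for G q
  proof -
    have "(\<integral>\<^sup>+\<omega>. ennreal ((work (queue_at_visit G \<omega>))\<^sup>2) * indicator (start_event q) \<omega> \<partial>M) \<le>
        (\<integral>\<^sup>+\<omega>. (\<Sum>n. ennreal (target_square G (state_at n \<omega>)) * indicator (start_event q) \<omega>) \<partial>M)"
    proof (rule nn_integral_mono_AE)
      show "AE \<omega> in M. ennreal ((work (queue_at_visit G \<omega>))\<^sup>2) * indicator (start_event q) \<omega>
          \<le> (\<Sum>n. ennreal (target_square G (state_at n \<omega>)) * indicator (start_event q) \<omega>)"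
        using AE_reach[of G]
      proof eventually_elim
        case (elim \<omega>)
        then obtain n where n: "state_at n \<omega> = Select G (queue_at_visit G \<omega>)" by blast
        let ?f = "\<lambda>n. ennreal (target_square G (state_at n \<omega>)) * indicator (start_event q) \<omega>"
        have "ennreal ((work (queue_at_visit G \<omega>))\<^sup>2) * indicator (start_event q) \<omega> = sum ?f {n}"
          by (simp add: n target_square_def)
        also have "\<dots> \<le> suminf ?f" by (rule sum_le_suminf) auto
        finally show ?case .
      qed
    qed
    also have "\<dots> = (\<Sum>n. \<integral>\<^sup>+\<omega>. ennreal (target_square G (state_at n \<omega>)) * indicator (start_event q) \<omega> \<partial>M)"
      by (rule nn_integral_suminf) measurable
    also have "\<dots> \<le> ennreal (lyapunov C G (Select 0 q)) * emeasure M (start_event q)"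
      by (intro suminf_le_const summableI drift_sum_le[of "\<lambda>c. ennreal (lyapunov C G c)"] lyapunov_drift C)
    finally show ?thesis .
  qed
  then show ?thesis using that C(1) by blast
qed

section \<open>Sufficiency and necessity\<close>

text \<open>Some stage of the cycle visits \<open>k\<close> with positive selection probability; its
  factor is below 1 and the remaining ones are at most 1.\<close>

lemma unselected_cycle: "unselected I 0 k < 1"
proof -
  obtain i where i: "i \<in> {1..I}" "p i = k" "0 < r i"
  proof (rule ccontr)
    assume "\<not> thesis"
    then have "(\<Sum>i\<in>{i \<in> {1..I}. p i = k}. r i) \<le> 0" using that by (intro sum_nonpos) force
    then show False using r_sum_pos[of k] by simp
  qed
  define v where "v = i - 1"
  have v: "v \<in> {0..<I}" "stage I v = i" "queue_of v = k"
    using i by (auto simp: v_def stage_def queue_of_def)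
  let ?f = "\<lambda>v'. if queue_of v' = k then 1 - r (stage I v') else 1"
  have "unselected I 0 k = ?f v * (\<Prod>v'\<in>{0..<I} - {v}. ?f v')"
    unfolding unselected_def by (rule prod.remove) (use v in auto)
  also have "\<dots> \<le> ?f v * 1"
    using r_bounds by (intro mult_left_mono prod_le_1) auto
  finally show ?thesis using v i by simp
qed

text \<open>\<open>e k\<close> is the relative loss of weight of a customer of queue
  \<open>k\<close> over one cycle. As there are finitely many queues, the minimum is still
  positive.\<close>

lemma cycle_contraction:
  obtains \<epsilon> where "0 < \<epsilon>" "\<epsilon> \<le> 1" "\<And>q. lin I 0 q \<le> (1 - \<epsilon>) * work q"
proof -
  define e where "e k = (1 - theta k) * (1 - unselected I 0 k)" for k
  have e: "0 < e k" "e k \<le> 1" for k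
    using theta_bounds[of k] unselected_cycle[of k] unselected_bounds[of I 0 k] by (auto simp: e_def intro!: mult_le_one)
  have w: "weight I 0 k = (1 - e k) / mu k" for k
    by (simp add: weight_def e_def algebra_simps)
  define \<epsilon> where "\<epsilon> = Min (range e)"
  have le: "\<epsilon> \<le> e k" for k unfolding \<epsilon>_def by (rule Min_le) auto
  have pos: "0 < \<epsilon>" unfolding \<epsilon>_def using e by (subst Min_gr_iff) auto
  have "lin I 0 q \<le> (1 - \<epsilon>) * work q" for q
    unfolding lin_def work_def sum_distrib_left
  proof (rule sum_mono)
    fix j
    have "(1 - e j) * (real (q j) / mu j) \<le> (1 - \<epsilon>) * (real (q j) / mu j)"
      using le[of j] mu_pos[of j] by (intro mult_right_mono) auto
    then show "weight I 0 j * real (q j) \<le> (1 - \<epsilon>) * (real (q j) / mu j)" by (simp add: w)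
  qed
  moreover have "\<epsilon> \<le> 1" using le[of undefined] e(2)[of undefined] by linarith
  ultimately show ?thesis using that pos by blast
qed

lemma lin_le_work: "lin G v q \<le> work q"
  unfolding lin_def work_def
proof (rule sum_mono)
  fix j
  show "weight G v j * real (q j) \<le> real (q j) / mu j"
    using mult_right_mono[OF weight_bounds(2)[of G v j], of "real (q j)"] by simp
qed

lemma nn_integral_start_partition:
  assumes [measurable]: "f \<in> borel_measurable M"
  shows "(\<integral>\<^sup>+\<omega>. f \<omega> \<partial>M) = (\<integral>\<^sup>+q. \<integral>\<^sup>+\<omega>. f \<omega> * indicator (start_event q) \<omega> \<partial>M \<partial>count_space UNIV)"
  by (rule nn_integral_partition[OF initial_rv assms])

text \<open>The target is visit \<open>I\<close>, one full cycle after the start: there the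
  contraction applies and the queue vector has the law of \<open>Q0\<close> again.\<close>

lemma stationary_work_square:
  assumes steady: steady_state and sm: second_moments
  shows "(\<integral>\<^sup>+\<omega>. ennreal ((work (Q0 \<omega>))\<^sup>2) \<partial>M) < \<infinity>"
proof -
  obtain C where C: "0 \<le> C" and bound: "\<And>G q. (\<integral>\<^sup>+\<omega>. ennreal ((work (queue_at_visit G \<omega>))\<^sup>2) * indicator (start_event q) \<omega> \<partial>M)
    \<le> ennreal (lyapunov C G (Select 0 q)) * emeasure M (start_event q)"
    using second_moment_bound[OF sm] by blast
  obtain \<epsilon> where eps: "0 < \<epsilon>" "\<epsilon> \<le> 1" "\<And>q. lin I 0 q \<le> (1 - \<epsilon>) * work q"
    using cycle_contraction by blast
  obtain a C' where a: "0 \<le> a" "a < 1" "0 \<le> C'" and absorb: "\<And>w. 0 \<le> w \<Longrightarrow>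
      ((1 - \<epsilon>) * w + real I * drift_up)\<^sup>2 + (2 * work_coeff C * real I) * w + real I * const_term C I \<le> a * w\<^sup>2 + C'"
    using quadratic_absorb[OF eps(1,2), of "real I * drift_up" "2 * work_coeff C * real I" "real I * const_term C I"] by blast
  have lyapunov: "lyapunov C I (Select 0 q) \<le> a * (work q)\<^sup>2 + C'" for q
  proof -
    have "(lin I 0 q + real I * drift_up)\<^sup>2 \<le> ((1 - \<epsilon>) * work q + real I * drift_up)\<^sup>2"
      using eps(3) lin_nonneg drift_up_nonneg by (intro power_mono) auto
    then show ?thesis using absorb[of "work q"] by simp
  qed
  have "distr M (count_space UNIV) (queue_at_visit I) = distr M (count_space UNIV) Q0"
    using steady[unfolded steady_state_def, rule_format, of 1] by simp
  then have "(\<integral>\<^sup>+\<omega>. ennreal ((work (Q0 \<omega>))\<^sup>2) \<partial>M) \<le> ennreal (C' / (1 - a))"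
  proof (rule stationary_moment_bound[OF initial_rv queue_rv _ _ a])
    fix q
    have "ennreal (lyapunov C I (Select 0 q)) * emeasure M (start_event q)
        \<le> ennreal (a * (work q)\<^sup>2 + C') * emeasure M (start_event q)"
      by (intro mult_right_mono ennreal_leI lyapunov) simp
    with bound[of I q] show "(\<integral>\<^sup>+\<omega>. ennreal ((work (queue_at_visit I \<omega>))\<^sup>2) * indicator (start_event q) \<omega> \<partial>M)
        \<le> ennreal (a * (work q)\<^sup>2 + C') * emeasure M (start_event q)"
      by (rule order_trans)
  qed simp
  then show ?thesis by (rule le_less_trans) simp
qed

text \<open>At an arbitrary epoch the crude bound \<open>lin \<le> work\<close> suffices, since the
  squared work at the start is already integrable and the Lyapunov value is at most quadratic in
  it.\<close>

lemma work_square_finite: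
  assumes steady: steady_state and sm: second_moments
  shows "(\<integral>\<^sup>+\<omega>. ennreal ((work (queue_at_visit G \<omega>))\<^sup>2) \<partial>M) < \<infinity>"
proof -
  note initial_rv[measurable]
  obtain C where C: "0 \<le> C" and bound: "\<And>G q. (\<integral>\<^sup>+\<omega>. ennreal ((work (queue_at_visit G \<omega>))\<^sup>2) * indicator (start_event q) \<omega> \<partial>M)
    \<le> ennreal (lyapunov C G (Select 0 q)) * emeasure M (start_event q)"
    using second_moment_bound[OF sm] by blast
  define b where "b = real G * drift_up"
  define c where "c = 2 * work_coeff C * real G"
  define e where "e = real G * const_term C G"
  have nn: "0 \<le> b" "0 \<le> c" "0 \<le> e"
    using drift_up_nonneg work_coeff_nonneg[OF C] const_term_nonneg[OF C] by (simp_all add: b_def c_def e_def)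
  have lyapunov: "lyapunov C G (Select 0 q) \<le> (2 + c) * (work q)\<^sup>2 + (2 * b\<^sup>2 + c + e)" for q
  proof -
    have "(lin G 0 q + b)\<^sup>2 \<le> (work q + b)\<^sup>2"
      using lin_nonneg lin_le_work nn by (intro power_mono) auto
    also have "\<dots> \<le> 2 * (work q)\<^sup>2 + 2 * b\<^sup>2"
      using zero_le_power2[of "work q - b"] by (simp add: power2_sum power2_diff)
    finally have 1: "(lin G 0 q + b)\<^sup>2 \<le> 2 * (work q)\<^sup>2 + 2 * b\<^sup>2" .
    have "2 * work q \<le> (work q)\<^sup>2 + 1"
      using zero_le_power2[of "work q - 1"] by (simp add: power2_diff)
    then have "work q \<le> (work q)\<^sup>2 + 1" using work_nonneg[of q] by linarith
    then have "c * work q \<le> c * ((work q)\<^sup>2 + 1)" using nn by (intro mult_left_mono)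
    moreover have "lyapunov C G (Select 0 q) = (lin G 0 q + b)\<^sup>2 + c * work q + e"
      by (simp add: b_def c_def e_def)
    ultimately show ?thesis using 1 unfolding distrib_left distrib_right by linarith
  qed
  have "(\<integral>\<^sup>+\<omega>. ennreal ((work (queue_at_visit G \<omega>))\<^sup>2) \<partial>M) =
      (\<integral>\<^sup>+q. \<integral>\<^sup>+\<omega>. ennreal ((work (queue_at_visit G \<omega>))\<^sup>2) * indicator (start_event q) \<omega> \<partial>M \<partial>count_space UNIV)"
    by (rule nn_integral_start_partition) measurable
  also have "\<dots> \<le> (\<integral>\<^sup>+q. \<integral>\<^sup>+\<omega>. ennreal ((2 + c) * (work (Q0 \<omega>))\<^sup>2 + (2 * b\<^sup>2 + c + e)) * indicator (start_event q) \<omega> \<partial>M \<partial>count_space UNIV)"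
  proof (rule nn_integral_mono)
    fix q
    note bound[of G q]
    also have "ennreal (lyapunov C G (Select 0 q)) * emeasure M (start_event q) \<le>
        ennreal ((2 + c) * (work q)\<^sup>2 + (2 * b\<^sup>2 + c + e)) * emeasure M (start_event q)"
      by (intro mult_right_mono ennreal_leI lyapunov) simp
    also have "\<dots> = (\<integral>\<^sup>+\<omega>. ennreal ((2 + c) * (work q)\<^sup>2 + (2 * b\<^sup>2 + c + e)) * indicator (start_event q) \<omega> \<partial>M)"
      by (rule nn_integral_cmult_indicator[symmetric]) measurable
    also have "\<dots> = (\<integral>\<^sup>+\<omega>. ennreal ((2 + c) * (work (Q0 \<omega>))\<^sup>2 + (2 * b\<^sup>2 + c + e)) * indicator (start_event q) \<omega> \<partial>M)"
      by (intro nn_integral_cong) (auto simp: indicator_def)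
    finally show "(\<integral>\<^sup>+\<omega>. ennreal ((work (queue_at_visit G \<omega>))\<^sup>2) * indicator (start_event q) \<omega> \<partial>M) \<le> \<dots>" .
  qed
  also have "\<dots> = (\<integral>\<^sup>+\<omega>. ennreal ((2 + c) * (work (Q0 \<omega>))\<^sup>2 + (2 * b\<^sup>2 + c + e)) \<partial>M)"
    by (rule nn_integral_start_partition[symmetric]) measurable
  also have "\<dots> = ennreal (2 + c) * (\<integral>\<^sup>+\<omega>. ennreal ((work (Q0 \<omega>))\<^sup>2) \<partial>M) + ennreal (2 * b\<^sup>2 + c + e)"
    using nn by (simp add: ennreal_plus ennreal_mult nn_integral_add nn_integral_cmult emeasure_space_1)
  also have "\<dots> < \<infinity>"
    using stationary_work_square[OF assms] by (simp add: ennreal_mult_less_top ennreal_add_less_top)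
  finally show ?thesis .
qed

lemma queue_component_rv[measurable]: "random_variable (count_space UNIV) (\<lambda>\<omega>. queue_at_visit v \<omega> j)"
  by (rule measurable_compose[OF queue_rv, where g="\<lambda>q. q j"]) simp

lemma integrable_queue_product:
  assumes "steady_state" "second_moments"
  shows "integrable M (\<lambda>\<omega>. real (queue_at_visit G \<omega> j) * real (queue_at_visit G \<omega> k))"
proof (rule Bochner_Integration.integrable_bound)
  show "integrable M (\<lambda>\<omega>. mu j * mu k * (work (queue_at_visit G \<omega>))\<^sup>2)"
    using work_square_finite[OF assms, of G]
    by (intro integrable_mult_right integrableI_nonneg) auto
  show "AE \<omega> in M. norm (real (queue_at_visit G \<omega> j) * real (queue_at_visit G \<omega> k))
      \<le> norm (mu j * mu k * (work (queue_at_visit G \<omega>))\<^sup>2)"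
  proof (rule AE_I2)
    fix \<omega>
    let ?q = "queue_at_visit G \<omega>"
    have "real (?q j) * real (?q k) \<le> (mu j * work ?q) * (mu k * work ?q)"
      by (intro mult_mono work_component mult_nonneg_nonneg) (simp_all add: mu_pos less_imp_le)
    then show "norm (real (?q j) * real (?q k)) \<le> norm (mu j * mu k * (work ?q)\<^sup>2)"
      using mu_pos[of j] mu_pos[of k] by (simp add: abs_mult power2_eq_square mult_ac)
  qed
qed measurable

section \<open>Necessity: arrivals collected while a queue is not served\<close>

fun contents :: "'k state \<Rightarrow> 'k \<Rightarrow> nat" where
  "contents (Select v q) = q"
| "contents (Serve v l q z) = q"

fun serving :: "'k \<Rightarrow> 'k state \<Rightarrow> bool" where
  "serving k (Select v q) \<longleftrightarrow> False"
| "serving k (Serve v l q z) \<longleftrightarrow> z \<noteq> 0 \<and> queue_of v = k"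

fun switching :: "'k state \<Rightarrow> bool" where
  "switching (Select v q) \<longleftrightarrow> False"
| "switching (Serve v l q z) \<longleftrightarrow> z = 0"

lemma contents_next_state: "\<not> serving j c \<Longrightarrow> contents c j \<le> contents (next_state c b) j"
  by (cases c) auto

lemma contents_next_state_timed: "\<not> serving j c \<Longrightarrow> src c \<in> timed \<Longrightarrow> contents (next_state c b) j = contents c j + b j"
  by (cases c) auto

lemma contents_mono:
  assumes "n \<le> m" "\<And>i. n \<le> i \<Longrightarrow> i < m \<Longrightarrow> \<not> serving j (state_at i \<omega>)"
  shows "contents (state_at n \<omega>) j \<le> contents (state_at m \<omega>) j"
  using assms
proof (induction m rule: dec_induct)
  case (step m)
  then show ?case using contents_next_state[of j "state_at m \<omega>" "input_at m \<omega>"] by (force simp: state_at_Suc)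
qed simp

lemma contents_input:
  assumes "n < m" "\<And>i. n \<le> i \<Longrightarrow> i < m \<Longrightarrow> \<not> serving j (state_at i \<omega>)" "src (state_at n \<omega>) \<in> timed"
  shows "contents (state_at n \<omega>) j + input_at n \<omega> j \<le> contents (state_at m \<omega>) j"
proof -
  have "contents (state_at n \<omega>) j + input_at n \<omega> j = contents (state_at (Suc n) \<omega>) j"
    using contents_next_state_timed[of j "state_at n \<omega>" "input_at n \<omega>"] assms by (simp add: state_at_Suc)
  also have "\<dots> \<le> contents (state_at m \<omega>) j" by (rule contents_mono) (use assms in auto)
  finally show ?thesis .
qed

lemma visit_mono: "n \<le> m \<Longrightarrow> visit (state_at n \<omega>) \<le> visit (state_at m \<omega>)"
proof (rule lift_Suc_mono_le[of "\<lambda>n. visit (state_at n \<omega>)"])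
  fix n show "visit (state_at n \<omega>) \<le> visit (state_at (Suc n) \<omega>)"
    by (cases "state_at n \<omega>") (auto simp: state_at_Suc)
qed

lemma markov_step_total:
  fixes \<phi> :: "'k state \<Rightarrow> ('k \<Rightarrow> nat) \<Rightarrow> ennreal"
  shows "(\<integral>\<^sup>+\<omega>. \<phi> (state_at n \<omega>) (input_at n \<omega>) \<partial>M) = (\<integral>\<^sup>+\<omega>. \<integral>\<^sup>+\<omega>'. \<phi> (state_at n \<omega>) (input (src (state_at n \<omega>)) \<omega>') \<partial>M \<partial>M)"
proof -
  have "(\<lambda>\<omega>. \<phi> (state_at n \<omega>) (input_at n \<omega>)) \<in> borel_measurable M"
    by (rule measurable_compose_countable[where f="\<lambda>c \<omega>. \<phi> c (input_at n \<omega>)" and g="state_at n"]) measurable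
  from nn_integral_start_partition[OF this]
    nn_integral_start_partition[of "\<lambda>\<omega>. \<integral>\<^sup>+\<omega>'. \<phi> (state_at n \<omega>) (input (src (state_at n \<omega>)) \<omega>') \<partial>M"]
  show ?thesis unfolding markov_step by simp
qed

text \<open>At the fixed step \<open>n\<close> the input is fresh given the state, so a bound for
  all states of \<open>A\<close> is multiplied by the probability of being in \<open>A\<close>. The
  bound \<open>e\<close> may be infinite.\<close>

lemma input_lower_bound:
  assumes e: "\<And>c. c \<in> A \<Longrightarrow> e \<le> (\<integral>\<^sup>+\<omega>. f (input (src c) \<omega> j) \<partial>M)"
  shows "e * emeasure M {\<omega> \<in> space M. state_at n \<omega> \<in> A} \<le> (\<integral>\<^sup>+\<omega>. f (input_at n \<omega> j) * indicator A (state_at n \<omega>) \<partial>M)"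
proof -
  have "e * emeasure M {\<omega> \<in> space M. state_at n \<omega> \<in> A} = (\<integral>\<^sup>+\<omega>. e * indicator {\<omega> \<in> space M. state_at n \<omega> \<in> A} \<omega> \<partial>M)"
    by (rule nn_integral_cmult_indicator[symmetric]) measurable
  also have "\<dots> \<le> (\<integral>\<^sup>+\<omega>. \<integral>\<^sup>+\<omega>'. f (input (src (state_at n \<omega>)) \<omega>' j) * indicator A (state_at n \<omega>) \<partial>M \<partial>M)"
    using e by (intro nn_integral_mono) (auto simp: indicator_def)
  also have "\<dots> = (\<integral>\<^sup>+\<omega>. f (input_at n \<omega> j) * indicator A (state_at n \<omega>) \<partial>M)"
    by (rule markov_step_total[of "\<lambda>c b. f (b j) * indicator A c", symmetric])
  finally show ?thesis .
qed

text \<open>Visit \<open>v + 1\<close> is reached almost surely and can be entered only from a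
  switching state of visit \<open>v\<close>. The step at which this happens is random, but there are
  countably many, so one of them has positive probability.\<close>

lemma exists_switching:
  obtains n where "0 < emeasure M {\<omega> \<in> space M. state_at n \<omega> \<in> {c. switching c \<and> visit c = v}}"
proof (rule ccontr)
  assume "\<not> thesis"
  then have "AE \<omega> in M. \<not> (switching (state_at n \<omega>) \<and> visit (state_at n \<omega>) = v)" for n
    using that by (intro AE_I[of _ _ "{\<omega> \<in> space M. state_at n \<omega> \<in> {c. switching c \<and> visit c = v}}"]) (auto simp: zero_less_iff_neq_zero)
  then have "AE \<omega> in M. \<forall>n. \<not> (switching (state_at n \<omega>) \<and> visit (state_at n \<omega>) = v)" by (simp add: AE_all_countable)
  moreover note AE_reach[of "Suc v"]
  ultimately have "AE \<omega> in M. False"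
  proof eventually_elim
    case (elim \<omega>)
    then obtain m where m: "state_at m \<omega> = Select (Suc v) (queue_at_visit (Suc v) \<omega>)" by blast
    then obtain n where "m = Suc n" by (cases m) auto
    then have "switching (state_at n \<omega>) \<and> visit (state_at n \<omega>) = v"
      using m by (cases "state_at n \<omega>") (auto simp: state_at_Suc split: if_splits)
    then show False using elim by blast
  qed
  then show False by simp
qed

lemma integrable_dur_square:
  assumes le: "(ennreal ((lam j)\<^sup>2) * (\<integral>\<^sup>+\<omega>. ennreal ((dur x \<omega>)\<^sup>2) \<partial>M)) * P \<le> F" and P: "0 < P" and F: "F < \<infinity>"
  shows "integrable M (\<lambda>\<omega>. (dur x \<omega>)\<^sup>2)"
proof (rule integrableI_nonneg)
  show "(\<integral>\<^sup>+\<omega>. ennreal ((dur x \<omega>)\<^sup>2) \<partial>M) < \<infinity>"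
  proof (rule ccontr)
    assume "\<not> (\<integral>\<^sup>+\<omega>. ennreal ((dur x \<omega>)\<^sup>2) \<partial>M) < \<infinity>"
    then have "(\<integral>\<^sup>+\<omega>. ennreal ((dur x \<omega>)\<^sup>2) \<partial>M) = \<infinity>" by (simp add: not_less top_unique)
    then show False using le P F lam_pos[of j]
      by (auto simp: ennreal_mult_top ennreal_top_mult top_unique split: if_splits)
  qed
qed auto

lemma input_square_ge:
  assumes "x \<in> timed"
  shows "ennreal ((lam j)\<^sup>2) * (\<integral>\<^sup>+\<omega>. ennreal ((dur x \<omega>)\<^sup>2) \<partial>M) \<le> (\<integral>\<^sup>+\<omega>. of_nat ((input x \<omega> j)\<^sup>2) \<partial>M)"
  unfolding input_dur[OF timed_not(2)[OF assms]] by (rule nn_integral_N_dur_sq_ge[OF timed_not(1)[OF assms]])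

text \<open>Nothing is served between the switchover and the next polling epoch, so the arrivals at
  any queue \<open>j\<close> during the switchover are all still present there.\<close>

lemma switchover_square:
  assumes fin: "(\<integral>\<^sup>+\<omega>. of_nat ((queue_at_visit (Suc v) \<omega> j)\<^sup>2) \<partial>M) < \<infinity>"
  shows "integrable (V_law (stage I v)) (\<lambda>x. x\<^sup>2)"
proof -
  let ?A = "{c. switching c \<and> visit c = v}"
  obtain n where n: "0 < emeasure M {\<omega> \<in> space M. state_at n \<omega> \<in> ?A}" using exists_switching by blast
  let ?e = "ennreal ((lam j)\<^sup>2) * (\<integral>\<^sup>+\<omega>. ennreal ((dur (Switchover v) \<omega>)\<^sup>2) \<partial>M)"
  have "?e * emeasure M {\<omega> \<in> space M. state_at n \<omega> \<in> ?A} \<le> (\<integral>\<^sup>+\<omega>. of_nat ((input_at n \<omega> j)\<^sup>2) * indicator ?A (state_at n \<omega>) \<partial>M)"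
  proof (rule input_lower_bound)
    fix c assume "c \<in> ?A"
    then have "src c = Switchover v" by (cases c) auto
    then show "?e \<le> (\<integral>\<^sup>+\<omega>. of_nat ((input (src c) \<omega> j)\<^sup>2) \<partial>M)"
      using input_square_ge[of "Switchover v" j] by simp
  qed
  also have "\<dots> \<le> (\<integral>\<^sup>+\<omega>. of_nat ((queue_at_visit (Suc v) \<omega> j)\<^sup>2) \<partial>M)"
  proof (rule nn_integral_mono)
    fix \<omega> assume \<omega>: "\<omega> \<in> space M"
    show "of_nat ((input_at n \<omega> j)\<^sup>2) * indicator ?A (state_at n \<omega>) \<le> (of_nat ((queue_at_visit (Suc v) \<omega> j)\<^sup>2) :: ennreal)"
    proof (cases "state_at n \<omega> \<in> ?A")
      case True
      then obtain l q where "state_at n \<omega> = Serve v l q 0" by (cases "state_at n \<omega>") auto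
      then have "state_at (Suc n) \<omega> = Select (Suc v) (\<lambda>j. q j + input_at n \<omega> j)" by (simp add: state_at_Suc)
      from state_at_Select[OF \<omega> this] have "input_at n \<omega> j \<le> queue_at_visit (Suc v) \<omega> j" by (metis le_add2)
      then have "(input_at n \<omega> j)\<^sup>2 \<le> (queue_at_visit (Suc v) \<omega> j)\<^sup>2" by (rule power_mono) simp
      then show ?thesis using True by (simp del: of_nat_power)
    qed simp
  qed
  finally have "integrable M (\<lambda>\<omega>. (dur (Switchover v) \<omega>)\<^sup>2)"
    by (rule integrable_dur_square[OF _ n fin])
  then show ?thesis by (simp only: dur_square_law)
qed

text \<open>In visit \<open>v\<close> only queue \<open>k\<close> loses customers, hence what
  arrives at \<open>j\<close> during a service is still present at the next polling epoch. Fixing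
  the step \<open>n\<close> reduces the random position of the service to an event of positive
  probability.\<close>

lemma service_square:
  assumes pos: "0 < emeasure M {\<omega> \<in> space M. state_at n \<omega> \<in> {c. serving k c \<and> visit c = v}}"
    and j: "j \<noteq> k" and fin: "(\<integral>\<^sup>+\<omega>. of_nat ((queue_at_visit (Suc v) \<omega> j)\<^sup>2) \<partial>M) < \<infinity>"
  shows "integrable (S_law k) (\<lambda>x. x\<^sup>2)"
proof -
  let ?A = "{c. serving k c \<and> visit c = v}"
  have "?A \<noteq> {}" using pos by (metis (no_types, lifting) Collect_empty_eq emeasure_empty empty_iff not_gr_zero)
  then obtain c where "c \<in> ?A" by blast
  then have k: "queue_of v = k" by (cases c) auto
  let ?e = "ennreal ((lam j)\<^sup>2) * (\<integral>\<^sup>+\<omega>. ennreal ((dur (Service v 0) \<omega>)\<^sup>2) \<partial>M)"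
  \<comment> \<open>Different states of \<open>?A\<close> may be at different services
    \<open>l\<close> of the visit; all of them have the same law, so one bound \<open>?e\<close>
    serves all.\<close>
  have e: "(\<integral>\<^sup>+\<omega>. ennreal ((dur (Service v l) \<omega>)\<^sup>2) \<partial>M) = (\<integral>\<^sup>+x. ennreal (x\<^sup>2) \<partial>S_law k)" for l
    using service_rv[of v l] by (simp add: k[symmetric] queue_of_def service_law[of v l, symmetric] nn_integral_distr)
  have "?e * emeasure M {\<omega> \<in> space M. state_at n \<omega> \<in> ?A} \<le> (\<integral>\<^sup>+\<omega>. of_nat ((input_at n \<omega> j)\<^sup>2) * indicator ?A (state_at n \<omega>) \<partial>M)"
  proof (rule input_lower_bound)
    fix c assume "c \<in> ?A"
    then obtain l where "src c = Service v l" by (cases c) auto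
    then show "?e \<le> (\<integral>\<^sup>+\<omega>. of_nat ((input (src c) \<omega> j)\<^sup>2) \<partial>M)"
      using input_square_ge[of "Service v l" j] unfolding e by auto
  qed
  also have "\<dots> \<le> (\<integral>\<^sup>+\<omega>. of_nat ((queue_at_visit (Suc v) \<omega> j)\<^sup>2) \<partial>M)"
  proof (rule nn_integral_mono_AE)
    show "AE \<omega> in M. of_nat ((input_at n \<omega> j)\<^sup>2) * indicator ?A (state_at n \<omega>) \<le> (of_nat ((queue_at_visit (Suc v) \<omega> j)\<^sup>2) :: ennreal)"
      using AE_reach[of "Suc v"]
    proof eventually_elim
      case (elim \<omega>)
      then obtain m where m: "state_at m \<omega> = Select (Suc v) (queue_at_visit (Suc v) \<omega>)" "\<And>i. i < m \<Longrightarrow> visit (state_at i \<omega>) < Suc v"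
        by blast
      show ?case
      proof (cases "state_at n \<omega> \<in> ?A")
        case True
        have "n < m"
          using visit_mono[of m n \<omega>] m(1) True by (cases "n < m") auto
        moreover have "\<not> serving j (state_at i \<omega>)" if "n \<le> i" "i < m" for i
        proof -
          have "visit (state_at i \<omega>) = v"
            using visit_mono[OF that(1), of \<omega>] m(2)[OF that(2)] True by simp
          then show ?thesis using k j by (cases "state_at i \<omega>") auto
        qed
        moreover have "src (state_at n \<omega>) \<in> timed" using True by (cases "state_at n \<omega>") auto
        ultimately have "contents (state_at n \<omega>) j + input_at n \<omega> j \<le> contents (state_at m \<omega>) j" by (rule contents_input)
        then have "input_at n \<omega> j \<le> queue_at_visit (Suc v) \<omega> j" using m(1) by simp
        then have "(input_at n \<omega> j)\<^sup>2 \<le> (queue_at_visit (Suc v) \<omega> j)\<^sup>2" by (rule power_mono) simp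
        then show ?thesis using True by (simp del: of_nat_power)
      qed simp
    qed
  qed
  finally have "integrable M (\<lambda>\<omega>. (dur (Service v 0) \<omega>)\<^sup>2)"
    by (rule integrable_dur_square[OF _ pos fin])
  then show ?thesis by (simp only: dur_square_law k)
qed

text \<open>If queue \<open>k\<close> were almost surely never served in the cycle, it could only
  grow, and by a positive mean amount during a switchover of positive mean length. This contradicts
  equality of the finite means at visits 0 and \<open>I\<close>.\<close>

lemma exists_service:
  assumes steady: steady_state and fin: "(\<integral>\<^sup>+\<omega>. of_nat (Q0 \<omega> k) \<partial>M) < \<infinity>"
  obtains n v where "v < I" "0 < emeasure M {\<omega> \<in> space M. state_at n \<omega> \<in> {c. serving k c \<and> visit c = v}}"
proof (rule ccontr)
  note obtained = that
  assume "\<not> thesis"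
  then have none: "emeasure M {\<omega> \<in> space M. state_at n \<omega> \<in> {c. serving k c \<and> visit c = v}} = 0" if "v < I" for n v
    using obtained[OF that, of n] zero_less_iff_neq_zero by blast
  note initial_rv[measurable]
  have "AE \<omega> in M. \<not> (serving k (state_at n \<omega>) \<and> visit (state_at n \<omega>) = v)" if "v < I" for n v
    using none[OF that]
    by (intro AE_I[of _ _ "{\<omega> \<in> space M. state_at n \<omega> \<in> {c. serving k c \<and> visit c = v}}"]) auto
  then have ns: "AE \<omega> in M. \<forall>n v. v < I \<longrightarrow> \<not> (serving k (state_at n \<omega>) \<and> visit (state_at n \<omega>) = v)"
    by (simp add: AE_all_countable)
  obtain i where i: "i \<in> {1..I}" "0 < s i"
  proof (rule ccontr)
    assume "\<not> thesis"
    then have "(\<Sum>i\<in>{1..I}. s i) \<le> 0" using that by (intro sum_nonpos) force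
    then show False using s_sum_pos by simp
  qed
  define v where "v = i - 1"
  have v: "v < I" "stage I v = i" using i by (auto simp: v_def stage_def)
  let ?A = "{c. switching c \<and> visit c = v}"
  obtain n where n: "0 < emeasure M {\<omega> \<in> space M. state_at n \<omega> \<in> ?A}" using exists_switching by blast
  let ?g = "\<lambda>\<omega>. of_nat (input_at n \<omega> k) * indicator ?A (state_at n \<omega>) :: ennreal"
  have gm: "?g \<in> borel_measurable M"
  proof -
    have "(\<lambda>\<omega>. input_at n \<omega> k) \<in> measurable M (count_space UNIV)"
      by (rule measurable_compose[OF input_at_rv, where g="\<lambda>b. b k"]) simp
    then show ?thesis by measurable
  qed
  have q0: "(\<lambda>\<omega>. of_nat (Q0 \<omega> k) :: ennreal) \<in> borel_measurable M"
    by (rule measurable_compose[OF initial_rv, where g="\<lambda>q. of_nat (q k)"]) simp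
  have grow: "AE \<omega> in M. of_nat (Q0 \<omega> k) + ?g \<omega> \<le> of_nat (queue_at_visit I \<omega> k)"
    using ns AE_reach[of I]
  proof eventually_elim
    case (elim \<omega>)
    then obtain m where m: "state_at m \<omega> = Select I (queue_at_visit I \<omega>)" "\<And>i. i < m \<Longrightarrow> visit (state_at i \<omega>) < I"
      by blast
    have ns: "\<not> serving k (state_at i \<omega>)" if "i < m" for i
      using elim(1) m(2)[OF that] by blast
    have mono: "contents (state_at 0 \<omega>) k \<le> contents (state_at n' \<omega>) k" if "n' \<le> m" for n'
      by (rule contents_mono) (use that ns in auto)
    show ?case
    proof (cases "state_at n \<omega> \<in> ?A")
      case True
      have nm: "n < m" using visit_mono[of m n \<omega>] m(1) True v(1) by (cases "n < m") auto
      moreover have "src (state_at n \<omega>) \<in> timed" using True by (cases "state_at n \<omega>") auto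
      ultimately have "contents (state_at n \<omega>) k + input_at n \<omega> k \<le> contents (state_at m \<omega>) k"
        using ns by (intro contents_input) auto
      then have "Q0 \<omega> k + input_at n \<omega> k \<le> queue_at_visit I \<omega> k" using mono[of n] m(1) nm by simp
      then have "(of_nat (Q0 \<omega> k + input_at n \<omega> k) :: ennreal) \<le> of_nat (queue_at_visit I \<omega> k)" by (simp only: of_nat_le_iff)
      then show ?thesis using True by simp
    next
      case False
      then show ?thesis using mono[of m] m(1) by simp
    qed
  qed
  have "distr M (count_space UNIV) (queue_at_visit I) = distr M (count_space UNIV) Q0"
    using steady[unfolded steady_state_def, rule_format, of 1] by simp
  then have same: "(\<integral>\<^sup>+\<omega>. of_nat (queue_at_visit I \<omega> k) \<partial>M) = (\<integral>\<^sup>+\<omega>. of_nat (Q0 \<omega> k) \<partial>M)"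
    using nn_integral_distr[OF queue_rv[of I], of "\<lambda>q. of_nat (q k)"] nn_integral_distr[OF initial_rv, of "\<lambda>q. of_nat (q k)"]
    by simp
  have "ennreal (lam k * s i) * emeasure M {\<omega> \<in> space M. state_at n \<omega> \<in> ?A} \<le> (\<integral>\<^sup>+\<omega>. ?g \<omega> \<partial>M)"
  proof (rule input_lower_bound)
    fix c assume "c \<in> ?A"
    then have c: "src c = Switchover v" by (cases c) auto
    have "(\<integral>\<^sup>+\<omega>. of_nat (N k (dur (Switchover v) \<omega>) \<omega>) \<partial>M) = (\<integral>\<^sup>+\<omega>. ennreal (real (N k (dur (Switchover v) \<omega>) \<omega>)) \<partial>M)"
      by (simp add: ennreal_of_nat_eq_real_of_nat)
    also have "\<dots> = ennreal (lam k * dur_mean (Switchover v))"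
      using has_bochner_integral_N_dur[OF timed_not(1), of "Switchover v" k]
      by (subst nn_integral_eq_integral) (auto simp: has_bochner_integral_iff)
    finally show "ennreal (lam k * s i) \<le> (\<integral>\<^sup>+\<omega>. of_nat (input (src c) \<omega> k) \<partial>M)"
      by (simp add: c input_dur dur_mean_def v(2) image_iff)
  qed
  moreover have pos: "0 < ennreal (lam k * s i) * emeasure M {\<omega> \<in> space M. state_at n \<omega> \<in> ?A}"
    using n i lam_pos[of k] by (simp add: ennreal_zero_less_mult_iff)
  ultimately have g: "0 < (\<integral>\<^sup>+\<omega>. ?g \<omega> \<partial>M)" by (rule less_le_trans[rotated])
  have "(\<integral>\<^sup>+\<omega>. of_nat (Q0 \<omega> k) \<partial>M) + (\<integral>\<^sup>+\<omega>. ?g \<omega> \<partial>M) \<le> (\<integral>\<^sup>+\<omega>. of_nat (Q0 \<omega> k) \<partial>M)"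
    using nn_integral_mono_AE[OF grow] unfolding same nn_integral_add[OF q0 gm] .
  \<comment> \<open>Finiteness of the mean is what permits the cancellation in the extended
    reals.\<close>
  moreover have "y \<le> 0" if "x + y \<le> x" "x < \<infinity>" for x y :: ennreal
    using that ennreal_add_left_cancel_le[of x y 0] by auto
  ultimately show False using fin g not_less by blast
qed

theorem second_moments_iff:
  assumes K: "CARD('k) \<ge> 2" and steady: steady_state
  shows "(\<forall>i\<in>{1..I}. \<forall>j k. integrable M (\<lambda>\<omega>. real (Q_at i \<omega> j) * real (Q_at i \<omega> k))) \<longleftrightarrow> second_moments"
proof
  assume "second_moments"
  then show "\<forall>i\<in>{1..I}. \<forall>j k. integrable M (\<lambda>\<omega>. real (Q_at i \<omega> j) * real (Q_at i \<omega> k))"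
    using integrable_queue_product[OF steady] by (simp add: Q_at_def)
next
  assume int: "\<forall>i\<in>{1..I}. \<forall>j k. integrable M (\<lambda>\<omega>. real (Q_at i \<omega> j) * real (Q_at i \<omega> k))"
  note initial_rv[measurable]
  have sq: "(\<integral>\<^sup>+\<omega>. of_nat ((queue_at_visit v \<omega> j)\<^sup>2) \<partial>M) < \<infinity>" if "v < I" for v j
  proof -
    have "Suc v \<in> {1..I}" using that by simp
    then have "integrable M (\<lambda>\<omega>. real (Q_at (Suc v) \<omega> j) * real (Q_at (Suc v) \<omega> j))" using int by blast
    then have "(\<integral>\<^sup>+\<omega>. ennreal ((real (queue_at_visit v \<omega> j))\<^sup>2) \<partial>M) < \<infinity>"
      by (subst nn_integral_eq_integral) (simp_all add: Q_at_def power2_eq_square)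
    then show ?thesis by (simp add: ennreal_of_nat_eq_real_of_nat)
  qed
  \<comment> \<open>What happens in the last visit \<open>I - 1\<close> of the cycle is observed at
    epoch \<open>I\<close>, which the hypothesis on the stages \<open>1, ..., I\<close> of the first
    cycle does not include; stationarity transfers the bound from epoch 0.\<close>
  have "distr M (count_space UNIV) (queue_at_visit I) = distr M (count_space UNIV) Q0"
    using steady[unfolded steady_state_def, rule_format, of 1] by simp
  then have "(\<integral>\<^sup>+\<omega>. of_nat ((queue_at_visit I \<omega> j)\<^sup>2) \<partial>M) = (\<integral>\<^sup>+\<omega>. of_nat ((Q0 \<omega> j)\<^sup>2) \<partial>M)" for j
    using nn_integral_distr[OF queue_rv[of I], of "\<lambda>q. of_nat ((q j)\<^sup>2)"] nn_integral_distr[OF initial_rv, of "\<lambda>q. of_nat ((q j)\<^sup>2)"]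
    by (simp del: of_nat_power)
  then have sq': "(\<integral>\<^sup>+\<omega>. of_nat ((queue_at_visit v \<omega> j)\<^sup>2) \<partial>M) < \<infinity>" if "v \<le> I" for v j
    using sq[of v j] sq[of 0 j] that I_pos by (cases "v = I") (auto simp del: of_nat_power)
  \<comment> \<open>For natural numbers the value is at most its square, so finite first moments are
    derived instead of being presupposed.\<close>
  have fin: "(\<integral>\<^sup>+\<omega>. of_nat (Q0 \<omega> k) \<partial>M) < \<infinity>" for k
  proof -
    have "(\<integral>\<^sup>+\<omega>. of_nat (Q0 \<omega> k) \<partial>M) \<le> (\<integral>\<^sup>+\<omega>. of_nat ((queue_at_visit 0 \<omega> k)\<^sup>2) \<partial>M)"
      by (intro nn_integral_mono) (auto simp: power2_eq_square simp del: of_nat_power of_nat_mult)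
    then show ?thesis using sq'[of 0 k] by (rule le_less_trans) simp
  qed
  show second_moments
    unfolding second_moments_def
  proof (intro conjI allI ballI)
    fix i assume i: "i \<in> {1..I}"
    then have "stage I (i - 1) = i" "Suc (i - 1) \<le> I" by (auto simp: stage_def)
    then show "integrable (V_law i) (\<lambda>x. x\<^sup>2)"
      using switchover_square[OF sq'[of "Suc (i - 1)" undefined]] by simp
  next
    fix k :: 'k
    have "\<exists>j. j \<noteq> k"
    proof (rule ccontr)
      assume "\<not> ?thesis"
      then have u: "UNIV = {k}" by auto
      have "CARD('k) = card {k}" using u by (rule arg_cong)
      then show False using K by simp
    qed
    then obtain j where j: "j \<noteq> k" by blast
    obtain n v where nv: "v < I" "0 < emeasure M {\<omega> \<in> space M. state_at n \<omega> \<in> {c. serving k c \<and> visit c = v}}"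
      using exists_service[OF steady fin] by blast
    show "integrable (S_law k) (\<lambda>x. x\<^sup>2)"
      by (rule service_square[OF nv(2) j sq']) (use nv in simp)
  qed
qed

end

theorem theorem5p2:
  fixes M :: "'a measure"
    and I :: nat
    and p :: "nat \<Rightarrow> 'k::finite"
    and lam mu :: "'k \<Rightarrow> real"
    and s :: "nat \<Rightarrow> real"
    and S_law :: "'k \<Rightarrow> real measure"
    and V_law :: "nat \<Rightarrow> real measure"
    and r :: "nat \<Rightarrow> real"
    and N :: "'k \<Rightarrow> real \<Rightarrow> 'a \<Rightarrow> nat"
    and S :: "nat \<Rightarrow> nat \<Rightarrow> 'a \<Rightarrow> real"
    and V :: "nat \<Rightarrow> 'a \<Rightarrow> real"
    and Y :: "nat \<Rightarrow> nat \<Rightarrow> 'a \<Rightarrow> nat"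
    and Q0 :: "'a \<Rightarrow> 'k \<Rightarrow> nat"
  assumes "CARD('k) \<ge> 2"
    and "bep_polling_system M I p lam mu s S_law V_law r N S V Y Q0"
    and "bep_polling_system.steady_state M I p N S V Y Q0"
  shows "(\<forall>i\<in>{1..I}. \<forall>j k. integrable M (\<lambda>\<omega>.
            real (bep_polling_system.Q_at I p N S V Y Q0 i \<omega> j) *
            real (bep_polling_system.Q_at I p N S V Y Q0 i \<omega> k)))
     \<longleftrightarrow> (\<forall>k. integrable (S_law k) (\<lambda>x. x\<^sup>2)) \<and>
         (\<forall>i\<in>{1..I}. integrable (V_law i) (\<lambda>x. x\<^sup>2))"
  using bep_polling_system.second_moments_iff[OF assms(2,1,3)]
  unfolding bep_polling_system.second_moments_def[OF assms(2)] .

end
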